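(* Let $n\geq2$ and $q\in[1,+\infty)$. There is a constant $C>0$ such that for every $\kappa$-covering $\left(\mathcal{P}_{\kappa|\rho(z_j)|}(z_j)\right)_{j\in\mathbb{N}}$ of $D\cap X$ and every function $g$ holomorphic on $X\cap D$ having a holomorphic extension $G\in L^q(D)$ to $D$, one has $$c^{(q)}_{\kappa,(z_j)_{j\in\mathbb{N}}}(g)\leq C\,\|G\|^q_{L^q(D)};$$ the constant $C$ does not depend on $g$, $G$ or the covering.
   Context: $D$ is a bounded strictly convex domain of $\mathbb{C}^n$, $D=\{z:\rho(z)<0\}$, where $\rho$ is a smooth strictly convex function on $\mathbb{C}^n$ whose gradient does not vanish in a neighborhood of the boundary $bD$; $D_r=\{z:\rho(z)<r\}$. $X=\{z: f(z)=0\}$ is an analytic set, where $f$ is a holomorphic function in a neighborhood of $\overline D$, assumed to be a minimal defining function of $X$; $X\cap D\neq\emptyset$ and $X\cap bD$ is transverse in the sense of tangent cones. Koranyi balls. For $\zeta$ near $bD$, $\eta_\zeta$ is the outer unit normal at $\zeta$ to $\{\rho=\rho(\zeta)\}$; completing it to an orthonormal basis $(\eta_\zeta,v_2,\ldots,v_n)$ of $\mathbb{C}^n$, put $\mathcal{P}_r(\zeta)=\{\zeta+\lambda\eta_\zeta+\sum_{i\geq2}\mu_iv_i:\ |\lambda|<r,\ |\mu_i|<r^{1/2}\}$, and $\delta(z,\zeta)=\inf\{\varepsilon>0:\zeta\in\mathcal{P}_\varepsilon(z)\}$. $\kappa$-coverings. Let $\kappa,c,\varepsilon_0>0$ be sufficiently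 small fixed constants and $\mathcal{V}\subset\mathbb{C}^n$ a set. A family $(\mathcal{P}_{\kappa|\rho(z_j)|}(z_j))_j$ is a $\kappa$-covering of $\mathcal{V}\cap(D\setminus D_{-\varepsilon_0})$ if $(z_j)$ can be renumbered as $(z_j^{(k)})_{k\in\mathbb{N},1\leq j\leq n_k}$ so that: $z_j^{(k)}\in bD_{-(1-c\kappa)^k\varepsilon_0}$; $\delta(z_i^{(k)},z_j^{(k)})\geq c\kappa(1-c\kappa)^k\varepsilon_0$ for $i\neq j$; and for all $k$ and all $z\in\mathcal{V}\cap bD_{-(1-c\kappa)^k\varepsilon_0}$ there is $j$ with $\delta(z,z_j^{(k)})<c\kappa(1-c\kappa)^k\varepsilon_0$. A $\kappa$-covering of $D\cap X$ is one for $\mathcal{V}=X$. Divided differences. For $z\in D$, $|v|=1$, $\varepsilon>0$: $\tau(z,v,\varepsilon)=\sup\{\tau>0:\ \rho(z+\lambda v)-\rho(z)<\varepsilon\text{ for all }|\lambda|<\tau\}$, and $\Lambda_{z,v}=\{\lambda\in\mathbb{C}:\ |\lambda|<3\kappa\,\tau(z,v,|\rho(z)|),\ z+\lambda v\in X\}$. Put $g_{z,v}[\lambda]=g(z+\lambda v)$ and, for pairwise distinct elements of $\Lambda_{z,v}$, $g_{z,v}[\lambda_1,\ldots,\lambda_{k+1}]=\frac{g_{z,v}[\lambda_1,\ldots,\lambda_k]-g_{z,v}[\lambda_2,\ldots,\lambda_{k+1}]}{\lambda_1-\lambda_{k+1}}$. The quantity $c^{(q)}$. By transversality, for each $j$ there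 is a unit vector $w_j$ in the complex tangent plane to $bD_{\rho(z_j)}$ at $z_j$ such that the orthogonal projection onto the hyperplane orthogonal to $w_j$ passing through $z_j$ is a $p_j$-sheeted covering of $X$ (locally). Let $w_1^*,\ldots,w_n^*$ be an orthonormal basis of $\mathbb{C}^n$ with $w_1^*=\eta_{z_j}$, $w_n^*=w_j$, and $\mathcal{P}'_\varepsilon(z_j)=\{z_j+z_1^*w_1^*+\ldots+z_{n-1}^*w_{n-1}^*:\ |z_1^*|<\varepsilon,\ |z_k^*|<\varepsilon^{1/2},\ k=2,\ldots,n-1\}$. Then $$c^{(q)}_{\kappa,(z_j)_{j\in\mathbb{N}}}(g)=\sum_{j=0}^\infty\int_{z'\in\mathcal{P}'_{2\kappa|\rho(z_j)|}(z_j)}\sum_{\lambda_1,\ldots,\lambda_k}|\rho(z_j)|^{q\frac{k-1}{2}+1}\left|g_{z',w_n^*}[\lambda_1,\ldots,\lambda_k]\right|^q\,dV_{n-1}(z'),$$ where the inner sum is over all $k\geq1$ and all pairwise distinct $\lambda_1,\ldots,\lambda_k\in\Lambda_{z',w_n^*}$, and $dV_{n-1}$ is Lebesgue measure on $\mathbb{C}^{n-1}$. *)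

theory Defs
  imports "HOL-Analysis.Analysis"
begin

definition hinner :: "complex^'n \<Rightarrow> complex^'n \<Rightarrow> complex" where
  "hinner x y = (\<Sum>i\<in>UNIV. x $ i * cnj (y $ i))"

text \<open>Families are indexed by \<open>1, \<dots>, n\<close> with \<open>n = CARD('n)\<close>; by counting, such a family is
  automatically a basis.\<close>

definition orthonormal_basis :: "(nat \<Rightarrow> complex^'n) \<Rightarrow> bool" where
  "orthonormal_basis b \<longleftrightarrow>
     (\<forall>i\<in>{1..CARD('n)}. \<forall>j\<in>{1..CARD('n)}. hinner (b i) (b j) = (if i = j then 1 else 0))"

primrec Ck :: "nat \<Rightarrow> ('a::real_normed_vector \<Rightarrow> 'b::real_normed_vector) \<Rightarrow> bool" where
  "Ck 0 f \<longleftrightarrow> continuous_on UNIV f"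
| "Ck (Suc k) f \<longleftrightarrow>
     f differentiable_on UNIV \<and> (\<forall>v. Ck k (\<lambda>x. frechet_derivative f (at x) v))"

definition smooth :: "('a::real_normed_vector \<Rightarrow> 'b::real_normed_vector) \<Rightarrow> bool" where
  "smooth f \<longleftrightarrow> (\<forall>k. Ck k f)"

definition strictly_convex :: "('a::real_vector \<Rightarrow> real) \<Rightarrow> bool" where
  "strictly_convex f \<longleftrightarrow>
     (\<forall>x y t. x \<noteq> y \<longrightarrow> 0 < t \<longrightarrow> t < 1 \<longrightarrow>
        f ((1 - t) *\<^sub>R x + t *\<^sub>R y) < (1 - t) * f x + t * f y)"

text \<open>The gradient with respect to the real inner product of the underlying real space.\<close>

definition grad :: "('a::real_inner \<Rightarrow> real) \<Rightarrow> 'a \<Rightarrow> 'a" where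
  "grad \<rho> z = (THE d. GDERIV \<rho> z :> d)"

definition unit_normal :: "('a::real_inner \<Rightarrow> real) \<Rightarrow> 'a \<Rightarrow> 'a" where
  "unit_normal \<rho> z = grad \<rho> z /\<^sub>R norm (grad \<rho> z)"

definition complex_tangent :: "(complex^'n \<Rightarrow> real) \<Rightarrow> complex^'n \<Rightarrow> (complex^'n) set" where
  "complex_tangent \<rho> z = {v. hinner v (grad \<rho> z) = 0}"

definition sublevel :: "('a \<Rightarrow> real) \<Rightarrow> real \<Rightarrow> 'a set" where
  "sublevel \<rho> r = {z. \<rho> z < r}"

text \<open>Complex differentiability in several variables, to be used on open sets.\<close>

definition holo_on :: "(complex^'n \<Rightarrow> complex) \<Rightarrow> (complex^'n) set \<Rightarrow> bool" where
  "holo_on f U \<longleftrightarrow>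
     (\<forall>z\<in>U. \<exists>f'. (f has_derivative f') (at z) \<and> (\<forall>c v. f' (c *s v) = c * f' v))"

text \<open>Holomorphy on a possibly singular analytic subset: locally the restriction of an ambient
  holomorphic function.\<close>

definition holo_on_subset :: "(complex^'n \<Rightarrow> complex) \<Rightarrow> (complex^'n) set \<Rightarrow> bool" where
  "holo_on_subset g A \<longleftrightarrow>
     (\<forall>z\<in>A. \<exists>U h. open U \<and> z \<in> U \<and> holo_on h U \<and> (\<forall>x\<in>U \<inter> A. h x = g x))"

text \<open>Every holomorphic function vanishing on \<open>{z \<in> N. f z = 0}\<close> over an open \<open>V \<subseteq> N\<close> is
  divisible by \<open>f\<close> on \<open>V\<close>.\<close>

definition minimal_defining :: "(complex^'n \<Rightarrow> complex) \<Rightarrow> (complex^'n) set \<Rightarrow> bool" where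
  "minimal_defining f N \<longleftrightarrow>
     (\<forall>V h. open V \<and> V \<subseteq> N \<and> holo_on h V \<and> (\<forall>z\<in>V. f z = 0 \<longrightarrow> h z = 0) \<longrightarrow>
        (\<exists>u. holo_on u V \<and> (\<forall>z\<in>V. h z = f z * u z)))"

definition tangent_cone :: "'a::real_normed_vector set \<Rightarrow> 'a \<Rightarrow> 'a set" where
  "tangent_cone A p =
     {v. \<exists>a t. (\<forall>i::nat. a i \<in> A \<and> 0 < t i) \<and> a \<longlonglongrightarrow> p \<and> (\<lambda>i. t i *\<^sub>R (a i - p)) \<longlonglongrightarrow> v}"

text \<open>For a complex hypersurface the tangent cone at \<open>p\<close> is a complex cone of pure dimension
  \<open>n - 1\<close>. It meets the complex tangent hyperplane of the boundary in the expected
  dimension \<open>n - 2\<close> exactly when it does not contain this hyperplane.\<close>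

definition transverse_at ::
    "(complex^'n \<Rightarrow> real) \<Rightarrow> (complex^'n) set \<Rightarrow> complex^'n \<Rightarrow> bool" where
  "transverse_at \<rho> X p \<longleftrightarrow> \<not> complex_tangent \<rho> p \<subseteq> tangent_cone X p"

text \<open>Below, \<open>S\<close> is an open subset of \<open>\<complex>\<^sup>n\<close> or of an affine complex subspace.\<close>

definition analytic_in :: "(complex^'n) set \<Rightarrow> (complex^'n) set \<Rightarrow> bool" where
  "analytic_in A S \<longleftrightarrow> A \<subseteq> S \<and>
     (\<forall>y\<in>S. \<exists>V F. open V \<and> y \<in> V \<and> finite F \<and> (\<forall>h\<in>F. holo_on h V) \<and>
        A \<inter> V = {z \<in> S \<inter> V. \<forall>h\<in>F. h z = 0})"

text \<open>Orthogonal projection onto the complex hyperplane through \<open>z0\<close> orthogonal to the unit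
  vector \<open>w\<close>.\<close>

definition hyperplane_proj :: "complex^'n \<Rightarrow> complex^'n \<Rightarrow> complex^'n \<Rightarrow> complex^'n" where
  "hyperplane_proj z0 w z = z - hinner (z - z0) w *s w"

text \<open>\<open>X \<inter> U\<close> is a \<open>p\<close>-sheeted (ramified) analytic covering of the image \<open>B\<close> of \<open>U\<close>: the
  projection is proper, and off a nowhere dense analytic set \<open>\<sigma>\<close>, over which no open part of
  \<open>X \<inter> U\<close> lies, \<open>X \<inter> U\<close> consists locally of \<open>p\<close> disjoint holomorphic graphs in the
  direction \<open>w\<close>. The value \<open>p = 0\<close> occurs when \<open>X \<inter> U\<close> is empty.\<close>

definition sheeted_covering ::
    "(complex^'n) set \<Rightarrow> (complex^'n) set \<Rightarrow> complex^'n \<Rightarrow> complex^'n \<Rightarrow> nat \<Rightarrow> bool" where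
  "sheeted_covering X U z0 w p \<longleftrightarrow>
     (let \<pi> = hyperplane_proj z0 w; B = \<pi> ` U in
      (\<forall>K. compact K \<and> K \<subseteq> B \<longrightarrow> compact {z \<in> X \<inter> U. \<pi> z \<in> K}) \<and>
      (\<exists>\<sigma>. analytic_in \<sigma> B \<and> B \<subseteq> closure (B - \<sigma>) \<and>
           X \<inter> U \<subseteq> closure {z \<in> X \<inter> U. \<pi> z \<notin> \<sigma>} \<and>
           (\<forall>y\<in>B - \<sigma>. \<exists>V a. open V \<and> y \<in> V \<and> (\<forall>i<p. holo_on (a i) V) \<and>
              (\<forall>x\<in>V \<inter> B. inj_on (\<lambda>i. a i x) {..<p} \<and>
                 {s. x + s *s w \<in> X \<inter> U} = (\<lambda>i. a i x) ` {..<p}))))"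

text \<open>The balls depend on how the unit normal is completed to an orthonormal basis, so the
  completion is a parameter: \<open>b \<zeta>\<close> is the basis used at \<open>\<zeta>\<close>.\<close>

definition adapted_frame ::
    "(complex^'n \<Rightarrow> real) \<Rightarrow> (complex^'n \<Rightarrow> nat \<Rightarrow> complex^'n) \<Rightarrow> bool" where
  "adapted_frame \<rho> b \<longleftrightarrow>
     (\<forall>\<zeta>. grad \<rho> \<zeta> \<noteq> 0 \<longrightarrow> orthonormal_basis (b \<zeta>) \<and> b \<zeta> 1 = unit_normal \<rho> \<zeta>)"

definition koranyi_ball ::
    "(complex^'n \<Rightarrow> nat \<Rightarrow> complex^'n) \<Rightarrow> real \<Rightarrow> complex^'n \<Rightarrow> (complex^'n) set" where
  "koranyi_ball b r \<zeta> =
     {\<zeta> + s *s b \<zeta> 1 + (\<Sum>i=2..CARD('n). \<mu> i *s b \<zeta> i) | s \<mu>.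
        norm s < r \<and> (\<forall>i\<in>{2..CARD('n)}. norm (\<mu> i) < sqrt r)}"

definition koranyi_dist ::
    "(complex^'n \<Rightarrow> nat \<Rightarrow> complex^'n) \<Rightarrow> complex^'n \<Rightarrow> complex^'n \<Rightarrow> real" where
  "koranyi_dist b z \<zeta> = Inf {\<epsilon>. 0 < \<epsilon> \<and> \<zeta> \<in> koranyi_ball b \<epsilon> z}"

text \<open>The family of Koranyi balls of radius \<open>\<kappa> \<bar>\<rho> (z j)\<bar>\<close> is determined by the sequence of
  centres \<open>z\<close>, so the property is stated for \<open>z\<close>. The bijection \<open>\<phi>\<close> is the renumbering, and
  \<open>m k\<close> is the number of centres on the \<open>k\<close>-th level.\<close>

definition kappa_covering ::
    "(complex^'n \<Rightarrow> real) \<Rightarrow> (complex^'n \<Rightarrow> nat \<Rightarrow> complex^'n) \<Rightarrow> real \<Rightarrow> real \<Rightarrow> real \<Rightarrow>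
     (complex^'n) set \<Rightarrow> (nat \<Rightarrow> complex^'n) \<Rightarrow> bool" where
  "kappa_covering \<rho> b \<kappa> c \<epsilon>0 \<V> z \<longleftrightarrow>
     (\<exists>(m :: nat \<Rightarrow> nat) (\<phi> :: nat \<times> nat \<Rightarrow> nat).
        bij_betw \<phi> {(k, j). 1 \<le> j \<and> j \<le> m k} UNIV \<and>
        (let Z = (\<lambda>k j. z (\<phi> (k, j))); r = (\<lambda>k. (1 - c * \<kappa>) ^ k * \<epsilon>0) in
         (\<forall>k. \<forall>j\<in>{1..m k}. Z k j \<in> frontier (sublevel \<rho> (- r k))) \<and>
         (\<forall>k. \<forall>i\<in>{1..m k}. \<forall>j\<in>{1..m k}. i \<noteq> j \<longrightarrow> koranyi_dist b (Z k i) (Z k j) \<ge> c * \<kappa> * r k) \<and>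
         (\<forall>k. \<forall>x\<in>\<V> \<inter> frontier (sublevel \<rho> (- r k)).
            \<exists>j\<in>{1..m k}. koranyi_dist b x (Z k j) < c * \<kappa> * r k)))"

definition tau :: "(complex^'n \<Rightarrow> real) \<Rightarrow> complex^'n \<Rightarrow> complex^'n \<Rightarrow> real \<Rightarrow> real" where
  "tau \<rho> z v \<epsilon> = Sup {t. 0 < t \<and> (\<forall>s. norm s < t \<longrightarrow> \<rho> (z + s *s v) - \<rho> z < \<epsilon>)}"

definition Lam ::
    "(complex^'n \<Rightarrow> real) \<Rightarrow> (complex^'n) set \<Rightarrow> real \<Rightarrow> complex^'n \<Rightarrow> complex^'n \<Rightarrow> complex set" where
  "Lam \<rho> X \<kappa> z v = {s. norm s < 3 * \<kappa> * tau \<rho> z v \<bar>\<rho> z\<bar> \<and> z + s *s v \<in> X}"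

text \<open>The value on the empty list is a dummy.\<close>

fun divdiff :: "(complex \<Rightarrow> complex) \<Rightarrow> complex list \<Rightarrow> complex" where
  "divdiff h [] = 0"
| "divdiff h [x] = h x"
| "divdiff h (x # y # xs) =
     (divdiff h (butlast (x # y # xs)) - divdiff h (y # xs)) / (x - last (y # xs))"

text \<open>\<open>W 1, \<dots>, W n\<close> is the basis written with stars in the literature; its last vector is the
  direction in which \<open>X\<close> is projected near \<open>z\<close>.\<close>

definition admissible_basis ::
    "(complex^'n \<Rightarrow> real) \<Rightarrow> (complex^'n) set \<Rightarrow> complex^'n \<Rightarrow> (nat \<Rightarrow> complex^'n) \<Rightarrow> bool" where
  "admissible_basis \<rho> X z W \<longleftrightarrow>
     orthonormal_basis W \<and> W 1 = unit_normal \<rho> z \<and> W CARD('n) \<in> complex_tangent \<rho> z \<and>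
     (\<exists>p U. open U \<and> z \<in> U \<and> sheeted_covering X U z (W CARD('n)) p)"

text \<open>Coordinates of the polydisc \<open>\<P>'\<close> in \<open>\<complex>\<^sup>n\<^sup>-\<^sup>1\<close>, whose points are functions on the index set
  \<open>{1..<n}\<close>; Lebesgue measure there is the product of the Lebesgue measures on \<open>\<complex>\<close>.\<close>

definition coord_polydisc :: "nat \<Rightarrow> real \<Rightarrow> (nat \<Rightarrow> complex) set" where
  "coord_polydisc n \<epsilon> =
     {t \<in> {1..<n} \<rightarrow>\<^sub>E UNIV. norm (t 1) < \<epsilon> \<and> (\<forall>i\<in>{2..<n}. norm (t i) < sqrt \<epsilon>)}"

definition coord_point :: "complex^'n \<Rightarrow> (nat \<Rightarrow> complex^'n) \<Rightarrow> (nat \<Rightarrow> complex) \<Rightarrow> complex^'n" where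
  "coord_point z W t = z + (\<Sum>i\<in>{1..<CARD('n)}. t i *s W i)"

text \<open>Tuples of pairwise distinct points are nonempty distinct lists. The value may be infinite.\<close>

definition cq ::
    "(complex^'n \<Rightarrow> real) \<Rightarrow> (complex^'n) set \<Rightarrow> real \<Rightarrow> real \<Rightarrow> (nat \<Rightarrow> complex^'n) \<Rightarrow>
     (nat \<Rightarrow> nat \<Rightarrow> complex^'n) \<Rightarrow> (complex^'n \<Rightarrow> complex) \<Rightarrow> ennreal" where
  "cq \<rho> X q \<kappa> z W g =
     (\<Sum>j. \<integral>\<^sup>+ t \<in> coord_polydisc CARD('n) (2 * \<kappa> * \<bar>\<rho> (z j)\<bar>).
        (let z' = coord_point (z j) (W j) t; w = W j CARD('n) in
         \<Sum>\<^sub>\<infinity>ls\<in>{ls. ls \<noteq> [] \<and> distinct ls \<and> set ls \<subseteq> Lam \<rho> X \<kappa> z' w}.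
           ennreal (\<bar>\<rho> (z j)\<bar> powr (q * ((real (length ls) - 1) / 2) + 1)
                    * norm (divdiff (\<lambda>s. g (z' + s *s w)) ls) powr q))
        \<partial>(\<Pi>\<^sub>M i\<in>{1..<CARD('n)}. (lborel :: complex measure)))"

definition in_Lq :: "real \<Rightarrow> 'a::euclidean_space set \<Rightarrow> ('a \<Rightarrow> complex) \<Rightarrow> bool" where
  "in_Lq q S G \<longleftrightarrow> set_borel_measurable lborel S G \<and> set_integrable lborel S (\<lambda>z. norm (G z) powr q)"

definition Lq_norm :: "real \<Rightarrow> 'a::euclidean_space set \<Rightarrow> ('a \<Rightarrow> complex) \<Rightarrow> real" where
  "Lq_norm q S G = (LINT z:S|lborel. norm (G z) powr q) powr (1 / q)"

end

theory Submission
  imports Defs "HOL-Complex_Analysis.Complex_Analysis"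
begin

text \<open>
  The sum is estimated one centre at a time. Put \<open>\<delta> = \<bar>\<rho> (z j)\<bar>\<close> and let \<open>B\<close> be the set of all \<open>y\<close> such
  that \<open>D\<close> contains the whole closed complex disc \<open>{z j + s *s y | s. norm s \<le> 1}\<close>. This is a convex
  set invariant under rotations \<open>y \<mapsto> c *s y\<close> with \<open>norm c = 1\<close>, and it replaces the Koranyi ball of
  radius comparable to \<open>\<delta>\<close>: by the second order Taylor formula it contains the slab
  \<open>\<bar>\<langle>y, \<eta>\<rangle>\<bar> \<le> a \<delta>\<close>, \<open>\<bar>y\<bar>\<^sup>2 \<le> a \<delta>\<close> around the complex tangent plane (\<open>slab_subset_disc_body\<close>). Its
  advantage is that discs contained in \<open>D\<close>, hence the numbers \<open>tau\<close>, and the bodies of neighbouring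
  points are compared by convexity alone.

  On a disc in \<open>D\<close> of radius comparable to \<open>tau\<close> a divided difference is a Cauchy integral, so it is at
  most a power of \<open>1 / tau\<close> times the maximum of \<open>G\<close> on the circle (\<open>norm_divdiff_le\<close>). For a
  tuple of \<open>k\<close> points the power is \<open>k - 1\<close>. Since \<open>tau \<ge> const * sqrt \<delta>\<close>, the weight
  \<open>\<delta> powr (q * (k - 1) / 2 + 1)\<close> absorbs that power and leaves one
  factor \<open>\<delta>\<close>. The maximum of \<open>\<bar>G\<bar>\<^sup>q\<close> is at most a mean value over a translate of a fraction of \<open>B\<close>; for
  this the rotation invariance of \<open>B\<close> suffices (\<open>circled_mean_value\<close>). Together with the volume of the
  polydisc the \<open>j\<close>-th term is at most a constant times
  \<open>\<delta>\<^sup>n\<^sup>+\<^sup>1 / vol B\<close> times the integral of \<open>\<bar>G\<bar>\<^sup>q\<close> over \<open>z j + 3/4 B\<close> (\<open>polydisc_integral_le\<close>).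

  The number of tuples must also be bounded, that is, the number of zeros of \<open>f\<close> on short discs, uniformly
  over all complex lines near \<open>D\<close> on which \<open>f\<close> does not vanish identically. Near a fixed line the Taylor
  coefficients of the restrictions of \<open>f\<close> are power series in the parameters of the line. Finitely many
  of them dominate all the others, which is a quantitative form of the Noetherian property
  (\<open>coefficient_domination\<close>), and this forbids too many zeros close to the origin
  (\<open>zero_count_by_coefficients\<close>). Compactness then gives \<open>uniform_line_zero_bound\<close>. Among the lines in
  the projection direction through the points of the polydisc, those on which \<open>f\<close> vanishes identically
  form a null set (\<open>AE_line_not_in_zero_set\<close>), because the sheeted covering
  prevents \<open>f\<close> from vanishing near the centre.

  Finally the integrals over \<open>z j + 3/4 B\<close> are summed. Centres of one level carry disjoint slabs of volume
  at least \<open>const * \<delta>\<^sup>n\<^sup>+\<^sup>1\<close>; all slabs belonging to bodies that contain a given point \<open>x\<close> lie in a fixed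
  dilate of the body of \<open>x\<close>, and only boundedly many levels occur. Hence the weights
  \<open>\<delta>\<^sup>n\<^sup>+\<^sup>1 / vol B\<close> of the bodies that contain \<open>x\<close> add up to at most a constant (\<open>bounded_overlap\<close>), and
  the sum is at most a constant times the integral of \<open>\<bar>G\<bar>\<^sup>q\<close> over \<open>D\<close>.
\<close>

section \<open>Absolutely summable families\<close>

abbreviation l1 :: "('a \<Rightarrow> 'b::real_normed_vector) \<Rightarrow> bool" where
  "l1 f \<equiv> (\<lambda>x. norm (f x)) summable_on UNIV"

text \<open>Tonelli and Fubini for families whose rows have \<open>l1\<close>-norms bounded by a summable family.\<close>
lemma infsum_swap_dominated:
  fixes f :: "'a \<Rightarrow> 'b \<Rightarrow> complex"
  assumes f: "\<And>x. l1 (f x)"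
    and le: "\<And>x. (\<Sum>\<^sub>\<infinity>y. norm (f x y)) \<le> b x"
    and b: "b summable_on UNIV"
  shows "(\<Sum>\<^sub>\<infinity>x. \<Sum>\<^sub>\<infinity>y. f x y) = (\<Sum>\<^sub>\<infinity>y. \<Sum>\<^sub>\<infinity>x. f x y)"
    and "l1 (\<lambda>y. \<Sum>\<^sub>\<infinity>x. f x y)"
    and "(\<Sum>\<^sub>\<infinity>y. norm (\<Sum>\<^sub>\<infinity>x. f x y)) \<le> (\<Sum>\<^sub>\<infinity>x. b x)"
    and "\<And>y. l1 (\<lambda>x. f x y)"
proof -
  have nn: "0 \<le> (\<Sum>\<^sub>\<infinity>y. norm (f x y))" for x by (simp add: infsum_nonneg)
  have s1: "(\<lambda>x. \<Sum>\<^sub>\<infinity>y. norm (f x y)) summable_on UNIV"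
    by (rule summable_on_comparison_test[OF b]) (use le nn in auto)
  have S: "(\<lambda>z. norm (case z of (x,y) \<Rightarrow> f x y)) summable_on (UNIV \<times> UNIV)"
    using Infinite_Sum.abs_summable_on_Sigma_iff[of "\<lambda>(x,y). f x y" UNIV "\<lambda>_. UNIV"] f s1 nn
    by (simp add: abs_of_nonneg)
  have S': "(\<lambda>z. norm (case z of (y,x) \<Rightarrow> f x y)) summable_on (UNIV \<times> UNIV)"
    using summable_on_reindex_bij_betw[of prod.swap UNIV UNIV "\<lambda>z. norm (case z of (x,y) \<Rightarrow> f x y)"] S
    by (simp add: case_prod_unfold bij_swap)
  have S'': "(\<forall>y. l1 (\<lambda>x. f x y)) \<and> (\<lambda>y. \<Sum>\<^sub>\<infinity>x. norm (f x y)) summable_on UNIV"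
    using Infinite_Sum.abs_summable_on_Sigma_iff[of "\<lambda>(y,x). f x y" UNIV "\<lambda>_. UNIV"] S'
    by (simp add: abs_of_nonneg infsum_nonneg)
  show "(\<Sum>\<^sub>\<infinity>x. \<Sum>\<^sub>\<infinity>y. f x y) = (\<Sum>\<^sub>\<infinity>y. \<Sum>\<^sub>\<infinity>x. f x y)"
    by (rule infsum_swap_banach) (use S in \<open>auto intro: abs_summable_summable simp: case_prod_unfold\<close>)
  show c: "l1 (\<lambda>x. f x y)" for y
    using S'' by blast
  have s2: "(\<lambda>y. \<Sum>\<^sub>\<infinity>x. norm (f x y)) summable_on UNIV"
    using S'' by blast
  show d: "l1 (\<lambda>y. \<Sum>\<^sub>\<infinity>x. f x y)"
    by (rule Infinite_Sum.abs_summable_on_comparison_test[where g="\<lambda>y. \<Sum>\<^sub>\<infinity>x. norm (f x y)"])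
       (use s2 c in \<open>auto simp: abs_of_nonneg infsum_nonneg intro!: norm_infsum_bound order_trans[OF _ abs_ge_self]\<close>)
  have "(\<Sum>\<^sub>\<infinity>y. norm (\<Sum>\<^sub>\<infinity>x. f x y)) \<le> (\<Sum>\<^sub>\<infinity>y. \<Sum>\<^sub>\<infinity>x. norm (f x y))"
    by (rule infsum_mono) (use s2 c d in \<open>auto intro!: norm_infsum_bound\<close>)
  also have "\<dots> = (\<Sum>\<^sub>\<infinity>x. \<Sum>\<^sub>\<infinity>y. norm (f x y))"
    by (rule infsum_swap_banach) (use S' in \<open>auto simp: case_prod_unfold\<close>)
  also have "\<dots> \<le> (\<Sum>\<^sub>\<infinity>x. b x)"
    by (rule infsum_mono) (use s1 b le in auto)
  finally show "(\<Sum>\<^sub>\<infinity>y. norm (\<Sum>\<^sub>\<infinity>x. f x y)) \<le> (\<Sum>\<^sub>\<infinity>x. b x)" .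
qed

text \<open>The matrix \<open>E\<close>, acting on row vectors, has norm at most \<open>1/2\<close> on the weighted space \<open>l1\<close>, so
  \<open>x + x E = h\<close> is solved by the Neumann series \<open>h - h E + h E\<^sup>2 - \<dots>\<close>. The equation is stated
  after pairing with any \<open>\<psi>\<close> bounded by the weights, since it is applied to the vector
  of all monomials at a point.\<close>
lemma neumann_series_l1:
  fixes E :: "'e \<Rightarrow> 'e \<Rightarrow> complex" and h :: "'e \<Rightarrow> complex" and wt :: "'e \<Rightarrow> real"
  assumes wt: "\<And>\<gamma>. wt \<gamma> > 0"
    and E: "\<And>\<beta>. (\<lambda>\<gamma>. norm (E \<beta> \<gamma>) * wt \<gamma>) summable_on UNIV"
      "\<And>\<beta>. (\<Sum>\<^sub>\<infinity>\<gamma>. norm (E \<beta> \<gamma>) * wt \<gamma>) \<le> wt \<beta> / 2"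
    and h: "(\<lambda>\<gamma>. norm (h \<gamma>) * wt \<gamma>) summable_on UNIV"
  obtains x where "(\<lambda>\<gamma>. norm (x \<gamma>) * wt \<gamma>) summable_on UNIV"
    "(\<Sum>\<^sub>\<infinity>\<gamma>. norm (x \<gamma>) * wt \<gamma>) \<le> 2 * (\<Sum>\<^sub>\<infinity>\<gamma>. norm (h \<gamma>) * wt \<gamma>)"
    "\<And>\<psi>. (\<And>\<gamma>. norm (\<psi> \<gamma>) \<le> wt \<gamma>) \<Longrightarrow>
       (\<Sum>\<^sub>\<infinity>\<beta>. x \<beta> * (\<psi> \<beta> + (\<Sum>\<^sub>\<infinity>\<gamma>. E \<beta> \<gamma> * \<psi> \<gamma>))) = (\<Sum>\<^sub>\<infinity>\<gamma>. h \<gamma> * \<psi> \<gamma>)"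
proof -
  define X where "X = rec_nat h (\<lambda>n x \<gamma>. - (\<Sum>\<^sub>\<infinity>\<beta>. x \<beta> * E \<beta> \<gamma>))"
  have X0: "X 0 = h" and XS: "X (Suc n) = (\<lambda>\<gamma>. - (\<Sum>\<^sub>\<infinity>\<beta>. X n \<beta> * E \<beta> \<gamma>))" for n
    by (simp_all add: X_def)
  define H where "H = (\<Sum>\<^sub>\<infinity>\<gamma>. norm (h \<gamma>) * wt \<gamma>)"
  have H0: "H \<ge> 0" unfolding H_def using wt by (intro infsum_nonneg) (simp add: less_imp_le)
  note wt0 = less_imp_le[OF wt]
  have step: "(\<lambda>\<gamma>. norm (X n \<gamma>) * wt \<gamma>) summable_on UNIV \<and> (\<Sum>\<^sub>\<infinity>\<gamma>. norm (X n \<gamma>) * wt \<gamma>) \<le> H * (1/2)^n" for n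
  proof (induction n)
    case 0
    then show ?case using h by (simp add: X0 H_def)
  next
    case (Suc n)
    have b: "(\<lambda>\<beta>. norm (X n \<beta>) * wt \<beta> / 2) summable_on UNIV"
      using Suc summable_on_cmult_left[of "\<lambda>\<beta>. norm (X n \<beta>) * wt \<beta>" UNIV "1/2"] by simp
    have f1: "l1 (\<lambda>\<gamma>. X n \<beta> * E \<beta> \<gamma> * wt \<gamma>)" for \<beta>
      using summable_on_cmult_right[OF E(1)[of \<beta>], of "norm (X n \<beta>)"] wt0
      by (simp add: norm_mult mult.assoc)
    have f2: "(\<Sum>\<^sub>\<infinity>\<gamma>. norm (X n \<beta> * E \<beta> \<gamma> * wt \<gamma>)) \<le> norm (X n \<beta>) * wt \<beta> / 2" for \<beta>
    proof -
      have "(\<Sum>\<^sub>\<infinity>\<gamma>. norm (X n \<beta> * E \<beta> \<gamma> * wt \<gamma>)) = norm (X n \<beta>) * (\<Sum>\<^sub>\<infinity>\<gamma>. norm (E \<beta> \<gamma>) * wt \<gamma>)"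
        using wt0 by (simp add: norm_mult mult.assoc infsum_cmult_right')
      also have "\<dots> \<le> norm (X n \<beta>) * (wt \<beta> / 2)"
        by (intro mult_left_mono E) auto
      finally show ?thesis by simp
    qed
    have eq: "norm (X (Suc n) \<gamma>) * wt \<gamma> = norm (\<Sum>\<^sub>\<infinity>\<beta>. X n \<beta> * E \<beta> \<gamma> * wt \<gamma>)" for \<gamma>
      using wt0[of \<gamma>] by (simp add: XS infsum_cmult_left' norm_mult)
    note sw = infsum_swap_dominated(2,3)[OF f1 f2 b]
    have "(\<Sum>\<^sub>\<infinity>\<beta>. norm (X n \<beta>) * wt \<beta> / 2) = (\<Sum>\<^sub>\<infinity>\<beta>. norm (X n \<beta>) * wt \<beta>) / 2"
      using infsum_cmult_left'[of "\<lambda>\<beta>. norm (X n \<beta>) * wt \<beta>" "1/2"] by simp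
    then show ?case using sw Suc by (simp add: eq)
  qed
  have geo: "(\<lambda>n. H * (1/2)^n) summable_on UNIV"
    using summable_on_cmult_right[of "\<lambda>n. (1/2::real)^n" UNIV H]
    by (subst summable_on_UNIV_nonneg_real_iff) (auto intro!: summable_mult simp: H0)
  have geo2: "(\<Sum>\<^sub>\<infinity>n. H * (1/2)^n) = 2 * H"
  proof -
    have "(\<lambda>n. H * (1/2)^n) sums (H * 2)"
      using geometric_sums[of "1/2::real"] by (intro sums_mult) simp
    then show ?thesis using sums_nonneg_imp_has_sum[of "\<lambda>n. H * (1/2)^n" "H*2"] H0
      by (simp add: infsumI mult.commute)
  qed
  define x where "x \<gamma> = (\<Sum>\<^sub>\<infinity>n. X n \<gamma>)" for \<gamma>
  have g1: "l1 (\<lambda>\<gamma>. X n \<gamma> * wt \<gamma>)" for n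
    using step[of n] wt0 by (simp add: norm_mult)
  have g2: "(\<Sum>\<^sub>\<infinity>\<gamma>. norm (X n \<gamma> * wt \<gamma>)) \<le> H * (1/2)^n" for n
    using step[of n] wt0 by (simp add: norm_mult)
  note sx = infsum_swap_dominated[OF g1 g2 geo]
  have xeq: "norm (x \<gamma>) * wt \<gamma> = norm (\<Sum>\<^sub>\<infinity>n. X n \<gamma> * wt \<gamma>)" for \<gamma>
    using wt0[of \<gamma>] by (simp add: x_def infsum_cmult_left' norm_mult)
  show thesis
  proof (rule that[of x])
    show "(\<lambda>\<gamma>. norm (x \<gamma>) * wt \<gamma>) summable_on UNIV" using sx(2) by (simp add: xeq)
    show "(\<Sum>\<^sub>\<infinity>\<gamma>. norm (x \<gamma>) * wt \<gamma>) \<le> 2 * (\<Sum>\<^sub>\<infinity>\<gamma>. norm (h \<gamma>) * wt \<gamma>)"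
      using sx(3) by (simp add: xeq geo2 flip: H_def)
  next
    fix \<psi> :: "'e \<Rightarrow> complex" assume psi: "\<And>\<gamma>. norm (\<psi> \<gamma>) \<le> wt \<gamma>"
    define G where "G \<beta> = (\<Sum>\<^sub>\<infinity>\<gamma>. E \<beta> \<gamma> * \<psi> \<gamma>)" for \<beta>
    have Es: "l1 (\<lambda>\<gamma>. E \<beta> \<gamma> * \<psi> \<gamma>)" for \<beta>
      by (rule Infinite_Sum.abs_summable_on_comparison_test'[OF E(1)[of \<beta>]]) (auto simp: norm_mult intro!: mult_left_mono psi)
    have Es2: "(\<Sum>\<^sub>\<infinity>\<gamma>. norm (E \<beta> \<gamma> * \<psi> \<gamma>)) \<le> wt \<beta> / 2" for \<beta>
      by (rule order_trans[OF infsum_mono E(2)]) (use Es E(1) psi in \<open>auto simp: norm_mult intro!: mult_left_mono\<close>)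
    have G: "norm (G \<beta>) \<le> wt \<beta> / 2" for \<beta>
      unfolding G_def using norm_infsum_bound[OF Es[of \<beta>]] Es2[of \<beta>] by linarith
    define e where "e n = (\<Sum>\<^sub>\<infinity>\<gamma>. X n \<gamma> * \<psi> \<gamma>)" for n
    have Xs: "l1 (\<lambda>\<gamma>. X n \<gamma> * \<psi> \<gamma>)" for n
      by (rule Infinite_Sum.abs_summable_on_comparison_test'[where g="\<lambda>\<gamma>. norm (X n \<gamma>) * wt \<gamma>"])
         (use step psi in \<open>auto simp: norm_mult intro!: mult_left_mono\<close>)
    have en: "norm (e n) \<le> H * (1/2)^n" for n
    proof -
      have "norm (e n) \<le> (\<Sum>\<^sub>\<infinity>\<gamma>. norm (X n \<gamma> * \<psi> \<gamma>))"
        unfolding e_def by (rule norm_infsum_bound[OF Xs])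
      also have "\<dots> \<le> (\<Sum>\<^sub>\<infinity>\<gamma>. norm (X n \<gamma>) * wt \<gamma>)"
        by (rule infsum_mono) (use Xs step psi in \<open>auto simp: norm_mult intro!: mult_left_mono\<close>)
      finally show ?thesis using step[of n] by simp
    qed
    have XG: "l1 (\<lambda>\<beta>. X n \<beta> * G \<beta>)" for n
      by (rule Infinite_Sum.abs_summable_on_comparison_test'[where g="\<lambda>\<gamma>. norm (X n \<gamma>) * wt \<gamma>"])
         (use step G wt0 in \<open>auto simp: norm_mult intro!: mult_left_mono intro: order_trans[OF G]\<close>)
    have eS: "e (Suc n) = - (\<Sum>\<^sub>\<infinity>\<beta>. X n \<beta> * G \<beta>)" for n
    proof -
      have b: "(\<lambda>\<beta>. norm (X n \<beta>) * wt \<beta> / 2) summable_on UNIV"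
        using step[of n] summable_on_cmult_left[of "\<lambda>\<beta>. norm (X n \<beta>) * wt \<beta>" UNIV "1/2"] by simp
      have f1: "l1 (\<lambda>\<gamma>. X n \<beta> * E \<beta> \<gamma> * \<psi> \<gamma>)" for \<beta>
        using summable_on_cmult_right[OF Es[of \<beta>], of "norm (X n \<beta>)"]
        by (simp add: norm_mult mult.assoc)
      have f2: "(\<Sum>\<^sub>\<infinity>\<gamma>. norm (X n \<beta> * E \<beta> \<gamma> * \<psi> \<gamma>)) \<le> norm (X n \<beta>) * wt \<beta> / 2" for \<beta>
      proof -
        have "(\<Sum>\<^sub>\<infinity>\<gamma>. norm (X n \<beta> * E \<beta> \<gamma> * \<psi> \<gamma>)) = norm (X n \<beta>) * (\<Sum>\<^sub>\<infinity>\<gamma>. norm (E \<beta> \<gamma> * \<psi> \<gamma>))"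
          by (simp add: norm_mult mult.assoc infsum_cmult_right')
        also have "\<dots> \<le> norm (X n \<beta>) * (wt \<beta> / 2)"
          by (intro mult_left_mono Es2) auto
        finally show ?thesis by simp
      qed
      show ?thesis
        using infsum_swap_dominated(1)[OF f1 f2 b]
        by (simp add: e_def XS G_def infsum_uminus mult.assoc flip: infsum_cmult_left' infsum_cmult_right')
    qed
    have diff: "(\<Sum>\<^sub>\<infinity>\<beta>. X n \<beta> * (\<psi> \<beta> + G \<beta>)) = e n - e (Suc n)" for n
      unfolding ring_distribs eS using Xs[of n] XG[of n]
      by (subst infsum_add) (auto intro: abs_summable_summable simp: e_def)
    have psiG: "norm (\<psi> \<beta> + G \<beta>) \<le> 2 * wt \<beta>" for \<beta>
      using norm_triangle_ineq[of "\<psi> \<beta>" "G \<beta>"] psi[of \<beta>] G[of \<beta>] wt0[of \<beta>] by linarith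
    have k1: "l1 (\<lambda>\<beta>. X n \<beta> * (\<psi> \<beta> + G \<beta>))" for n
    proof (rule Infinite_Sum.abs_summable_on_comparison_test')
      show "(\<lambda>\<beta>. 2 * (norm (X n \<beta>) * wt \<beta>)) summable_on UNIV"
        using step by (intro summable_on_cmult_right) auto
      show "norm (X n \<beta> * (\<psi> \<beta> + G \<beta>)) \<le> 2 * (norm (X n \<beta>) * wt \<beta>)" for \<beta>
        using mult_left_mono[OF psiG[of \<beta>], of "norm (X n \<beta>)"] by (simp add: norm_mult mult.left_commute)
    qed
    have k2: "(\<Sum>\<^sub>\<infinity>\<beta>. norm (X n \<beta> * (\<psi> \<beta> + G \<beta>))) \<le> 2 * (H * (1/2)^n)" for n
    proof -
      have "(\<Sum>\<^sub>\<infinity>\<beta>. norm (X n \<beta> * (\<psi> \<beta> + G \<beta>))) \<le> (\<Sum>\<^sub>\<infinity>\<beta>. 2 * (norm (X n \<beta>) * wt \<beta>))"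
      proof (rule infsum_mono)
        show "(\<lambda>\<beta>. 2 * (norm (X n \<beta>) * wt \<beta>)) summable_on UNIV"
          using step by (intro summable_on_cmult_right) auto
        show "norm (X n \<beta> * (\<psi> \<beta> + G \<beta>)) \<le> 2 * (norm (X n \<beta>) * wt \<beta>)" for \<beta>
          using mult_left_mono[OF psiG[of \<beta>], of "norm (X n \<beta>)"] by (simp add: norm_mult mult.left_commute)
      qed (use k1 in auto)
      also have "\<dots> = 2 * (\<Sum>\<^sub>\<infinity>\<beta>. (norm (X n \<beta>) * wt \<beta>))" by (rule infsum_cmult_right')
      finally show ?thesis using step[of n] by linarith
    qed
    \<comment> \<open>Paired with \<open>\<psi>\<close>, the equation telescopes: the \<open>n\<close>-th term \<open>X n\<close> of the series contributes
        \<open>e n - e (Suc n)\<close>.\<close>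
    have tel: "(\<lambda>n. e n - e (Suc n)) sums (e 0 - 0)"
    proof (rule telescope_sums')
      have "(\<lambda>n. H * (1/2::real)^n) \<longlonglongrightarrow> 0"
        using tendsto_mult_left[OF LIMSEQ_realpow_zero[of "1/2"], of H] by simp
      then show "e \<longlonglongrightarrow> 0" using en by (intro Lim_null_comparison[of e "\<lambda>n. H * (1/2)^n"] always_eventually allI)
    qed
    note sw = infsum_swap_dominated[OF k1 k2 summable_on_cmult_right[OF geo]]
    have "(\<Sum>\<^sub>\<infinity>\<beta>. x \<beta> * (\<psi> \<beta> + G \<beta>)) = (\<Sum>\<^sub>\<infinity>\<beta>. \<Sum>\<^sub>\<infinity>n. X n \<beta> * (\<psi> \<beta> + G \<beta>))"
      by (simp add: x_def infsum_cmult_left')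
    also have "\<dots> = (\<Sum>\<^sub>\<infinity>n. e n - e (Suc n))"
      using sw(1) by (simp add: diff)
    also have "\<dots> = e 0"
    proof -
      have "summable (\<lambda>n. norm (e n - e (Suc n)))"
      proof (rule summable_comparison_test')
        show "summable (\<lambda>n. 2 * (H * (1/2)^n))" by (intro summable_mult) auto
        fix n :: nat
        have "norm (e n - e (Suc n)) \<le> norm (e n) + norm (e (Suc n))" by (rule norm_triangle_ineq4)
        also have "\<dots> \<le> H * (1/2)^n + H * (1/2)^Suc n" using en[of n] en[of "Suc n"] by linarith
        also have "\<dots> \<le> 2 * (H * (1/2)^n)" using H0 by simp
        finally show "norm (norm (e n - e (Suc n))) \<le> 2 * (H * (1/2)^n)" by simp
      qed
      then show ?thesis using norm_summable_imp_has_sum[OF _ tel] by (simp add: infsumI)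
    qed
    finally show "(\<Sum>\<^sub>\<infinity>\<beta>. x \<beta> * (\<psi> \<beta> + (\<Sum>\<^sub>\<infinity>\<gamma>. E \<beta> \<gamma> * \<psi> \<gamma>))) = (\<Sum>\<^sub>\<infinity>\<gamma>. h \<gamma> * \<psi> \<gamma>)"
      by (simp add: G_def e_def X0)
  qed
qed

section \<open>Multivariate power series and their exponents\<close>

lemma nat_seq_obtain_incseq_subseq:
  fixes a :: "nat \<Rightarrow> nat"
  obtains r :: "nat \<Rightarrow> nat" where "strict_mono r" "incseq (\<lambda>n. a (r n))"
proof -
  obtain f where f: "strict_mono f" "monoseq (\<lambda>n. a (f n))"
    using seq_monosub[of a] by blast
  show thesis
  proof (cases "incseq (\<lambda>n. a (f n))")
    case True
    then show ?thesis using f that by blast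
  next
    case False
    then have dec: "decseq (\<lambda>n. a (f n))" using f(2) by (simp add: monoseq_iff)
    obtain n0 where n0: "\<And>n. a (f n0) \<le> a (f n)"
      using ex_has_least_nat[of "\<lambda>_. True" 0 "\<lambda>n. a (f n)"] by auto
    have c: "a (f (n0 + n)) = a (f n0)" for n
      using decseqD[OF dec, of n0 "n0+n"] n0[of "n0+n"] by simp
    show ?thesis
    proof (rule that[of "\<lambda>n. f (n0 + n)"])
      show "strict_mono (\<lambda>n. f (n0 + n))" using f(1) by (simp add: strict_mono_def)
      show "incseq (\<lambda>n. a (f (n0 + n)))" by (simp add: c incseq_def)
    qed
  qed
qed

text \<open>An infinite set of minimal exponents would contain a sequence that increases in every coordinate
  after passing to subsequences one coordinate at a time, and then two of its members are comparable.\<close>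
lemma dickson_lemma:
  fixes S :: "('i::finite \<Rightarrow> nat) set"
  obtains S0 where "finite S0" "S0 \<subseteq> S" "\<And>\<beta>. \<beta> \<in> S \<Longrightarrow> \<exists>\<alpha>\<in>S0. \<alpha> \<le> \<beta>"
proof -
  define M where "M = {\<alpha>\<in>S. \<forall>\<beta>\<in>S. \<beta> \<le> \<alpha> \<longrightarrow> \<beta> = \<alpha>}"
  have below: "\<exists>\<alpha>\<in>M. \<alpha> \<le> \<beta>" if "\<beta> \<in> S" for \<beta>
    using that
  proof (induction "\<Sum>i\<in>UNIV. \<beta> i" arbitrary: \<beta> rule: less_induct)
    case less
    show ?case
    proof (cases "\<beta> \<in> M")
      case False
      then obtain \<gamma> where g: "\<gamma> \<in> S" "\<gamma> \<le> \<beta>" "\<gamma> \<noteq> \<beta>" using less.prems by (auto simp: M_def)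
      then obtain i where "\<gamma> i < \<beta> i" by (metis antisym_conv3 ext le_funD not_le)
      then have "(\<Sum>i\<in>UNIV. \<gamma> i) < (\<Sum>i\<in>UNIV. \<beta> i)"
        using g by (intro sum_strict_mono_ex1) (auto simp: le_fun_def)
      then show ?thesis using less.hyps g by (meson order_trans)
    qed auto
  qed
  have "finite M"
  proof (rule ccontr)
    assume "infinite M"
    then obtain a :: "nat \<Rightarrow> _" where a: "inj a" "range a \<subseteq> M"
      using infinite_countable_subset by blast
    have "\<exists>r. strict_mono r \<and> (\<forall>i\<in>A. incseq (\<lambda>n. a (r n) i))" for A :: "'i set"
    proof (induction A rule: finite_induct[OF finite])
      case 1
      show ?case by (rule exI[of _ id]) (auto simp: strict_mono_def)
    next
      case (2 x F)
      then obtain r where r: "strict_mono r" "\<forall>i\<in>F. incseq (\<lambda>n. a (r n) i)" by blast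
      obtain r' :: "nat \<Rightarrow> nat" where r': "strict_mono r'" "incseq (\<lambda>n. a (r (r' n)) x)"
        using nat_seq_obtain_incseq_subseq[of "\<lambda>n. a (r n) x"] by blast
      have "strict_mono (\<lambda>n. r (r' n))" using r(1) r'(1) by (simp add: strict_mono_def)
      moreover have "incseq (\<lambda>n. a (r (r' n)) i)" if "i \<in> F" for i
        using r(2) that r'(1) by (simp add: incseq_def strict_mono_less_eq)
      ultimately show ?case using r'(2) by (intro exI[of _ "\<lambda>n. r (r' n)"]) auto
    qed
    from this[of UNIV] obtain r where r: "strict_mono r" "\<And>i. incseq (\<lambda>n. a (r n) i)" by blast
    have "a (r 0) \<le> a (r 1)" using r(2) by (auto simp: le_fun_def incseq_def)
    moreover have "a (r 0) \<in> M" "a (r 1) \<in> M" using a(2) by blast+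
    ultimately have "a (r 0) = a (r 1)" unfolding M_def by blast
    then show False using a(1) r(1) by (metis inj_eq less_numeral_extra(1) order_less_irrefl strict_mono_less)
  qed
  then show thesis using below by (intro that[of M]) (auto simp: M_def)
qed

definition monom_at :: "('i::finite \<Rightarrow> complex) \<Rightarrow> ('i \<Rightarrow> nat) \<Rightarrow> complex" where
  "monom_at u \<alpha> = (\<Prod>i\<in>UNIV. u i ^ \<alpha> i)"

definition series_at :: "(('i::finite \<Rightarrow> nat) \<Rightarrow> complex) \<Rightarrow> ('i \<Rightarrow> complex) \<Rightarrow> complex" where
  "series_at c u = (\<Sum>\<^sub>\<infinity>\<alpha>. c \<alpha> * monom_at u \<alpha>)"

text \<open>The exponents are encoded as Goedel numbers, where \<open>p\<close> will be a family of distinct primes. This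
  encoding is injective and turns sums of exponents into products, so it gives a linear order on
  monomials compatible with multiplication, and at the same time, through its negative powers, weights
  for norms on power series.\<close>
definition godel :: "('i::finite \<Rightarrow> nat) \<Rightarrow> ('i \<Rightarrow> nat) \<Rightarrow> nat" where
  "godel p \<alpha> = (\<Prod>i\<in>UNIV. p i ^ \<alpha> i)"

lemma monom_at_add: "monom_at u (\<lambda>i. \<alpha> i + \<beta> i) = monom_at u \<alpha> * monom_at u \<beta>"
  by (simp add: monom_at_def power_add prod.distrib)

lemma godel_add: "godel p (\<lambda>i. \<alpha> i + \<beta> i) = godel p \<alpha> * godel p \<beta>"
  by (simp add: godel_def power_add prod.distrib)

lemma godel_pos: "(\<And>i. prime (p i)) \<Longrightarrow> 0 < godel p \<alpha>"
  by (auto simp: godel_def intro!: prod_pos prime_gt_0_nat)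

lemma inj_godel:
  assumes "inj p" "\<And>i. prime (p i)"
  shows "inj (godel p)"
proof (rule injI, rule ext)
  fix \<alpha> \<beta> :: "'a \<Rightarrow> nat" and i assume eq: "godel p \<alpha> = godel p \<beta>"
  have "multiplicity (p i) (godel p \<gamma>) = \<gamma> i" for \<gamma>
  proof -
    have "godel p \<gamma> = (\<Prod>x\<in>range p. x ^ \<gamma> (inv p x))"
      using assms(1) by (simp add: godel_def prod.reindex o_def)
    then show ?thesis
      using multiplicity_prod_prime_powers[of "range p" "p i" "\<lambda>x. \<gamma> (inv p x)"] assms by auto
  qed
  then show "\<alpha> i = \<beta> i" using eq by metis
qed

lemma norm_monom_at_le:
  assumes "\<And>i. norm (u i) \<le> 1 / real (p i) ^ s"
  shows "norm (monom_at u \<alpha>) \<le> 1 / real (godel p \<alpha>) ^ s"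
proof -
  have "norm (monom_at u \<alpha>) = (\<Prod>i\<in>UNIV. norm (u i) ^ \<alpha> i)"
    by (simp add: monom_at_def prod_norm[symmetric] norm_power)
  also have "\<dots> \<le> (\<Prod>i\<in>UNIV. (1 / real (p i) ^ s) ^ \<alpha> i)"
    by (intro prod_mono conjI power_mono assms) auto
  also have "\<dots> = 1 / real (godel p \<alpha>) ^ s"
    by (simp add: godel_def prod_power_distrib prod_dividef power_divide flip: power_mult)
       (simp add: mult.commute)
  finally show ?thesis .
qed

text \<open>The coefficients of the product of the series \<open>F\<close> with the monomial of exponent \<open>\<delta>\<close>.\<close>
definition shift :: "('i \<Rightarrow> nat) \<Rightarrow> (('i \<Rightarrow> nat) \<Rightarrow> 'b::zero) \<Rightarrow> ('i \<Rightarrow> nat) \<Rightarrow> 'b" where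
  "shift \<delta> F \<gamma> = (if \<delta> \<le> \<gamma> then F (\<lambda>i. \<gamma> i - \<delta> i) else 0)"

lemma has_sum_shift:
  fixes F :: "('i \<Rightarrow> nat) \<Rightarrow> 'b::{topological_comm_monoid_add}"
  assumes "\<And>\<gamma>. \<not> \<delta> \<le> \<gamma> \<Longrightarrow> F \<gamma> = 0"
  shows "(F has_sum S) UNIV \<longleftrightarrow> ((\<lambda>\<gamma>. F (\<lambda>i. \<gamma> i + \<delta> i)) has_sum S) UNIV"
proof -
  have inj: "inj (\<lambda>\<gamma> i. \<gamma> i + \<delta> i)" by (auto simp: inj_def fun_eq_iff)
  have ran: "\<gamma> \<in> range (\<lambda>\<gamma> i. \<gamma> i + \<delta> i)" if "\<delta> \<le> \<gamma>" for \<gamma>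
    by (rule range_eqI[of _ _ "\<lambda>i. \<gamma> i - \<delta> i"]) (use that in \<open>auto simp: le_fun_def\<close>)
  have "(F has_sum S) UNIV \<longleftrightarrow> (F has_sum S) (range (\<lambda>\<gamma> i. \<gamma> i + \<delta> i))"
    by (rule has_sum_cong_neutral) (use ran assms in auto)
  also have "\<dots> \<longleftrightarrow> ((\<lambda>\<gamma>. F (\<lambda>i. \<gamma> i + \<delta> i)) has_sum S) UNIV"
    by (subst has_sum_reindex[OF inj]) (simp add: o_def)
  finally show ?thesis .
qed

lemma infsum_shift:
  fixes F :: "('i \<Rightarrow> nat) \<Rightarrow> 'b::{topological_comm_monoid_add,t2_space}"
  assumes "\<And>\<gamma>. \<not> \<delta> \<le> \<gamma> \<Longrightarrow> F \<gamma> = 0"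
  shows "infsum F UNIV = (\<Sum>\<^sub>\<infinity>\<gamma>. F (\<lambda>i. \<gamma> i + \<delta> i))"
    and "F summable_on UNIV \<longleftrightarrow> (\<lambda>\<gamma>. F (\<lambda>i. \<gamma> i + \<delta> i)) summable_on UNIV"
proof -
  note hs = has_sum_shift[of \<delta> F, OF assms]
  show *: "F summable_on UNIV \<longleftrightarrow> (\<lambda>\<gamma>. F (\<lambda>i. \<gamma> i + \<delta> i)) summable_on UNIV"
    by (simp add: summable_on_def hs)
  show "infsum F UNIV = (\<Sum>\<^sub>\<infinity>\<gamma>. F (\<lambda>i. \<gamma> i + \<delta> i))"
  proof (cases "F summable_on UNIV")
    case True
    then show ?thesis using hs has_sum_infsum[OF True] by (metis infsumI)
  next
    case False
    then show ?thesis using * by (simp add: infsum_not_exists)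
  qed
qed

section \<open>Domination by finitely many power series\<close>

lemma obtain_distinct_primes:
  obtains p :: "'i::finite \<Rightarrow> nat" where "inj p" "\<And>i. prime (p i)"
proof -
  obtain P :: "nat set" where P: "P \<subseteq> {p. prime p}" "finite P" "card P = CARD('i)"
    using infinite_arbitrarily_large[OF primes_infinite] by blast
  obtain p where "bij_betw p (UNIV :: 'i set) P"
    using P finite_same_card_bij[of "UNIV::'i set" P] by auto
  then show thesis using P by (intro that[of p]) (auto simp: bij_betw_def)
qed

text \<open>Infinitely many power series, bounded in norm on a common polydisc, are dominated by finitely
  many of them on a smaller polydisc, with a constant valid for all of them. The idea is Hilbert's
  basis theorem with estimates. Let \<open>I\<close> consist of the series that are dominated by
  finitely many members of the family. Order monomials by their Goedel number and call the smallest
  monomial of a series its leading one. By Dickson's lemma finitely many members \<open>g \<alpha>\<close> of \<open>I\<close> have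
  leading exponents below all leading exponents of \<open>I\<close>. Every member of the family is divided by
  the \<open>g \<alpha>\<close>; the remainder belongs to \<open>I\<close> and contains no monomial divisible by a leading monomial
  of \<open>I\<close>, hence it is zero.

  The division inverts an operator close to the identity: with the weights \<open>1 / godel p \<alpha> ^ s\<close> the
  leading term of each \<open>g \<alpha>\<close> outweighs the rest as soon as \<open>s\<close> is large, because all other exponents
  have strictly larger Goedel number. The polydisc with radii \<open>1 / p i ^ s\<close> is the one on which the
  monomials are bounded by these weights.\<close>
lemma coefficient_domination:
  fixes a :: "nat \<Rightarrow> ('i::finite \<Rightarrow> nat) \<Rightarrow> complex" and p :: "'i \<Rightarrow> nat"
  assumes p: "inj p" "\<And>i. prime (p i)"
    and a: "\<And>k. (\<lambda>\<alpha>. norm (a k \<alpha>) * (1 / real (godel p \<alpha>) ^ s0)) summable_on UNIV"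
      "\<And>k. (\<Sum>\<^sub>\<infinity>\<alpha>. norm (a k \<alpha>) * (1 / real (godel p \<alpha>) ^ s0)) \<le> 1"
  obtains K :: nat and s C
  where "s \<ge> s0" "\<And>u j. (\<And>i. norm (u i) \<le> 1 / real (p i) ^ s) \<Longrightarrow>
    norm (series_at (a j) u) \<le> C * (\<Sum>k\<le>K. norm (series_at (a k) u))"
proof -
  define N where "N = (\<lambda>\<alpha>. real (godel p \<alpha>))"
  have N1: "N \<alpha> \<ge> 1" for \<alpha> using godel_pos[of p \<alpha>] p(2) by (simp add: N_def)
  have Npos: "N \<alpha> > 0" for \<alpha> using N1[of \<alpha>] by linarith
  define P where "P s = {u :: 'i \<Rightarrow> complex. \<forall>i. norm (u i) \<le> 1 / real (p i) ^ s}" for s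
  define A where "A K u = (\<Sum>k\<le>K. norm (series_at (a k) u))" for K u
  have A0: "A K u \<ge> 0" for K u by (simp add: A_def sum_nonneg)
  have Amono: "A K u \<le> A K' u" if "K \<le> K'" for K K' u
    unfolding A_def by (rule sum_mono2) (use that in auto)
  have Ak: "norm (series_at (a k) u) \<le> A K u" if "k \<le> K" for k K u
    unfolding A_def using member_le_sum[of k "{..K}" "\<lambda>k. norm (series_at (a k) u)"] that by auto
  define w where "w s \<alpha> = 1 / N \<alpha> ^ s" for s \<alpha>
  have w0: "0 < w s \<alpha>" for s \<alpha> using Npos by (simp add: w_def)
  note w0' = less_imp_le[OF w0]
  have wadd: "w s (\<lambda>x. \<alpha> x + \<beta> x) = w s \<alpha> * w s \<beta>" for s \<alpha> \<beta>
    by (simp add: w_def N_def godel_add power_mult_distrib)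
  define sm where "sm s c \<longleftrightarrow> (\<lambda>\<alpha>. norm (c \<alpha>) * w s \<alpha>) summable_on UNIV" for s and c :: "('i \<Rightarrow> nat) \<Rightarrow> complex"
  have wmono: "w s' \<alpha> \<le> w s \<alpha>" if "s \<le> s'" for s s' \<alpha>
    unfolding w_def using Npos N1 that by (intro divide_left_mono power_increasing mult_pos_pos) auto
  have smmono: "sm s' c" if "sm s c" "s \<le> s'" for s s' c
    using that(1) unfolding sm_def
    by (rule summable_on_comparison_test) (auto intro!: mult_left_mono wmono[OF that(2)] mult_nonneg_nonneg w0')
  have psmall: "1 / real (p i) ^ s' \<le> 1 / real (p i) ^ s" if "s \<le> s'" for s s' i
    using p(2)[of i] that prime_gt_0_nat[of "p i"] by (intro divide_left_mono power_increasing mult_pos_pos) (auto simp: Suc_leI)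
  have Pmono: "u \<in> P s" if "u \<in> P s'" "s \<le> s'" for s s' u
    using that psmall[OF that(2)] unfolding P_def by (auto intro: order_trans)
  have mon: "norm (monom_at u \<alpha>) \<le> w s \<alpha>" if "u \<in> P s" for u s \<alpha>
    using that unfolding w_def N_def P_def by (intro norm_monom_at_le) auto
  define I where "I = {c. \<exists>s\<ge>s0. \<exists>K C. sm s c \<and> (\<forall>u\<in>P s. norm (series_at c u) \<le> C * A K u)}"
  define lead where "lead c \<alpha> \<longleftrightarrow> c \<alpha> \<noteq> 0 \<and> (\<forall>\<beta>. c \<beta> \<noteq> 0 \<longrightarrow> N \<alpha> \<le> N \<beta>)" for c :: "('i \<Rightarrow> nat) \<Rightarrow> complex" and \<alpha>
  have lead_ex: "\<exists>\<alpha>. lead c \<alpha>" if "c \<beta> \<noteq> 0" for c \<beta>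
    using ex_has_least_nat[of "\<lambda>\<alpha>. c \<alpha> \<noteq> 0" \<beta> "godel p"] that by (auto simp: lead_def N_def)
  define L where "L = {\<alpha>. \<exists>c\<in>I. lead c \<alpha>}"
  obtain S0 where S0: "finite S0" "S0 \<subseteq> L" "\<And>\<beta>. \<beta> \<in> L \<Longrightarrow> \<exists>\<alpha>\<in>S0. \<alpha> \<le> \<beta>"
    by (rule dickson_lemma[of L]) blast
  have "\<exists>g s1 K C. s1 \<ge> s0 \<and> sm s1 g \<and> lead g \<alpha> \<and> g \<alpha> = 1 \<and> C \<ge> 0 \<and> (\<forall>u\<in>P s1. norm (series_at g u) \<le> C * A K u)"
    if "\<alpha> \<in> S0" for \<alpha>
  proof -
    have "\<exists>c\<in>I. lead c \<alpha>" using S0(2) that by (auto simp: L_def)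
    then obtain c where c: "c \<in> I" "lead c \<alpha>" by blast
    then obtain s1 K C where d: "s1 \<ge> s0" "sm s1 c" "\<And>u. u \<in> P s1 \<Longrightarrow> norm (series_at c u) \<le> C * A K u"
      unfolding I_def by blast
    have ca: "c \<alpha> \<noteq> 0" using c by (simp add: lead_def)
    define g where "g = (\<lambda>\<beta>. c \<beta> / c \<alpha>)"
    have "sm s1 g" using summable_on_cmult_left[OF d(2)[unfolded sm_def], of "1 / norm (c \<alpha>)"]
      by (simp add: sm_def g_def norm_divide)
    moreover have "lead g \<alpha>" "g \<alpha> = 1" using c ca by (auto simp: lead_def g_def)
    moreover have "series_at g u = series_at c u / c \<alpha>" for u
      using infsum_cmult_left'[of "\<lambda>\<beta>. c \<beta> * monom_at u \<beta>" "1 / c \<alpha>" UNIV]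
      by (simp add: series_at_def g_def)
    then have "norm (series_at g u) \<le> (\<bar>C\<bar> / norm (c \<alpha>)) * A K u" if "u \<in> P s1" for u
    proof -
      have "norm (series_at c u) \<le> \<bar>C\<bar> * A K u"
        using d(3)[OF that] mult_right_mono[OF abs_ge_self[of C] A0[of K u]] by linarith
      then show ?thesis using ca \<open>series_at g u = series_at c u / c \<alpha>\<close> by (simp add: norm_divide divide_right_mono)
    qed
    ultimately show ?thesis using d(1) by (intro exI[of _ g] exI[of _ s1] exI[of _ K] exI[of _ "\<bar>C\<bar> / norm (c \<alpha>)"]) auto
  qed
  then have "\<forall>\<alpha>\<in>S0. \<exists>g s1 K C. s1 \<ge> s0 \<and> sm s1 g \<and> lead g \<alpha> \<and> g \<alpha> = 1 \<and> C \<ge> 0 \<and> (\<forall>u\<in>P s1. norm (series_at g u) \<le> C * A K u)" by blast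
  from this[unfolded bchoice_iff]
  obtain g s1 K1 C1 where g0: "\<forall>\<alpha>\<in>S0. s0 \<le> s1 \<alpha> \<and> sm (s1 \<alpha>) (g \<alpha>) \<and> lead (g \<alpha>) \<alpha> \<and> g \<alpha> \<alpha> = 1 \<and> 0 \<le> C1 \<alpha> \<and>
      (\<forall>u\<in>P (s1 \<alpha>). norm (series_at (g \<alpha>) u) \<le> C1 \<alpha> * A (K1 \<alpha>) u)"
    by (elim exE)
  have g: "\<And>\<alpha>. \<alpha> \<in> S0 \<Longrightarrow> s1 \<alpha> \<ge> s0" "\<And>\<alpha>. \<alpha> \<in> S0 \<Longrightarrow> sm (s1 \<alpha>) (g \<alpha>)"
    "\<And>\<alpha>. \<alpha> \<in> S0 \<Longrightarrow> lead (g \<alpha>) \<alpha>" "\<And>\<alpha>. \<alpha> \<in> S0 \<Longrightarrow> g \<alpha> \<alpha> = 1" "\<And>\<alpha>. \<alpha> \<in> S0 \<Longrightarrow> C1 \<alpha> \<ge> 0"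
    "\<And>\<alpha> u. \<alpha> \<in> S0 \<Longrightarrow> u \<in> P (s1 \<alpha>) \<Longrightarrow> norm (series_at (g \<alpha>) u) \<le> C1 \<alpha> * A (K1 \<alpha>) u"
    using g0 by simp_all
  define E0 where "E0 \<alpha> \<gamma> = (if \<gamma> = \<alpha> then 0 else g \<alpha> \<gamma>)" for \<alpha> \<gamma>
  have "\<exists>s2\<ge>s1 \<alpha>. \<forall>s\<ge>s2. (\<lambda>\<gamma>. norm (E0 \<alpha> \<gamma>) * w s \<gamma>) summable_on UNIV \<and>
           (\<Sum>\<^sub>\<infinity>\<gamma>. norm (E0 \<alpha> \<gamma>) * w s \<gamma>) \<le> w s \<alpha> / 2" if al: "\<alpha> \<in> S0" for \<alpha>
  proof -
    define t where "t = s1 \<alpha>"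
    have s_t: "(\<lambda>\<gamma>. norm (E0 \<alpha> \<gamma>) * w t \<gamma>) summable_on UNIV"
      using g(2)[OF al] unfolding sm_def t_def
      by (rule summable_on_comparison_test) (auto simp: E0_def w0' intro!: mult_nonneg_nonneg)
    define B where "B = (\<Sum>\<^sub>\<infinity>\<gamma>. norm (E0 \<alpha> \<gamma>) * w t \<gamma>)"
    have gap: "N \<gamma> \<ge> N \<alpha> + 1" if "E0 \<alpha> \<gamma> \<noteq> 0" for \<gamma>
    proof -
      have "\<gamma> \<noteq> \<alpha>" "N \<alpha> \<le> N \<gamma>" using that g(3)[OF al] by (auto simp: E0_def lead_def split: if_splits)
      moreover have "godel p \<gamma> \<noteq> godel p \<alpha>" using inj_godel[OF p] \<open>\<gamma> \<noteq> \<alpha>\<close> by (simp add: inj_eq)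
      ultimately show ?thesis unfolding N_def by linarith
    qed
    \<comment> \<open>Raising the exponent of the weights by \<open>m\<close> multiplies the norm of the tail, relative to that of
        the leading term, by at most \<open>\<theta> ^ m\<close>.\<close>
    define \<theta> where "\<theta> = N \<alpha> / (N \<alpha> + 1)"
    have th: "0 < \<theta>" "\<theta> < 1" using Npos[of \<alpha>] by (auto simp: \<theta>_def)
    have "(\<lambda>m. \<theta> ^ m * (2 * B * N \<alpha> ^ t)) \<longlonglongrightarrow> 0 * (2 * B * N \<alpha> ^ t)"
      using th by (intro tendsto_intros LIMSEQ_realpow_zero) auto
    then have "\<forall>\<^sub>F m in sequentially. \<theta> ^ m * (2 * B * N \<alpha> ^ t) < 1"
      by (intro order_tendstoD(2)) auto
    then obtain m0 where m0: "\<And>m. m \<ge> m0 \<Longrightarrow> \<theta> ^ m * (2 * B * N \<alpha> ^ t) < 1"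
      unfolding eventually_sequentially by blast
    show ?thesis
    proof (intro exI[of _ "t + m0"] conjI allI impI)
      show "s1 \<alpha> \<le> t + m0" by (simp add: t_def)
      fix s assume s: "s \<ge> t + m0"
      define m where "m = s - t"
      have m: "s = t + m" "m \<ge> m0" using s by (auto simp: m_def)
      have pt: "norm (E0 \<alpha> \<gamma>) * w s \<gamma> \<le> norm (E0 \<alpha> \<gamma>) * w t \<gamma> * (1 / (N \<alpha> + 1) ^ m)" for \<gamma>
      proof (cases "E0 \<alpha> \<gamma> = 0")
        case False
        have "w m \<gamma> \<le> 1 / (N \<alpha> + 1) ^ m" unfolding w_def
          using gap[OF False] Npos[of \<alpha>] Npos[of \<gamma>] by (intro divide_left_mono power_mono mult_pos_pos) auto
        then have "norm (E0 \<alpha> \<gamma>) * w t \<gamma> * w m \<gamma> \<le> norm (E0 \<alpha> \<gamma>) * w t \<gamma> * (1 / (N \<alpha> + 1) ^ m)"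
          by (intro mult_left_mono mult_nonneg_nonneg w0') auto
        then show ?thesis by (simp add: m w_def power_add)
      qed auto
      have rs: "(\<lambda>\<gamma>. norm (E0 \<alpha> \<gamma>) * w t \<gamma> * (1 / (N \<alpha> + 1) ^ m)) summable_on UNIV"
        by (rule summable_on_cmult_left[OF s_t])
      show ls: "(\<lambda>\<gamma>. norm (E0 \<alpha> \<gamma>) * w s \<gamma>) summable_on UNIV"
        by (rule summable_on_comparison_test[OF rs]) (use pt in \<open>auto intro!: mult_nonneg_nonneg w0'\<close>)
      have "(\<Sum>\<^sub>\<infinity>\<gamma>. norm (E0 \<alpha> \<gamma>) * w s \<gamma>) \<le> (\<Sum>\<^sub>\<infinity>\<gamma>. norm (E0 \<alpha> \<gamma>) * w t \<gamma> * (1 / (N \<alpha> + 1) ^ m))"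
        by (rule infsum_mono[OF ls rs pt])
      also have "\<dots> = B * (1 / (N \<alpha> + 1) ^ m)" unfolding B_def by (rule infsum_cmult_left')
      also have "\<dots> = (\<theta> ^ m * (2 * B * N \<alpha> ^ t)) * (w s \<alpha> / 2)"
        using Npos[of \<alpha>] by (simp add: w_def \<theta>_def m power_add power_divide field_simps)
      also have "\<dots> \<le> 1 * (w s \<alpha> / 2)"
        using m0[OF m(2)] w0[of s \<alpha>] by (intro mult_right_mono) auto
      finally show "(\<Sum>\<^sub>\<infinity>\<gamma>. norm (E0 \<alpha> \<gamma>) * w s \<gamma>) \<le> w s \<alpha> / 2" by simp
    qed
  qed
  then have "\<forall>\<alpha>\<in>S0. \<exists>s2\<ge>s1 \<alpha>. \<forall>s\<ge>s2. (\<lambda>\<gamma>. norm (E0 \<alpha> \<gamma>) * w s \<gamma>) summable_on UNIV \<and>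
           (\<Sum>\<^sub>\<infinity>\<gamma>. norm (E0 \<alpha> \<gamma>) * w s \<gamma>) \<le> w s \<alpha> / 2" by blast
  from this[unfolded bchoice_iff]
  obtain s2 where s20: "\<forall>\<alpha>\<in>S0. s2 \<alpha> \<ge> s1 \<alpha> \<and> (\<forall>s\<ge>s2 \<alpha>. (\<lambda>\<gamma>. norm (E0 \<alpha> \<gamma>) * w s \<gamma>) summable_on UNIV \<and>
           (\<Sum>\<^sub>\<infinity>\<gamma>. norm (E0 \<alpha> \<gamma>) * w s \<gamma>) \<le> w s \<alpha> / 2)" by (elim exE)
  have s2: "\<And>\<alpha>. \<alpha> \<in> S0 \<Longrightarrow> s2 \<alpha> \<ge> s1 \<alpha>"
     "\<And>\<alpha> s. \<alpha> \<in> S0 \<Longrightarrow> s \<ge> s2 \<alpha> \<Longrightarrow> (\<lambda>\<gamma>. norm (E0 \<alpha> \<gamma>) * w s \<gamma>) summable_on UNIV"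
     "\<And>\<alpha> s. \<alpha> \<in> S0 \<Longrightarrow> s \<ge> s2 \<alpha> \<Longrightarrow> (\<Sum>\<^sub>\<infinity>\<gamma>. norm (E0 \<alpha> \<gamma>) * w s \<gamma>) \<le> w s \<alpha> / 2"
    using s20 by simp_all
  define s where "s = s0 + (\<Sum>\<alpha>\<in>S0. s2 \<alpha>)"
  define K where "K = (\<Sum>\<alpha>\<in>S0. K1 \<alpha>)"
  define C' where "C' = (\<Sum>\<alpha>\<in>S0. N \<alpha> ^ s * C1 \<alpha>)"
  have ss2: "s2 \<alpha> \<le> s" if "\<alpha> \<in> S0" for \<alpha>
    unfolding s_def using member_le_sum[of \<alpha> S0 s2] that S0(1) by auto
  have KK1: "K1 \<alpha> \<le> K" if "\<alpha> \<in> S0" for \<alpha>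
    unfolding K_def using member_le_sum[of \<alpha> S0 K1] that S0(1) by auto
  have CC1: "N \<alpha> ^ s * C1 \<alpha> \<le> C'" if "\<alpha> \<in> S0" for \<alpha>
    unfolding C'_def using member_le_sum[of \<alpha> S0 "\<lambda>\<alpha>. N \<alpha> ^ s * C1 \<alpha>"] that S0(1) g(5) Npos
    by (auto simp: less_imp_le)
  have C'0: "C' \<ge> 0" unfolding C'_def using g(5) Npos by (intro sum_nonneg mult_nonneg_nonneg) (auto simp: less_imp_le)
  define up where "up \<beta> \<longleftrightarrow> (\<exists>\<alpha>\<in>S0. \<alpha> \<le> \<beta>)" for \<beta>
  \<comment> \<open>Reducing the exponent \<open>\<beta>\<close> uses the series \<open>g (i \<beta>)\<close> times the monomial of exponent \<open>\<delta> \<beta>\<close>; the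
      row \<open>E \<beta>\<close> is the tail of this product.\<close>
  define i where "i \<beta> = (SOME \<alpha>. \<alpha> \<in> S0 \<and> \<alpha> \<le> \<beta>)" for \<beta>
  have i: "i \<beta> \<in> S0" "i \<beta> \<le> \<beta>" if "up \<beta>" for \<beta>
    using someI_ex[of "\<lambda>\<alpha>. \<alpha> \<in> S0 \<and> \<alpha> \<le> \<beta>"] that unfolding up_def i_def by auto
  define \<delta> where "\<delta> \<beta> = (\<lambda>x. \<beta> x - i \<beta> x)" for \<beta>
  have \<delta>: "\<beta> = (\<lambda>x. i \<beta> x + \<delta> \<beta> x)" if "up \<beta>" for \<beta>
    using i(2)[OF that] by (auto simp: \<delta>_def le_fun_def fun_eq_iff)
  define E where "E \<beta> = (if up \<beta> then shift (\<delta> \<beta>) (E0 (i \<beta>)) else (\<lambda>_. 0))" for \<beta>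
  have shape: "shift \<delta> F (\<lambda>i. \<gamma> i + \<delta> i) = F \<gamma>" for \<delta> \<gamma> :: "'i \<Rightarrow> nat" and F :: "('i \<Rightarrow> nat) \<Rightarrow> complex"
    by (simp add: shift_def le_fun_def)
  have shz: "shift \<delta> F \<gamma> = 0" if "\<not> \<delta> \<le> \<gamma>" for \<delta> \<gamma> :: "'i \<Rightarrow> nat" and F :: "('i \<Rightarrow> nat) \<Rightarrow> complex"
    using that by (simp add: shift_def)
  have E1: "(\<lambda>\<gamma>. norm (E \<beta> \<gamma>) * w s \<gamma>) summable_on UNIV \<and>
     (\<Sum>\<^sub>\<infinity>\<gamma>. norm (E \<beta> \<gamma>) * w s \<gamma>) \<le> w s \<beta> / 2" for \<beta>
  proof (cases "up \<beta>")
    case True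
    note ib = i[OF True]
    have e: "norm (shift (\<delta> \<beta>) (E0 (i \<beta>)) (\<lambda>x. \<gamma> x + \<delta> \<beta> x)) * w s (\<lambda>x. \<gamma> x + \<delta> \<beta> x)
        = (norm (E0 (i \<beta>) \<gamma>) * w s \<gamma>) * w s (\<delta> \<beta>)" for \<gamma>
      by (simp add: shape wadd)
    note sh = infsum_shift[of "\<delta> \<beta>" "\<lambda>\<gamma>. norm (shift (\<delta> \<beta>) (E0 (i \<beta>)) \<gamma>) * w s \<gamma>"]
    have 1: "(\<lambda>\<gamma>. norm (E \<beta> \<gamma>) * w s \<gamma>) summable_on UNIV"
      using sh(2) summable_on_cmult_left[OF s2(2)[OF ib(1) ss2[OF ib(1)]], of "w s (\<delta> \<beta>)"] True
      by (simp add: E_def shz e)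
    have "(\<Sum>\<^sub>\<infinity>\<gamma>. norm (E \<beta> \<gamma>) * w s \<gamma>) = (\<Sum>\<^sub>\<infinity>\<gamma>. (norm (E0 (i \<beta>) \<gamma>) * w s \<gamma>) * w s (\<delta> \<beta>))"
      using sh(1) True by (simp add: E_def shz e)
    also have "\<dots> = (\<Sum>\<^sub>\<infinity>\<gamma>. (norm (E0 (i \<beta>) \<gamma>) * w s \<gamma>)) * w s (\<delta> \<beta>)"
      by (rule infsum_cmult_left')
    also have "\<dots> \<le> (w s (i \<beta>) / 2) * w s (\<delta> \<beta>)"
      using s2(3)[OF ib(1) ss2[OF ib(1)]] w0[of s "\<delta> \<beta>"] by (intro mult_right_mono) auto
    also have "\<dots> = w s \<beta> / 2"
      using wadd[of s "i \<beta>" "\<delta> \<beta>"] \<delta>[OF True] by simp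
    finally show ?thesis using 1 by simp
  qed (use w0[of s \<beta>] in \<open>simp_all add: E_def\<close>)
  have evE: "monom_at u \<beta> + (\<Sum>\<^sub>\<infinity>\<gamma>. E \<beta> \<gamma> * monom_at u \<gamma>) = monom_at u (\<delta> \<beta>) * series_at (g (i \<beta>)) u"
    if u: "u \<in> P s" and ub: "up \<beta>" for u \<beta>
  proof -
    note ib = i[OF ub]
    define \<alpha> where "\<alpha> = i \<beta>"
    have E0s: "(\<lambda>\<gamma>. E0 \<alpha> \<gamma> * monom_at u \<gamma>) summable_on UNIV"
    proof (rule abs_summable_summable, rule Infinite_Sum.abs_summable_on_comparison_test')
      show "(\<lambda>\<gamma>. norm (E0 \<alpha> \<gamma>) * w s \<gamma>) summable_on UNIV"
        unfolding \<alpha>_def by (rule s2(2)[OF ib(1) ss2[OF ib(1)]])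
    qed (auto simp: norm_mult intro!: mult_left_mono mon[OF u])
    have "(\<Sum>\<^sub>\<infinity>\<gamma>. E \<beta> \<gamma> * monom_at u \<gamma>) = (\<Sum>\<^sub>\<infinity>\<gamma>. E0 \<alpha> \<gamma> * monom_at u \<gamma> * monom_at u (\<delta> \<beta>))"
      using infsum_shift(1)[of "\<delta> \<beta>" "\<lambda>\<gamma>. shift (\<delta> \<beta>) (E0 \<alpha>) \<gamma> * monom_at u \<gamma>"] ub
      by (simp add: E_def shz shape monom_at_add mult.assoc \<alpha>_def)
    also have "\<dots> = (\<Sum>\<^sub>\<infinity>\<gamma>. E0 \<alpha> \<gamma> * monom_at u \<gamma>) * monom_at u (\<delta> \<beta>)"
      by (rule infsum_cmult_left')
    finally have 1: "(\<Sum>\<^sub>\<infinity>\<gamma>. E \<beta> \<gamma> * monom_at u \<gamma>) = (\<Sum>\<^sub>\<infinity>\<gamma>. E0 \<alpha> \<gamma> * monom_at u \<gamma>) * monom_at u (\<delta> \<beta>)" .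
    have "((\<lambda>\<gamma>. (if \<gamma> = \<alpha> then monom_at u \<alpha> else 0)) has_sum (monom_at u \<alpha>)) UNIV"
      using has_sum_finite_neutralI[of "{\<alpha>}" UNIV "\<lambda>\<gamma>. (if \<gamma> = \<alpha> then monom_at u \<alpha> else 0)" "monom_at u \<alpha>"] by simp
    from has_sum_add[OF this has_sum_infsum[OF E0s]]
    have "((\<lambda>\<gamma>. g \<alpha> \<gamma> * monom_at u \<gamma>) has_sum (monom_at u \<alpha> + (\<Sum>\<^sub>\<infinity>\<gamma>. E0 \<alpha> \<gamma> * monom_at u \<gamma>))) UNIV"
    proof (rule has_sum_cong[THEN iffD1, rotated])
      show "(if \<gamma> = \<alpha> then monom_at u \<alpha> else 0) + E0 \<alpha> \<gamma> * monom_at u \<gamma> = g \<alpha> \<gamma> * monom_at u \<gamma>" for \<gamma>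
        using g(4)[OF ib(1)] by (auto simp: E0_def \<alpha>_def)
    qed
    then have "series_at (g \<alpha>) u = monom_at u \<alpha> + (\<Sum>\<^sub>\<infinity>\<gamma>. E0 \<alpha> \<gamma> * monom_at u \<gamma>)"
      unfolding series_at_def by (rule infsumI)
    moreover have "monom_at u \<beta> = monom_at u \<alpha> * monom_at u (\<delta> \<beta>)"
      using monom_at_add[of u "i \<beta>" "\<delta> \<beta>"] \<delta>[OF ub] by (simp add: \<alpha>_def)
    ultimately show ?thesis using 1 by (simp add: algebra_simps \<alpha>_def)
  qed
  have bound: "norm (series_at (a j) u) \<le> (2 * C') * A K u" if u: "u \<in> P s" for j u
  proof -
    have ss0: "s0 \<le> s" by (simp add: s_def)
    have "sm s0 (a j)" using a(1) by (simp add: sm_def w_def N_def)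
    then have aj: "sm s (a j)" using smmono ss0 by blast
    have aj1: "(\<Sum>\<^sub>\<infinity>\<alpha>. norm (a j \<alpha>) * w s \<alpha>) \<le> 1"
    proof -
      have "(\<Sum>\<^sub>\<infinity>\<alpha>. norm (a j \<alpha>) * w s \<alpha>) \<le> (\<Sum>\<^sub>\<infinity>\<alpha>. norm (a j \<alpha>) * w s0 \<alpha>)"
        using aj \<open>sm s0 (a j)\<close> by (intro infsum_mono mult_left_mono wmono[OF ss0]) (auto simp: sm_def)
      then show ?thesis using a(2)[of j] by (simp add: w_def N_def)
    qed
    obtain x where x: "(\<lambda>\<gamma>. norm (x \<gamma>) * w s \<gamma>) summable_on UNIV"
      "(\<Sum>\<^sub>\<infinity>\<gamma>. norm (x \<gamma>) * w s \<gamma>) \<le> 2 * (\<Sum>\<^sub>\<infinity>\<gamma>. norm (a j \<gamma>) * w s \<gamma>)"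
      "\<And>\<psi>. (\<And>\<gamma>. norm (\<psi> \<gamma>) \<le> w s \<gamma>) \<Longrightarrow>
       (\<Sum>\<^sub>\<infinity>\<beta>. x \<beta> * (\<psi> \<beta> + (\<Sum>\<^sub>\<infinity>\<gamma>. E \<beta> \<gamma> * \<psi> \<gamma>))) = (\<Sum>\<^sub>\<infinity>\<gamma>. a j \<gamma> * \<psi> \<gamma>)"
      by (rule neumann_series_l1[of "w s" E "a j", OF w0 conjunct1[OF E1] conjunct2[OF E1] aj[unfolded sm_def]]) (rule that, assumption, assumption, blast)
    \<comment> \<open>\<open>x\<close> collects the coefficients of the division: those with \<open>up \<beta>\<close> are the quotients, which
        contribute \<open>Q\<close>, and the others form the remainder \<open>R\<close>.\<close>
    define R where "R \<beta> = (if up \<beta> then 0 else x \<beta>)" for \<beta>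
    define Q where "Q u \<beta> = (if up \<beta> then x \<beta> * (monom_at u (\<delta> \<beta>) * series_at (g (i \<beta>)) u) else 0)" for u \<beta>
    have Rsm: "sm s R" unfolding sm_def
      by (rule summable_on_comparison_test[OF x(1)]) (auto simp: R_def w0' intro!: mult_nonneg_nonneg)
    have Qle: "norm (Q u \<beta>) \<le> norm (x \<beta>) * w s \<beta> * (C' * A K u)" if u: "u \<in> P s" for u \<beta>
    proof (cases "up \<beta>")
      case True
      note ib = i[OF True]
      have "norm (series_at (g (i \<beta>)) u) \<le> C1 (i \<beta>) * A (K1 (i \<beta>)) u"
        using g(6)[OF ib(1)] Pmono[OF u] ss2[OF ib(1)] s2(1)[OF ib(1)] by (meson order_trans)
      also have "\<dots> \<le> C1 (i \<beta>) * A K u" using Amono[OF KK1[OF ib(1)]] g(5)[OF ib(1)] by (intro mult_left_mono)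
      finally have 1: "norm (series_at (g (i \<beta>)) u) \<le> C1 (i \<beta>) * A K u" .
      have "norm (monom_at u (\<delta> \<beta>) * series_at (g (i \<beta>)) u) \<le> w s (\<delta> \<beta>) * (C1 (i \<beta>) * A K u)"
        unfolding norm_mult by (intro mult_mono mon[OF u] 1) (use w0'[of s "\<delta> \<beta>"] in auto)
      also have "\<dots> = w s \<beta> * ((N (i \<beta>) ^ s * C1 (i \<beta>)) * A K u)"
        using Npos[of "i \<beta>"] wadd[of s "i \<beta>" "\<delta> \<beta>"] \<delta>[OF True] by (simp add: w_def)
      also have "\<dots> \<le> w s \<beta> * (C' * A K u)"
        by (intro mult_left_mono mult_right_mono CC1[OF ib(1)] A0 w0')
      finally show ?thesis using True
        using mult_left_mono[of "norm (monom_at u (\<delta> \<beta>) * series_at (g (i \<beta>)) u)" "w s \<beta> * (C' * A K u)" "norm (x \<beta>)"]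
        by (simp add: Q_def norm_mult mult.assoc)
    qed (use w0'[of s \<beta>] C'0 A0[of K u] in \<open>auto simp: Q_def\<close>)
    have key: "series_at (a j) u = infsum (Q u) UNIV + series_at R u \<and> norm (infsum (Q u) UNIV) \<le> 2 * C' * A K u" if u: "u \<in> P s" for u
    proof -
      have Qs: "l1 (Q u)"
        by (rule Infinite_Sum.abs_summable_on_comparison_test'[OF summable_on_cmult_left[OF x(1)] Qle[OF u]])
      have Rs: "(\<lambda>\<beta>. R \<beta> * monom_at u \<beta>) summable_on UNIV"
        by (rule abs_summable_summable, rule Infinite_Sum.abs_summable_on_comparison_test'[OF Rsm[unfolded sm_def]])
          (auto simp: norm_mult intro!: mult_left_mono mon[OF u])
      have "series_at (a j) u = (\<Sum>\<^sub>\<infinity>\<beta>. x \<beta> * (monom_at u \<beta> + (\<Sum>\<^sub>\<infinity>\<gamma>. E \<beta> \<gamma> * monom_at u \<gamma>)))"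
        unfolding series_at_def by (rule x(3)[symmetric]) (rule mon[OF u])
      also have "\<dots> = (\<Sum>\<^sub>\<infinity>\<beta>. Q u \<beta> + R \<beta> * monom_at u \<beta>)"
      proof (rule infsum_cong)
        show "x \<beta> * (monom_at u \<beta> + (\<Sum>\<^sub>\<infinity>\<gamma>. E \<beta> \<gamma> * monom_at u \<gamma>)) = Q u \<beta> + R \<beta> * monom_at u \<beta>" for \<beta>
          using evE[OF u, of \<beta>] by (cases "up \<beta>") (simp_all add: Q_def R_def E_def)
      qed
      also have "\<dots> = infsum (Q u) UNIV + series_at R u"
        unfolding series_at_def by (rule infsum_add[OF abs_summable_summable[OF Qs] Rs])
      finally have 1: "series_at (a j) u = infsum (Q u) UNIV + series_at R u" .
      have "norm (infsum (Q u) UNIV) \<le> (\<Sum>\<^sub>\<infinity>\<beta>. norm (Q u \<beta>))" by (rule norm_infsum_bound[OF Qs])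
      also have "\<dots> \<le> (\<Sum>\<^sub>\<infinity>\<beta>. norm (x \<beta>) * w s \<beta> * (C' * A K u))"
        by (rule infsum_mono[OF Qs summable_on_cmult_left[OF x(1)] Qle[OF u]])
      also have "\<dots> = (\<Sum>\<^sub>\<infinity>\<beta>. norm (x \<beta>) * w s \<beta>) * (C' * A K u)" by (rule infsum_cmult_left')
      also have "\<dots> \<le> 2 * (C' * A K u)"
        using x(2) aj1 C'0 A0 by (intro mult_right_mono mult_nonneg_nonneg) auto
      finally show ?thesis using 1 by simp
    qed
    have dom: "norm (series_at R u) \<le> (1 + 2 * C') * A (max K j) u" if u: "u \<in> P s" for u
    proof -
      have "norm (series_at R u) \<le> norm (series_at (a j) u) + norm (infsum (Q u) UNIV)"
        using key[OF u] norm_triangle_ineq4[of "series_at (a j) u" "infsum (Q u) UNIV"] by simp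
      also have "\<dots> \<le> A (max K j) u + 2 * C' * A (max K j) u"
        using key[OF u] Ak[of j "max K j" u] mult_left_mono[OF Amono[of K "max K j" u], of "2 * C'"] C'0 by simp
      also have "\<dots> = (1 + 2 * C') * A (max K j) u" by (simp add: algebra_simps)
      finally show ?thesis .
    qed
    \<comment> \<open>\<open>R\<close> is dominated by the series of index at most \<open>max K j\<close>, but no exponent of \<open>R\<close> lies above \<open>S0\<close>.\<close>
    have "R \<in> I" unfolding I_def using ss0 Rsm dom by blast
    have R0: "R \<beta> = 0" for \<beta>
    proof (rule ccontr)
      assume "R \<beta> \<noteq> 0"
      then obtain \<beta>0 where b0: "lead R \<beta>0" using lead_ex by blast
      then have "\<beta>0 \<in> L" using \<open>R \<in> I\<close> by (auto simp: L_def)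
      then have "up \<beta>0" using S0(3) by (simp add: up_def)
      then show False using b0 by (simp add: lead_def R_def)
    qed
    have "series_at R u = 0" by (simp add: series_at_def R0)
    then show ?thesis using key[OF u] by simp
  qed
  show thesis
  proof (rule that[of s "2 * C'" K])
    show "s0 \<le> s" by (simp add: s_def)
    show "norm (series_at (a j) u) \<le> 2 * C' * (\<Sum>k\<le>K. norm (series_at (a k) u))" if "\<And>i. norm (u i) \<le> 1 / real (p i) ^ s" for u j
      using bound[of u j] that by (simp add: P_def A_def)
  qed
qed

section \<open>Taylor coefficients of separately holomorphic functions\<close>

lemma taylor_coeff_bound:
  assumes "f holomorphic_on ball 0 R" "\<And>z. z \<in> ball 0 R \<Longrightarrow> norm (f z) \<le> M" "0 < R"
  shows "norm ((deriv ^^ k) f 0 / fact k) \<le> M / R ^ k"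
proof -
  have "norm ((deriv ^^ k) f 0 / fact k) \<le> M / r ^ k" if r: "0 < r" "r < R" for r
  proof -
    have "norm ((deriv ^^ k) f 0) \<le> fact k * M / r ^ k"
    proof (rule Cauchy_inequality)
      show "f holomorphic_on ball 0 r" by (rule holomorphic_on_subset[OF assms(1)]) (use r in auto)
      show "continuous_on (cball 0 r) f"
        by (rule continuous_on_subset[OF holomorphic_on_imp_continuous_on[OF assms(1)]]) (use r in auto)
    qed (use r assms in auto)
    then show ?thesis using r by (simp add: norm_divide field_simps)
  qed
  then have le: "\<forall>\<^sub>F r in at_left R. norm ((deriv ^^ k) f 0 / fact k) \<le> M / r ^ k"
    using eventually_at_left_real[OF \<open>0 < R\<close>] by (auto elim: eventually_mono)
  have "((\<lambda>r. M / r ^ k) \<longlongrightarrow> M / R ^ k) (at_left R)"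
    using \<open>0 < R\<close> by (intro tendsto_intros) auto
  from tendsto_lowerbound[OF this le] show ?thesis by simp
qed

text \<open>Taylor coefficients depend holomorphically on parameters already for separately holomorphic bounded
  functions: the \<open>k\<close>-th coefficient is the uniform limit of the quotients
  \<open>(h x y - (\<Sum>l<k. c l x * y ^ l)) / y ^ k\<close> as \<open>y\<close> tends to zero.\<close>
lemma taylor_coeff_holomorphic:
  fixes h :: "complex \<Rightarrow> complex \<Rightarrow> complex"
  assumes h1: "\<And>y. y \<in> ball 0 R' \<Longrightarrow> (\<lambda>x. h x y) holomorphic_on ball 0 R"
    and h2: "\<And>x. x \<in> ball 0 R \<Longrightarrow> h x holomorphic_on ball 0 R'"
    and M: "\<And>x y. x \<in> ball 0 R \<Longrightarrow> y \<in> ball 0 R' \<Longrightarrow> norm (h x y) \<le> M"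
    and R': "0 < R'"
  shows "(\<lambda>x. (deriv ^^ k) (h x) 0 / fact k) holomorphic_on ball 0 R"
proof (induction k rule: less_induct)
  case (less k)
  define c where "c l x = (deriv ^^ l) (h x) 0 / fact l" for l x
  define y where "y n = R' / 2 / real (Suc n)" for n
  define F where "F n x = (h x (y n) - (\<Sum>l<k. c l x * complex_of_real (y n) ^ l)) / complex_of_real (y n) ^ k" for n x
  have y: "0 < y n" "y n \<le> R' / 2" for n using R' by (auto simp: y_def divide_simps)
  have cb: "norm (c l x) \<le> M / R' ^ l" if "x \<in> ball 0 R" for l x
    unfolding c_def using taylor_coeff_bound[OF h2[OF that] M[OF that] R'] by blast
  have est: "norm (F n x - c k x) \<le> (2 * M / R' ^ Suc k) * y n" if x: "x \<in> ball 0 R" for n x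
  proof -
    have M0: "M \<ge> 0" using order_trans[OF norm_ge_zero M[OF x, of 0]] R' by simp
    define Y where "Y = complex_of_real (y n)"
    have Y: "Y \<noteq> 0" "Y \<in> ball 0 R'" "norm Y = y n" using y[of n] R' by (auto simp: Y_def)
    have s: "(\<lambda>l. c l x * Y ^ l) sums h x Y"
      using holomorphic_power_series[OF h2[OF x] Y(2)] by (simp add: c_def)
    have "(\<lambda>l. c (l + k) x * Y ^ (l + k)) sums (h x Y - (\<Sum>l<k. c l x * Y ^ l))"
      by (rule sums_split_initial_segment[OF s])
    then have "(\<lambda>l. c (l + k) x * Y ^ (l + k) / Y ^ k) sums F n x"
      unfolding F_def Y_def[symmetric] by (rule sums_divide)
    then have s2: "(\<lambda>l. c (l + k) x * Y ^ l) sums F n x"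
      using Y by (simp add: power_add)
    have s3: "(\<lambda>l. c (Suc l + k) x * Y ^ Suc l) sums (F n x - c k x)"
      using sums_split_initial_segment[OF s2, of 1] by simp
    have le: "norm (c (Suc l + k) x * Y ^ Suc l) \<le> (M / R' ^ Suc k * y n) * (1/2) ^ l" for l
    proof -
      have "norm (c (Suc l + k) x * Y ^ Suc l) \<le> M / R' ^ (Suc l + k) * y n ^ Suc l"
        unfolding norm_mult norm_power Y(3) using cb[OF x, of "Suc l + k"] y[of n]
        by (intro mult_right_mono) auto
      also have "\<dots> = (M / R' ^ Suc k * y n) * (y n / R') ^ l"
        by (simp add: power_add power_divide mult_ac)
      also have "\<dots> \<le> (M / R' ^ Suc k * y n) * (1/2) ^ l"
        using M0 R' y[of n] by (intro mult_left_mono power_mono mult_nonneg_nonneg divide_nonneg_nonneg) (auto simp: field_simps)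
      finally show ?thesis .
    qed
    have g: "(\<lambda>l. (M / R' ^ Suc k * y n) * (1/2) ^ l) sums ((M / R' ^ Suc k * y n) * 2)"
      using sums_mult[OF geometric_sums[of "1/2::real"], of "M / R' ^ Suc k * y n"] by (simp add: mult_ac)
    have "norm (F n x - c k x) \<le> (M / R' ^ Suc k * y n) * 2"
      using norm_suminf_le[OF le sums_summable[OF g]] unfolding sums_unique[OF s3, symmetric] sums_unique[OF g, symmetric] .
    then show ?thesis by (simp add: mult_ac)
  qed
  have holF: "F n holomorphic_on ball 0 R" for n
  proof -
    have "c l holomorphic_on ball 0 R" if "l < k" for l
      using less[OF that] by (simp add: c_def[abs_def])
    moreover have "(\<lambda>x. h x (y n)) holomorphic_on ball 0 R" using y[of n] R' by (intro h1) auto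
    ultimately show ?thesis unfolding F_def[abs_def] using y[of n]
      by (intro holomorphic_intros) auto
  qed
  have lim: "uniform_limit (ball 0 R) F (c k) sequentially"
  proof (rule uniform_limitI)
    fix e :: real assume "e > 0"
    have "(\<lambda>n. (2 * M / R' ^ Suc k) * y n) \<longlonglongrightarrow> (2 * M / R' ^ Suc k) * 0"
      unfolding y_def by (intro tendsto_mult tendsto_const LIMSEQ_Suc) (rule lim_const_over_n)
    then have "\<forall>\<^sub>F n in sequentially. (2 * M / R' ^ Suc k) * y n < e"
      by (rule order_tendstoD(2)) (use \<open>e > 0\<close> in auto)
    then show "\<forall>\<^sub>F n in sequentially. \<forall>x\<in>ball 0 R. dist (F n x) (c k x) < e"
      by (rule eventually_mono) (auto simp: dist_norm intro!: le_less_trans[OF est])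
  qed
  have "c k holomorphic_on ball 0 R"
  proof (rule holomorphic_uniform_sequence[OF open_ball holF])
    fix x :: complex assume "x \<in> ball 0 R"
    then obtain d where "d > 0" "cball x d \<subseteq> ball 0 R" using open_contains_cball[THEN iffD1, OF open_ball] by blast
    then show "\<exists>d>0. cball x d \<subseteq> ball 0 R \<and> uniform_limit (cball x d) F (c k) sequentially"
      using uniform_limit_on_subset[OF lim] by blast
  qed
  then show ?case by (simp add: c_def[abs_def])
qed

definition sep_holomorphic :: "real \<Rightarrow> (('i \<Rightarrow> complex) \<Rightarrow> complex) \<Rightarrow> bool" where
  "sep_holomorphic R h \<longleftrightarrow>
     (\<forall>u i. (\<forall>j. norm (u j) < R) \<longrightarrow> (\<lambda>x. h (u(i := x))) holomorphic_on ball 0 R)"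

lemma sep_holomorphic_taylor_coeff:
  assumes h: "sep_holomorphic R h" and M: "\<And>u. (\<And>j. norm (u j) < R) \<Longrightarrow> norm (h u) \<le> M" and R: "0 < R"
  shows "sep_holomorphic R (\<lambda>u. (deriv ^^ k) (\<lambda>y. h (u(i := y))) 0 / fact k)"
  unfolding sep_holomorphic_def
proof (intro allI impI)
  fix u :: "'a \<Rightarrow> complex" and j assume u: "\<forall>j. norm (u j) < R"
  show "(\<lambda>x. (deriv ^^ k) (\<lambda>y. h ((u(j := x))(i := y))) 0 / fact k) holomorphic_on ball 0 R"
  proof (cases "i = j")
    case False
    show ?thesis
    proof (rule taylor_coeff_holomorphic[of R _ R M])
      fix y :: complex assume "y \<in> ball 0 R"
      then have "\<forall>l. norm ((u(i := y)) l) < R" using u by auto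
      then have "(\<lambda>x. h ((u(i := y))(j := x))) holomorphic_on ball 0 R"
        using h unfolding sep_holomorphic_def by blast
      then show "(\<lambda>x. h (u(j := x, i := y))) holomorphic_on ball 0 R"
        using False by (simp add: fun_upd_twist)
    next
      fix x :: complex assume "x \<in> ball 0 R"
      then have "\<forall>l. norm ((u(j := x)) l) < R" using u by auto
      then show "(\<lambda>y. h (u(j := x, i := y))) holomorphic_on ball 0 R"
        using h unfolding sep_holomorphic_def by blast
    next
      fix x y :: complex assume "x \<in> ball 0 R" "y \<in> ball 0 R"
      then show "norm (h (u(j := x, i := y))) \<le> M" using u by (intro M) auto
    qed (rule R)
  qed simp
qed

lemma taylor_coeff_sep_bound:
  assumes h: "sep_holomorphic R h" and M: "\<And>u. (\<And>j. norm (u j) < R) \<Longrightarrow> norm (h u) \<le> M" and R: "0 < R"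
    and u: "\<And>j. norm (u j) < R"
  shows "norm ((deriv ^^ k) (\<lambda>y. h (u(i := y))) 0 / fact k) \<le> M / R ^ k"
  by (rule taylor_coeff_bound) (use h u R in \<open>auto simp: sep_holomorphic_def intro!: M\<close>)

text \<open>The variables in \<open>A\<close> are expanded one after the other; the other variables are kept at \<open>0\<close>, so
  that the induction runs over finite sets inside a fixed type. Each step costs a factor \<open>2\<close>, the sum of
  the geometric series of ratio \<open>1/2\<close> that arises from passing to half the radius.\<close>
lemma sep_holomorphic_power_series_on:
  fixes h :: "('i::finite \<Rightarrow> complex) \<Rightarrow> complex"
  assumes A: "finite A"
    and h: "sep_holomorphic R h" and M: "\<And>u. (\<And>j. norm (u j) < R) \<Longrightarrow> norm (h u) \<le> M" and R: "0 < R"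
  shows "\<exists>c. (\<forall>\<alpha>. (\<exists>i. i \<notin> A \<and> \<alpha> i \<noteq> 0) \<longrightarrow> c \<alpha> = 0) \<and>
     (\<lambda>\<alpha>. norm (c \<alpha>) * (\<Prod>i\<in>UNIV. (R/2) ^ \<alpha> i)) summable_on UNIV \<and>
     (\<Sum>\<^sub>\<infinity>\<alpha>. norm (c \<alpha>) * (\<Prod>i\<in>UNIV. (R/2) ^ \<alpha> i)) \<le> M * 2 ^ card A \<and>
     (\<forall>u. (\<forall>i. norm (u i) \<le> R/2) \<longrightarrow> (\<forall>i. i \<notin> A \<longrightarrow> u i = 0) \<longrightarrow> series_at c u = h u)"
  using A h M
proof (induction A arbitrary: h M rule: finite_induct)
  case empty
  define c where "c = (\<lambda>\<alpha> :: 'i \<Rightarrow> nat. if \<alpha> = (\<lambda>_. 0) then h (\<lambda>_. 0) else 0)"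
  have M: "norm (h (\<lambda>_. 0)) \<le> M" using empty R by auto
  have 1: "((\<lambda>\<alpha>. norm (c \<alpha>) * (\<Prod>i\<in>UNIV. (R/2) ^ \<alpha> i)) has_sum norm (h (\<lambda>_. 0))) UNIV"
    by (rule has_sum_finite_neutralI[of "{\<lambda>_. 0}"]) (auto simp: c_def)
  have 2: "((\<lambda>\<alpha>. c \<alpha> * monom_at u \<alpha>) has_sum h (\<lambda>_. 0)) UNIV" for u
    by (rule has_sum_finite_neutralI[of "{\<lambda>_. 0}"]) (auto simp: c_def monom_at_def)
  show ?case
  proof (intro exI[of _ c] conjI allI impI)
    fix \<alpha> :: "'i \<Rightarrow> nat" assume "\<exists>i. i \<notin> {} \<and> \<alpha> i \<noteq> 0"
    then show "c \<alpha> = 0" by (auto simp: c_def)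
  next
    show "(\<lambda>\<alpha>. norm (c \<alpha>) * (\<Prod>i\<in>UNIV. (R/2) ^ \<alpha> i)) summable_on UNIV"
      using 1 by (rule has_sum_imp_summable)
    show "(\<Sum>\<^sub>\<infinity>\<alpha>. norm (c \<alpha>) * (\<Prod>i\<in>UNIV. (R/2) ^ \<alpha> i)) \<le> M * 2 ^ card ({} :: 'i set)"
      using infsumI[OF 1] M by simp
  next
    fix u :: "'i \<Rightarrow> complex" assume "\<forall>i. i \<notin> {} \<longrightarrow> u i = 0"
    then have "u = (\<lambda>_. 0)" by auto
    then show "series_at c u = h u" using infsumI[OF 2[of u]] by (simp only: series_at_def)
  qed
next
  case (insert x A)
  define hk where "hk k u = (deriv ^^ k) (\<lambda>y. h (u(x := y))) 0 / fact k" for k u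
  have hs: "sep_holomorphic R (hk k)" for k
    unfolding hk_def by (rule sep_holomorphic_taylor_coeff[OF insert.prems R])
  have hb: "norm (hk k u) \<le> M / R ^ k" if "\<And>j. norm (u j) < R" for k u
    unfolding hk_def by (rule taylor_coeff_sep_bound[OF insert.prems R that])
  have "\<forall>k. \<exists>c. (\<forall>\<alpha>. (\<exists>i. i \<notin> A \<and> \<alpha> i \<noteq> 0) \<longrightarrow> c \<alpha> = 0) \<and>
     (\<lambda>\<alpha>. norm (c \<alpha>) * (\<Prod>i\<in>UNIV. (R/2) ^ \<alpha> i)) summable_on UNIV \<and>
     (\<Sum>\<^sub>\<infinity>\<alpha>. norm (c \<alpha>) * (\<Prod>i\<in>UNIV. (R/2) ^ \<alpha> i)) \<le> M / R ^ k * 2 ^ card A \<and>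
     (\<forall>u. (\<forall>i. norm (u i) \<le> R/2) \<longrightarrow> (\<forall>i. i \<notin> A \<longrightarrow> u i = 0) \<longrightarrow> series_at c u = hk k u)"
    by (intro allI insert.IH[OF hs hb])
  from choice[OF this] obtain c where c: "\<forall>k. (\<forall>\<alpha>. (\<exists>i. i \<notin> A \<and> \<alpha> i \<noteq> 0) \<longrightarrow> c k \<alpha> = 0) \<and>
     (\<lambda>\<alpha>. norm (c k \<alpha>) * (\<Prod>i\<in>UNIV. (R/2) ^ \<alpha> i)) summable_on UNIV \<and>
     (\<Sum>\<^sub>\<infinity>\<alpha>. norm (c k \<alpha>) * (\<Prod>i\<in>UNIV. (R/2) ^ \<alpha> i)) \<le> M / R ^ k * 2 ^ card A \<and>
     (\<forall>u. (\<forall>i. norm (u i) \<le> R/2) \<longrightarrow> (\<forall>i. i \<notin> A \<longrightarrow> u i = 0) \<longrightarrow> series_at (c k) u = hk k u)"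
    by (elim exE)
  define w where "w = (\<lambda>\<alpha> :: 'i \<Rightarrow> nat. \<Prod>i\<in>UNIV. (R/2) ^ \<alpha> i)"
  have w0: "0 < w \<alpha>" for \<alpha> using R by (auto simp: w_def intro!: prod_pos)
  have M0: "M \<ge> 0" using order_trans[OF norm_ge_zero insert.prems(2)[of "\<lambda>_. 0"]] R by simp
  have c4: "\<forall>u. (\<forall>i. norm (u i) \<le> R/2) \<longrightarrow> (\<forall>i. i \<notin> A \<longrightarrow> u i = 0) \<longrightarrow> series_at (c k) u = hk k u" for k
    using spec[OF c, of k] by (elim conjE)
  have c1: "\<forall>\<alpha>. (\<exists>i. i \<notin> A \<and> \<alpha> i \<noteq> 0) \<longrightarrow> c k \<alpha> = 0" for k
    using spec[OF c, of k] by (elim conjE)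
  have c2: "(\<lambda>\<alpha>. norm (c k \<alpha>) * w \<alpha>) summable_on UNIV" for k
    unfolding w_def using spec[OF c, of k] by (elim conjE)
  have c3: "(\<Sum>\<^sub>\<infinity>\<alpha>. norm (c k \<alpha>) * w \<alpha>) \<le> M / R ^ k * 2 ^ card A" for k
    unfolding w_def using spec[OF c, of k] by (elim conjE)
  have csupp: "c k \<alpha> = 0" if "i \<notin> A" "\<alpha> i \<noteq> 0" for k \<alpha> i
    using spec[OF c1[of k], of \<alpha>] that by blast
  define c' where "c' \<alpha> = c (\<alpha> x) (\<alpha>(x := 0))" for \<alpha>
  \<comment> \<open>both sums below are rearranged along the bijection that splits off the exponent of the new variable\<close>
  have split: "(\<Prod>i\<in>UNIV. g i ^ (\<beta>(x := k)) i) = g x ^ k * (\<Prod>i\<in>UNIV. g i ^ \<beta> i)"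
    if "\<beta> x = 0" for g :: "'i \<Rightarrow> 'b::comm_monoid_mult" and k and \<beta> :: "'i \<Rightarrow> nat"
  proof -
    have "(\<Prod>i\<in>UNIV - {x}. g i ^ (\<beta>(x := k)) i) = (\<Prod>i\<in>UNIV - {x}. g i ^ \<beta> i)" by (rule prod.cong) auto
    then show ?thesis using that by (simp add: prod.remove[of UNIV x])
  qed
  have bij: "bij_betw (\<lambda>(k, \<beta>). \<beta>(x := k)) (UNIV \<times> {\<beta>. \<beta> x = 0}) (UNIV :: ('i \<Rightarrow> nat) set)"
    by (rule bij_betw_byWitness[where f'="\<lambda>\<alpha>. (\<alpha> x, \<alpha>(x := 0))"]) auto
  have wupd: "w (\<beta>(x := k)) = (R/2)^k * w \<beta>" if "\<beta> x = 0" for \<beta> k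
    unfolding w_def by (rule split[of \<beta> "\<lambda>_. R/2" k, OF that])
  have mupd: "monom_at u (\<beta>(x := k)) = u x ^ k * monom_at u \<beta>" if "\<beta> x = 0" for u \<beta> k
    unfolding monom_at_def by (rule split[of \<beta> u k, OF that])
  have c'upd: "c' (\<beta>(x := k)) = c k \<beta>" if "\<beta> x = 0" for \<beta> k
  proof -
    have "\<beta>(x := 0) = \<beta>" using that by auto
    then show ?thesis by (simp add: c'_def)
  qed
  have geo: "(\<lambda>k. M * 2 ^ card A * (1/2) ^ k) sums (M * 2 ^ card A * 2)"
    using sums_mult[OF geometric_sums[of "1/2::real"], of "M * 2 ^ card A"] by simp
  have geo': "((\<lambda>k. M * 2 ^ card A * (1/2) ^ k) has_sum (M * 2 ^ card A * 2)) UNIV"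
    by (rule sums_nonneg_imp_has_sum[OF geo]) (use M0 in auto)
  have row: "(\<lambda>\<beta>. norm (c k \<beta>) * ((R/2)^k * w \<beta>)) summable_on UNIV \<and>
      (\<Sum>\<^sub>\<infinity>\<beta>. norm (c k \<beta>) * ((R/2)^k * w \<beta>)) \<le> M * 2 ^ card A * (1/2) ^ k" for k
  proof -
    have s: "(\<lambda>\<beta>. norm (c k \<beta>) * w \<beta>) summable_on UNIV" "(\<Sum>\<^sub>\<infinity>\<beta>. norm (c k \<beta>) * w \<beta>) \<le> M / R ^ k * 2 ^ card A"
      using c2 c3 by simp_all
    have e: "norm (c k \<beta>) * ((R/2)^k * w \<beta>) = (R/2)^k * (norm (c k \<beta>) * w \<beta>)" for \<beta> by simp
    have "(R/2)^k * (\<Sum>\<^sub>\<infinity>\<beta>. norm (c k \<beta>) * w \<beta>) \<le> (R/2)^k * (M / R ^ k * 2 ^ card A)"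
      using s(2) R by (intro mult_left_mono) auto
    also have "\<dots> = M * 2 ^ card A * (1/2) ^ k" using R by (simp add: power_divide)
    finally show ?thesis unfolding e infsum_cmult_right' using summable_on_cmult_right[OF s(1)] by blast
  qed
  define B where "B = {\<beta> :: 'i \<Rightarrow> nat. \<beta> x = 0}"
  define \<phi> where "\<phi> = (\<lambda>(k, \<beta>). norm (c k \<beta>) * ((R/2)^k * w \<beta>))"
  have \<phi>0: "0 \<le> \<phi> z" for z using R less_imp_le[OF w0] by (auto simp: \<phi>_def split: prod.split)
  have row2: "((\<lambda>\<beta>. \<phi> (k, \<beta>)) has_sum (\<Sum>\<^sub>\<infinity>\<beta>. norm (c k \<beta>) * ((R/2)^k * w \<beta>))) B" for k
  proof -
    have "((\<lambda>\<beta>. norm (c k \<beta>) * ((R/2)^k * w \<beta>)) has_sum (\<Sum>\<^sub>\<infinity>\<beta>. norm (c k \<beta>) * ((R/2)^k * w \<beta>))) UNIV"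
      using row by (intro has_sum_infsum) blast
    then show ?thesis
      by (rule has_sum_cong_neutral[THEN iffD1, rotated -1])
         (use csupp[of x] insert.hyps in \<open>auto simp: \<phi>_def B_def\<close>)
  qed
  have S: "\<phi> summable_on (UNIV \<times> B)"
  proof (rule summable_on_SigmaI[OF row2])
    show "(\<lambda>k. \<Sum>\<^sub>\<infinity>\<beta>. norm (c k \<beta>) * ((R/2)^k * w \<beta>)) summable_on UNIV"
      by (rule summable_on_comparison_test[OF has_sum_imp_summable[OF geo']])
         (use row R less_imp_le[OF w0] in \<open>auto intro!: infsum_nonneg\<close>)
  qed (use \<phi>0 in auto)
  have Sle: "infsum \<phi> (UNIV \<times> B) \<le> M * 2 ^ card A * 2"
  proof -
    have "infsum \<phi> (UNIV \<times> B) = (\<Sum>\<^sub>\<infinity>k. \<Sum>\<^sub>\<infinity>\<beta>\<in>B. \<phi> (k, \<beta>))"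
      by (rule infsum_Sigma_banach[symmetric, OF S])
    also have "\<dots> = (\<Sum>\<^sub>\<infinity>k. \<Sum>\<^sub>\<infinity>\<beta>. norm (c k \<beta>) * ((R/2)^k * w \<beta>))"
      by (intro infsum_cong infsumI row2)
    also have "\<dots> \<le> (\<Sum>\<^sub>\<infinity>k. M * 2 ^ card A * (1/2) ^ k)"
      by (rule infsum_mono[OF summable_on_comparison_test[OF has_sum_imp_summable[OF geo']] has_sum_imp_summable[OF geo']])
         (use row R less_imp_le[OF w0] in \<open>auto intro!: infsum_nonneg\<close>)
    also have "\<dots> = M * 2 ^ card A * 2" by (rule infsumI[OF geo'])
    finally show ?thesis .
  qed
  have bij': "bij_betw (\<lambda>z. (snd z)(x := fst z)) (UNIV \<times> B) (UNIV :: ('i \<Rightarrow> nat) set)"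
    using bij by (simp add: B_def case_prod_unfold)
  have reB: "norm (c' ((snd z)(x := fst z))) * w ((snd z)(x := fst z)) = \<phi> z" if "z \<in> UNIV \<times> B" for z
    using that by (auto simp: B_def \<phi>_def c'upd wupd)
  have C1: "(\<lambda>\<alpha>. norm (c' \<alpha>) * w \<alpha>) summable_on UNIV"
  proof -
    have "(\<lambda>z. norm (c' ((snd z)(x := fst z))) * w ((snd z)(x := fst z))) summable_on UNIV \<times> B \<longleftrightarrow> \<phi> summable_on UNIV \<times> B"
      by (rule summable_on_cong) (rule reB)
    then show ?thesis
      using summable_on_reindex_bij_betw[OF bij', of "\<lambda>\<alpha>. norm (c' \<alpha>) * w \<alpha>"] S by blast
  qed
  have C2: "(\<Sum>\<^sub>\<infinity>\<alpha>. norm (c' \<alpha>) * w \<alpha>) \<le> M * 2 ^ card (insert x A)"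
  proof -
    have "(\<Sum>\<^sub>\<infinity>z\<in>UNIV \<times> B. norm (c' ((snd z)(x := fst z))) * w ((snd z)(x := fst z))) = infsum \<phi> (UNIV \<times> B)"
      by (rule infsum_cong) (rule reB)
    then have "(\<Sum>\<^sub>\<infinity>\<alpha>. norm (c' \<alpha>) * w \<alpha>) = infsum \<phi> (UNIV \<times> B)"
      using infsum_reindex_bij_betw[OF bij', of "\<lambda>\<alpha>. norm (c' \<alpha>) * w \<alpha>"] by metis
    then show ?thesis using Sle insert.hyps by (simp add: mult.commute)
  qed
  have C3: "series_at c' u = h u" if u: "\<forall>i. norm (u i) \<le> R/2" and u0: "\<forall>i. i \<notin> insert x A \<longrightarrow> u i = 0" for u
  proof -
    define \<psi> where "\<psi> = (\<lambda>(k, \<beta>). c k \<beta> * (u x ^ k * monom_at u \<beta>))"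
    have mw: "norm (monom_at u \<beta>) \<le> w \<beta>" for \<beta>
      unfolding monom_at_def w_def prod_norm[symmetric] norm_power
      using u by (intro prod_mono conjI power_mono) auto
    have nle: "norm (\<psi> z) \<le> \<phi> z" for z
    proof (cases z)
      case (Pair k \<beta>)
      have "norm (u x ^ k) * norm (monom_at u \<beta>) \<le> (R/2) ^ k * w \<beta>"
        using u R mw by (intro mult_mono) (auto simp: norm_power intro!: power_mono)
      then show ?thesis
        unfolding Pair \<psi>_def \<phi>_def prod.case norm_mult by (rule mult_left_mono) simp
    qed
    have \<psi>s: "\<psi> summable_on (UNIV \<times> B)"
      by (rule abs_summable_summable, rule Infinite_Sum.abs_summable_on_comparison_test'[OF S]) (rule nle)
    have reM: "c' ((snd z)(x := fst z)) * monom_at u ((snd z)(x := fst z)) = \<psi> z" if "z \<in> UNIV \<times> B" for z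
      using that by (auto simp: B_def \<psi>_def c'upd mupd)
    have u': "norm (u i) < R" for i using R by (intro le_less_trans[OF spec[OF u, of i]]) simp
    have inner: "(\<Sum>\<^sub>\<infinity>\<beta>\<in>B. \<psi> (k, \<beta>)) = (deriv ^^ k) (\<lambda>y. h (u(x := y))) 0 / fact k * u x ^ k" for k
    proof -
      have m0: "monom_at (u(x := 0)) \<beta> = monom_at u \<beta>" if "\<beta> x = 0" for \<beta>
      proof -
        have "(u(x := 0)) i ^ \<beta> i = u i ^ \<beta> i" for i using that by (cases "i = x") simp_all
        then show ?thesis by (simp add: monom_at_def)
      qed
      have "(\<Sum>\<^sub>\<infinity>\<beta>\<in>B. \<psi> (k, \<beta>)) = (\<Sum>\<^sub>\<infinity>\<beta>. u x ^ k * (c k \<beta> * monom_at (u(x := 0)) \<beta>))"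
      proof (rule infsum_cong_neutral)
        fix \<beta> assume "\<beta> \<in> B \<inter> UNIV"
        then show "\<psi> (k, \<beta>) = u x ^ k * (c k \<beta> * monom_at (u(x := 0)) \<beta>)"
          by (simp add: B_def m0 \<psi>_def mult_ac)
      next
        fix \<beta> assume "\<beta> \<in> UNIV - B"
        then have "\<beta> x \<noteq> 0" by (simp add: B_def)
        then show "u x ^ k * (c k \<beta> * monom_at (u(x := 0)) \<beta>) = 0"
          using csupp[of x \<beta> k] insert.hyps by simp
      qed simp
      also have "\<dots> = u x ^ k * series_at (c k) (u(x := 0))" unfolding series_at_def by (rule infsum_cmult_right')
      finally have e: "(\<Sum>\<^sub>\<infinity>\<beta>\<in>B. \<psi> (k, \<beta>)) = u x ^ k * series_at (c k) (u(x := 0))" .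
      have "\<forall>i. norm ((u(x := 0)) i) \<le> R/2" "\<forall>i. i \<notin> A \<longrightarrow> (u(x := 0)) i = 0"
        using u u0 R by auto
      then have "series_at (c k) (u(x := 0)) = hk k (u(x := 0))" using spec[OF c4[of k], of "u(x := 0)"] by simp
      then show ?thesis using e by (simp add: hk_def)
    qed
    have "series_at c' u = infsum \<psi> (UNIV \<times> B)"
    proof -
      have "(\<Sum>\<^sub>\<infinity>z\<in>UNIV \<times> B. c' ((snd z)(x := fst z)) * monom_at u ((snd z)(x := fst z))) = infsum \<psi> (UNIV \<times> B)"
        by (rule infsum_cong) (rule reM)
      then show ?thesis unfolding series_at_def
        using infsum_reindex_bij_betw[OF bij', of "\<lambda>\<alpha>. c' \<alpha> * monom_at u \<alpha>"] by metis
    qed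
    also have "\<dots> = (\<Sum>\<^sub>\<infinity>k. \<Sum>\<^sub>\<infinity>\<beta>\<in>B. \<psi> (k, \<beta>))"
      by (rule infsum_Sigma_banach[symmetric, OF \<psi>s])
    also have "\<dots> = h u"
    proof -
      have "(\<lambda>k. \<Sum>\<^sub>\<infinity>\<beta>\<in>B. \<psi> (k, \<beta>)) summable_on UNIV"
        by (rule summable_on_Sigma_banach) (use \<psi>s in simp)
      then have "(\<lambda>k. \<Sum>\<^sub>\<infinity>\<beta>\<in>B. \<psi> (k, \<beta>)) sums (\<Sum>\<^sub>\<infinity>k. \<Sum>\<^sub>\<infinity>\<beta>\<in>B. \<psi> (k, \<beta>))"
        by (intro has_sum_imp_sums has_sum_infsum)
      moreover have "(\<lambda>y. h (u(x := y))) holomorphic_on ball 0 R"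
        using insert.prems(1) u' by (simp add: sep_holomorphic_def)
      then have "(\<lambda>k. \<Sum>\<^sub>\<infinity>\<beta>\<in>B. \<psi> (k, \<beta>)) sums h (u(x := u x))"
        unfolding inner using holomorphic_power_series[of "\<lambda>y. h (u(x := y))" 0 R "u x"] u' by simp
      ultimately show ?thesis using sums_unique2 by fastforce
    qed
    finally show ?thesis .
  qed
  have C0: "c' \<alpha> = 0" if "i \<notin> insert x A" "\<alpha> i \<noteq> 0" for \<alpha> i
    using csupp[of i "\<alpha>(x := 0)"] that by (auto simp: c'_def)
  show ?case
    using C0 C1 C2 C3 by (intro exI[of _ c']) (auto simp: w_def)
qed

section \<open>Zeros of a holomorphic function on complex lines\<close>

lemma factor_out_zeros:
  assumes "finite Z" "open S" "Z \<subseteq> S" "\<phi> holomorphic_on S" "\<And>z. z \<in> Z \<Longrightarrow> \<phi> z = (0::complex)"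
  shows "\<exists>\<psi>. \<psi> holomorphic_on S \<and> (\<forall>x\<in>S. \<phi> x = (\<Prod>z\<in>Z. x - z) * \<psi> x)"
  using assms
proof (induction Z rule: finite_induct)
  case empty
  then show ?case by auto
next
  case (insert a Z)
  then obtain \<psi> where \<psi>: "\<psi> holomorphic_on S" "\<And>x. x \<in> S \<Longrightarrow> \<phi> x = (\<Prod>z\<in>Z. x - z) * \<psi> x"
    by auto
  have "(\<Prod>z\<in>Z. a - z) \<noteq> 0" using insert.hyps by auto
  then have a0: "\<psi> a = 0" using \<psi>(2)[of a] insert.prems by auto
  define \<psi>' where "\<psi>' x = (if x = a then deriv \<psi> a else \<psi> x / (x - a))" for x
  have "\<psi>' holomorphic_on S"
    by (rule pole_theorem_open_0[OF \<psi>(1) \<open>open S\<close>, of a]) (use a0 in \<open>auto simp: \<psi>'_def\<close>)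
  moreover have "\<phi> x = (\<Prod>z\<in>insert a Z. x - z) * \<psi>' x" if "x \<in> S" for x
    using \<psi>(2)[OF that] insert.hyps a0 by (auto simp: \<psi>'_def)
  ultimately show ?case by blast
qed

text \<open>If the coefficients of degree at most \<open>K\<close> dominate all coefficients, then there are at most \<open>K\<close>
  zeros near the origin, unless the function is zero. With \<open>K + 1\<close> zeros in the disc of radius \<open>\<delta>\<close>,
  dividing by the corresponding linear factors and using the maximum principle shows that the function is
  of order \<open>\<delta> ^ (K + 1)\<close> on the circle of radius \<open>2 * \<delta>\<close>. By Cauchy's inequality the coefficients of
  degree at most \<open>K\<close> are then of order \<open>\<delta>\<close> relative to their own sum, which is absurd for small \<open>\<delta>\<close>.\<close>
lemma zero_count_by_coefficients:
  fixes K :: nat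
  assumes "C \<ge> 0"
  obtains \<delta> :: real where "\<delta> > 0" "\<And>\<phi>. \<phi> holomorphic_on ball 0 2 \<Longrightarrow>
     (\<And>j. norm ((deriv ^^ j) \<phi> 0 / fact j) * 2 ^ j \<le> C * (\<Sum>k\<le>K. norm ((deriv ^^ k) \<phi> 0 / fact k) * 2 ^ k)) \<Longrightarrow>
     (\<forall>x\<in>ball 0 2. \<phi> x = 0) \<or> (finite {x \<in> ball 0 \<delta>. \<phi> x = 0} \<and> card {x \<in> ball 0 \<delta>. \<phi> x = 0} \<le> K)"
proof -
  define B where "B = real (Suc K) * 6 ^ Suc K * 2 * C"
  have B0: "B \<ge> 0" using assms by (simp add: B_def)
  define \<delta> where "\<delta> = min (1/2) (1 / (2 * (B + 1)))"
  have d: "0 < \<delta>" "\<delta> \<le> 1/2" "B * \<delta> < 1"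
  proof -
    show "0 < \<delta>" "\<delta> \<le> 1/2" using B0 by (auto simp: \<delta>_def)
    have "B * \<delta> \<le> B * (1 / (2 * (B + 1)))" using B0 by (intro mult_left_mono) (auto simp: \<delta>_def)
    also have "\<dots> < 1" using B0 by (simp add: field_simps)
    finally show "B * \<delta> < 1" .
  qed
  show thesis
  proof (rule that[OF d(1)])
    fix \<phi> assume hol: "\<phi> holomorphic_on ball 0 2"
    define a where "a k = (deriv ^^ k) \<phi> 0 / fact k" for k
    define A where "A = (\<Sum>k\<le>K. norm (a k) * 2 ^ k)"
    assume "\<And>j. norm ((deriv ^^ j) \<phi> 0 / fact j) * 2 ^ j \<le> C * (\<Sum>k\<le>K. norm ((deriv ^^ k) \<phi> 0 / fact k) * 2 ^ k)"
    then have dom: "norm (a j) * 2 ^ j \<le> C * A" for j unfolding a_def A_def .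
    have A0: "A \<ge> 0" by (auto simp: A_def intro: sum_nonneg)
    have ser: "(\<lambda>j. a j * x ^ j) sums \<phi> x" if "x \<in> ball 0 2" for x
      using holomorphic_power_series[OF hol that] by (simp add: a_def)
    show "(\<forall>x\<in>ball 0 2. \<phi> x = 0) \<or> (finite {x \<in> ball 0 \<delta>. \<phi> x = 0} \<and> card {x \<in> ball 0 \<delta>. \<phi> x = 0} \<le> K)"
    proof (cases "A = 0")
      case True
      have "norm (a j) * 2 ^ j \<le> 0" for j using dom[of j] True by simp
      then have a0: "a j = 0" for j by (metis mult_le_0_iff norm_le_zero_iff not_less zero_less_numeral zero_less_power)
      have "\<phi> x = 0" if "x \<in> ball 0 2" for x
        using sums_unique2[OF ser[OF that], of 0] by (simp add: a0)
      then show ?thesis by blast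
    next
      case False
      then have Apos: "A > 0" using A0 by simp
      have bd: "norm (\<phi> x) \<le> 2 * C * A" if x: "norm x \<le> 1" for x
      proof -
        have le: "norm (a j * x ^ j) \<le> C * A * (1/2) ^ j" for j
        proof -
          have "norm (a j * x ^ j) \<le> norm (a j) * 1"
            unfolding norm_mult norm_power using x by (intro mult_left_mono power_le_one) auto
          also have "\<dots> \<le> C * A * (1/2) ^ j" using dom[of j] by (simp add: power_divide field_simps)
          finally show ?thesis .
        qed
        have g: "(\<lambda>j. C * A * (1/2::real) ^ j) sums (C * A * 2)"
          using sums_mult[OF geometric_sums[of "1/2::real"], of "C * A"] by simp
        have "x \<in> ball 0 2" using x by simp
        from norm_suminf_le[OF le sums_summable[OF g]] sums_unique[OF ser[OF this]] sums_unique[OF g]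
        show ?thesis by simp
      qed
      show ?thesis
      proof (rule ccontr)
        assume neg: "\<not> ?thesis"
        have "\<exists>Z. Z \<subseteq> {x \<in> ball 0 \<delta>. \<phi> x = 0} \<and> finite Z \<and> card Z = Suc K"
        proof (cases "finite {x \<in> ball 0 \<delta>. \<phi> x = 0}")
          case True
          then have "Suc K \<le> card {x \<in> ball 0 \<delta>. \<phi> x = 0}" using neg by auto
          then show ?thesis using True by (meson obtain_subset_with_card_n)
        next
          case False
          then show ?thesis using infinite_arbitrarily_large[OF False] by blast
        qed
        then obtain Z where Z: "Z \<subseteq> {x \<in> ball 0 \<delta>. \<phi> x = 0}" "finite Z" "card Z = Suc K" by blast
        have Zd: "norm z < \<delta>" "\<phi> z = 0" if "z \<in> Z" for z using Z(1) that by auto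
        have "Z \<subseteq> ball 0 2" using Zd(1) d(2) by fastforce
        then obtain \<psi> where \<psi>: "\<psi> holomorphic_on ball 0 2" "\<And>x. x \<in> ball 0 2 \<Longrightarrow> \<phi> x = (\<Prod>z\<in>Z. x - z) * \<psi> x"
          using factor_out_zeros[OF Z(2) open_ball _ hol Zd(2)] by blast
        have cont: "continuous_on (cball 0 1) \<psi>"
          by (rule continuous_on_subset[OF holomorphic_on_imp_continuous_on[OF \<psi>(1)]]) auto
        have bdry: "norm (\<psi> x) \<le> 2 ^ Suc K * (2 * C * A)" if x: "norm x = 1" for x
        proof -
          have "(1/2) ^ Suc K = (\<Prod>z\<in>Z. 1/2::real)" by (simp add: Z)
          also have "\<dots> \<le> (\<Prod>z\<in>Z. norm (x - z))"
          proof (rule prod_mono)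
            fix z assume "z \<in> Z"
            then show "0 \<le> (1/2::real) \<and> 1/2 \<le> norm (x - z)"
              using Zd(1)[of z] d(2) x norm_triangle_ineq2[of x z] by auto
          qed
          finally have p: "(1/2) ^ Suc K \<le> norm (\<Prod>z\<in>Z. x - z)" by (simp add: prod_norm)
          have "(1/2) ^ Suc K * norm (\<psi> x) \<le> norm (\<phi> x)"
          proof -
            have "norm (\<phi> x) = norm (\<Prod>z\<in>Z. x - z) * norm (\<psi> x)"
              using \<psi>(2)[of x] x by (simp add: norm_mult)
            then show ?thesis using mult_right_mono[OF p, of "norm (\<psi> x)"] by (simp del: power_Suc)
          qed
          also have "\<dots> \<le> 2 * C * A" using bd x by simp
          finally have "(1/2) ^ Suc K * norm (\<psi> x) \<le> 2 * C * A" .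
          then show ?thesis by (simp add: power_divide field_simps)
        qed
        have \<psi>b: "norm (\<psi> x) \<le> 2 ^ Suc K * (2 * C * A)" if "norm x \<le> 1" for x
        proof (rule maximum_modulus_frontier[of \<psi> "cball 0 1"])
          show "\<psi> holomorphic_on interior (cball 0 1)"
            by (rule holomorphic_on_subset[OF \<psi>(1)]) auto
        qed (use cont bdry that in auto)
        define r where "r = 2 * \<delta>"
        have r: "0 < r" "r \<le> 1" using d by (auto simp: r_def)
        have \<phi>b: "norm (\<phi> x) \<le> (3 * \<delta>) ^ Suc K * (2 ^ Suc K * (2 * C * A))" if x: "norm x = r" for x
        proof -
          have "(\<Prod>z\<in>Z. norm (x - z)) \<le> (\<Prod>z\<in>Z. 3 * \<delta>)"
          proof (rule prod_mono)
            fix z assume "z \<in> Z"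
            then show "0 \<le> norm (x - z) \<and> norm (x - z) \<le> 3 * \<delta>"
              using Zd(1)[of z] x norm_triangle_ineq4[of x z] by (auto simp: r_def)
          qed
          also have "\<dots> = (3 * \<delta>) ^ Suc K" using Z by simp
          finally have "norm (\<Prod>z\<in>Z. x - z) \<le> (3 * \<delta>) ^ Suc K" by (simp add: prod_norm)
          then have "norm (\<Prod>z\<in>Z. x - z) * norm (\<psi> x) \<le> (3 * \<delta>) ^ Suc K * (2 ^ Suc K * (2 * C * A))"
            by (rule mult_mono[OF _ \<psi>b]) (use x r d(1) in \<open>simp_all del: power_Suc\<close>)
          moreover have "\<phi> x = (\<Prod>z\<in>Z. x - z) * \<psi> x" using \<psi>(2)[of x] x r by simp
          ultimately show ?thesis by (simp only: norm_mult)
        qed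
        have ak: "norm (a k) * 2 ^ k \<le> \<delta> * (6 ^ Suc K * (2 * C * A))" if k: "k \<le> K" for k
        proof -
          have "norm ((deriv ^^ k) \<phi> 0) \<le> fact k * ((3 * \<delta>) ^ Suc K * (2 ^ Suc K * (2 * C * A))) / r ^ k"
          proof (rule Cauchy_inequality)
            show "\<phi> holomorphic_on ball 0 r" by (rule holomorphic_on_subset[OF hol]) (use r in auto)
            show "continuous_on (cball 0 r) \<phi>"
              by (rule continuous_on_subset[OF holomorphic_on_imp_continuous_on[OF hol]]) (use r in auto)
          qed (use r \<phi>b in auto)
          then have "norm (a k) \<le> ((3 * \<delta>) ^ Suc K * (2 ^ Suc K * (2 * C * A))) / r ^ k"
            using r by (simp add: a_def norm_divide field_simps)
          then have "norm (a k) * 2 ^ k \<le> ((3 * \<delta>) ^ Suc K * (2 ^ Suc K * (2 * C * A))) / r ^ k * 2 ^ k"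
            by (intro mult_right_mono) auto
          also have "\<dots> = (6 ^ Suc K * (2 * C * A)) * \<delta> ^ (Suc K - k)"
          proof -
            have 1: "(3 * \<delta>) ^ Suc K = 3 ^ Suc K * \<delta> ^ Suc K" by (rule power_mult_distrib)
            have 2: "(6::real) ^ Suc K = 3 ^ Suc K * 2 ^ Suc K"
              by (subst power_mult_distrib[symmetric]) simp
            have 3: "r ^ k = 2 ^ k * \<delta> ^ k" unfolding r_def by (rule power_mult_distrib)
            have 4: "\<delta> ^ Suc K = \<delta> ^ k * \<delta> ^ (Suc K - k)"
              using k by (simp add: power_add[symmetric] del: power_Suc)
            have "a * (\<delta> ^ k * b) * (c * x) / (d * \<delta> ^ k) * d = a * c * x * b" if "d \<noteq> 0" for a b c d x :: real
              using that d(1) by (simp add: field_simps)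
            then show ?thesis unfolding 1 2 3 4 by simp
          qed
          also have "\<dots> \<le> (6 ^ Suc K * (2 * C * A)) * \<delta>"
            using k d assms A0 power_decreasing[of 1 "Suc K - k" \<delta>] by (intro mult_left_mono) auto
          finally show ?thesis by (simp add: mult.commute)
        qed
        have "(\<Sum>k\<le>K. norm (a k) * 2 ^ k) \<le> (\<Sum>k\<le>K. \<delta> * (6 ^ Suc K * (2 * C * A)))"
          by (rule sum_mono) (use ak in \<open>simp del: power_Suc\<close>)
        then have "A \<le> (\<Sum>k\<le>K. \<delta> * (6 ^ Suc K * (2 * C * A)))" by (simp only: A_def[symmetric])
        also have "\<dots> = (B * \<delta>) * A" by (simp add: B_def del: power_Suc)
        also have "\<dots> < 1 * A" using d(3) Apos by (rule mult_strict_right_mono)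
        finally show False by simp
      qed
    qed
  qed
qed

lemma linear_scale_vec: "linear (\<lambda>t::complex. t *s (v :: complex^'n))"
  by (rule linearI) (auto simp: vec_eq_iff algebra_simps)

lemma holo_on_affine:
  assumes f: "holo_on f N" and U: "\<And>s. s \<in> U \<Longrightarrow> p + s *s v \<in> N"
  shows "(\<lambda>s. f (p + s *s v)) holomorphic_on U"
proof -
  have "(\<lambda>s. f (p + s *s v)) field_differentiable (at s)" if s: "s \<in> U" for s
  proof -
    obtain f' where f': "(f has_derivative f') (at (p + s *s v))" "\<And>c v. f' (c *s v) = c * f' v"
      using f U[OF s] unfolding holo_on_def by blast
    have "((\<lambda>s. p + s *s v) has_derivative (\<lambda>t. t *s v)) (at s)"
      using bounded_linear.has_derivative[OF linear_linear[THEN iffD2, OF linear_scale_vec[of v]] has_derivative_ident]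
      by (auto intro!: derivative_eq_intros)
    from has_derivative_compose[OF this f'(1)]
    have "((\<lambda>s. f (p + s *s v)) has_derivative (\<lambda>t. f' (t *s v))) (at s)" .
    then have "((\<lambda>s. f (p + s *s v)) has_field_derivative f' v) (at s)"
      by (simp add: has_field_derivative_def f'(2) mult.commute[of _ "f' v"])
    then show ?thesis by (auto simp: field_differentiable_def)
  qed
  then show ?thesis
    by (auto simp: holomorphic_on_def intro: field_differentiable_at_within)
qed

lemma holo_on_continuous_on: "holo_on f N \<Longrightarrow> continuous_on N f"
  unfolding holo_on_def
  by (auto intro!: continuous_at_imp_continuous_on dest!: has_derivative_continuous)

lemma norm_vec_le_sum:
  fixes x :: "complex^'n" shows "norm x \<le> (\<Sum>i\<in>UNIV. norm (x $ i))"
  unfolding norm_vec_def by (rule L2_set_le_sum) auto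

text \<open>Lines near \<open>z0\<close> are parametrised by \<open>u\<close>: the components \<open>Inl\<close> give the displacement of the base point
  and the components \<open>Inr\<close> the direction, taken short. The Taylor coefficients of the restriction of \<open>f\<close> to
  the line are holomorphic in \<open>u\<close>, and near \<open>u = 0\<close> finitely many dominate the others. Taking \<open>u\<close> near
  \<open>0\<close> is no restriction, since the direction may be rescaled.\<close>
lemma local_line_zero_bound:
  fixes f :: "complex^'n \<Rightarrow> complex"
  assumes N: "open N" "z0 \<in> N" and f: "holo_on f N"
  shows "\<exists>e>0. \<exists>r>0. \<exists>P. \<forall>z\<in>ball z0 e. \<forall>w. norm w = 1 \<longrightarrow>
     (\<forall>s. norm s < r \<longrightarrow> f (z + s *s w) = 0) \<or>
     (finite {s. norm s < r \<and> f (z + s *s w) = 0} \<and> card {s. norm s < r \<and> f (z + s *s w) = 0} \<le> P)"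
proof -
  obtain \<epsilon> where eps: "\<epsilon> > 0" "cball z0 \<epsilon> \<subseteq> N" using N open_contains_cball by blast
  have "compact (f ` cball z0 \<epsilon>)"
    by (intro compact_continuous_image continuous_on_subset[OF holo_on_continuous_on[OF f] eps(2)]) auto
  then have "bounded (f ` cball z0 \<epsilon>)" by (rule compact_imp_bounded)
  then obtain M where M: "M > 0" "\<And>z. z \<in> cball z0 \<epsilon> \<Longrightarrow> norm (f z) \<le> M"
    unfolding bounded_pos by blast
  define R where "R = \<epsilon> / (3 * real CARD('n))"
  have R: "R > 0" using eps by (simp add: R_def)
  define F where "F u \<sigma> = f (z0 + (\<chi> i. u (Inl i) + \<sigma> * u (Inr i)))" for u :: "'n + 'n \<Rightarrow> complex" and \<sigma>
  have inN: "z0 + (\<chi> i. u (Inl i) + \<sigma> * u (Inr i)) \<in> cball z0 \<epsilon>"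
    if u: "\<And>j. norm (u j) < R" and s: "norm \<sigma> < 2" for u :: "'n + 'n \<Rightarrow> complex" and \<sigma>
  proof -
    have "norm ((\<chi> i. u (Inl i) + \<sigma> * u (Inr i)) :: complex^'n) \<le> (\<Sum>i\<in>(UNIV::'n set). norm (u (Inl i) + \<sigma> * u (Inr i)))"
      using norm_vec_le_sum[of "\<chi> i. u (Inl i) + \<sigma> * u (Inr i)"] by simp
    also have "\<dots> \<le> (\<Sum>i\<in>(UNIV::'n set). 3 * R)"
    proof (rule sum_mono)
      fix i
      have "norm (\<sigma> * u (Inr i)) \<le> 2 * R"
        unfolding norm_mult using u[of "Inr i"] s by (intro mult_mono) auto
      then show "norm (u (Inl i) + \<sigma> * u (Inr i)) \<le> 3 * R"
        using norm_triangle_ineq[of "u (Inl i)" "\<sigma> * u (Inr i)"] u[of "Inl i"] by linarith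
    qed
    also have "\<dots> = \<epsilon>" by (simp add: R_def)
    finally show ?thesis by (simp add: dist_norm)
  qed
  have FM: "norm (F u \<sigma>) \<le> M" if "\<And>j. norm (u j) < R" "norm \<sigma> < 2" for u \<sigma>
    unfolding F_def by (rule M(2)[OF inN[OF that]])
  have Fsig: "F u holomorphic_on ball 0 2" if u: "\<And>j. norm (u j) < R" for u
  proof -
    have e: "(z0 + (\<chi> i. u (Inl i))) + \<sigma> *s (\<chi> i. u (Inr i)) = z0 + (\<chi> i. u (Inl i) + \<sigma> * u (Inr i))" for \<sigma>
      by (simp add: vec_eq_iff)
    have "(\<lambda>\<sigma>. f ((z0 + (\<chi> i. u (Inl i))) + \<sigma> *s (\<chi> i. u (Inr i)))) holomorphic_on ball 0 2"
    proof (rule holo_on_affine[OF f])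
      fix \<sigma> :: complex assume "\<sigma> \<in> ball 0 2"
      then have "norm \<sigma> < 2" by simp
      then show "(z0 + (\<chi> i. u (Inl i))) + \<sigma> *s (\<chi> i. u (Inr i)) \<in> N"
        unfolding e by (intro subsetD[OF eps(2)] inN u)
    qed
    then show ?thesis unfolding e F_def .
  qed
  have Fu: "(\<lambda>x. F (u(j := x)) \<sigma>) holomorphic_on ball 0 R" if u: "\<And>j. norm (u j) < R" and s: "norm \<sigma> < 2" for u j \<sigma>
  proof -
    define v :: "complex^'n" where "v = (\<chi> i. (if Inl i = j then 1 else 0) + \<sigma> * (if Inr i = j then 1 else 0))"
    define q :: "complex^'n" where "q = (\<chi> i. (u(j := 0)) (Inl i) + \<sigma> * (u(j := 0)) (Inr i))"
    have eq: "z0 + (\<chi> i. (u(j := x)) (Inl i) + \<sigma> * (u(j := x)) (Inr i)) = (z0 + q) + x *s v" for x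
      by (simp add: vec_eq_iff q_def v_def algebra_simps)
    have nu: "norm ((u(j := x)) k) < R" if "norm x < R" for x k using u that by simp
    have "(\<lambda>x. f ((z0 + q) + x *s v)) holomorphic_on ball 0 R"
    proof (rule holo_on_affine[OF f])
      fix x :: complex assume "x \<in> ball 0 R"
      then have "norm x < R" by simp
      then show "(z0 + q) + x *s v \<in> N"
        unfolding eq[symmetric] by (intro subsetD[OF eps(2)] inN nu s)
    qed
    then show ?thesis unfolding F_def eq .
  qed
  define a where "a k u = (deriv ^^ k) (F u) 0 / fact k" for k u
  have ahol: "sep_holomorphic R (a k)" for k
    unfolding sep_holomorphic_def a_def
  proof (intro allI impI)
    fix u :: "'n + 'n \<Rightarrow> complex" and i assume u: "\<forall>j. norm (u j) < R"
    then have u': "norm ((u(i := x)) j) < R" if "norm x < R" for x j using that by simp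
    show "(\<lambda>x. (deriv ^^ k) (F (u(i := x))) 0 / fact k) holomorphic_on ball 0 R"
      by (rule taylor_coeff_holomorphic[of 2 _ R M]) (use u u' in \<open>auto intro!: Fu Fsig FM\<close>)
  qed
  have abd: "norm (a k u) \<le> M / 2 ^ k" if "\<And>j. norm (u j) < R" for k u
    unfolding a_def by (rule taylor_coeff_bound) (use that in \<open>auto intro!: Fsig FM\<close>)
  define m where "m = CARD('n + 'n)"
  have "\<forall>k. \<exists>c. (\<lambda>\<alpha>. norm (c \<alpha>) * (\<Prod>i\<in>UNIV. (R/2) ^ \<alpha> i)) summable_on UNIV \<and>
     (\<Sum>\<^sub>\<infinity>\<alpha>. norm (c \<alpha>) * (\<Prod>i\<in>UNIV. (R/2) ^ \<alpha> i)) \<le> M / 2 ^ k * 2 ^ m \<and>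
     (\<forall>u. (\<forall>i. norm (u i) \<le> R/2) \<longrightarrow> series_at c u = a k u)"
  proof
    fix k
    show "\<exists>c. (\<lambda>\<alpha>. norm (c \<alpha>) * (\<Prod>i\<in>UNIV. (R/2) ^ \<alpha> i)) summable_on UNIV \<and>
     (\<Sum>\<^sub>\<infinity>\<alpha>. norm (c \<alpha>) * (\<Prod>i\<in>UNIV. (R/2) ^ \<alpha> i)) \<le> M / 2 ^ k * 2 ^ m \<and>
     (\<forall>u. (\<forall>i. norm (u i) \<le> R/2) \<longrightarrow> series_at c u = a k u)"
      using sep_holomorphic_power_series_on[OF finite[of UNIV] ahol abd R, of k] unfolding m_def by simp
  qed
  from choice[OF this] obtain c where c: "\<forall>k. (\<lambda>\<alpha>. norm (c k \<alpha>) * (\<Prod>i\<in>UNIV. (R/2) ^ \<alpha> i)) summable_on UNIV \<and>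
     (\<Sum>\<^sub>\<infinity>\<alpha>. norm (c k \<alpha>) * (\<Prod>i\<in>UNIV. (R/2) ^ \<alpha> i)) \<le> M / 2 ^ k * 2 ^ m \<and>
     (\<forall>u. (\<forall>i. norm (u i) \<le> R/2) \<longrightarrow> series_at (c k) u = a k u)"
    by (elim exE)
  have c1: "(\<lambda>\<alpha>. norm (c k \<alpha>) * (\<Prod>i\<in>UNIV. (R/2) ^ \<alpha> i)) summable_on UNIV" for k
    using spec[OF c, of k] by (elim conjE)
  have c2: "(\<Sum>\<^sub>\<infinity>\<alpha>. norm (c k \<alpha>) * (\<Prod>i\<in>UNIV. (R/2) ^ \<alpha> i)) \<le> M / 2 ^ k * 2 ^ m" for k
    using spec[OF c, of k] by (elim conjE)
  have c3: "\<forall>u. (\<forall>i. norm (u i) \<le> R/2) \<longrightarrow> series_at (c k) u = a k u" for k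
    using spec[OF c, of k] by (elim conjE)
  obtain p :: "'n + 'n \<Rightarrow> nat" where p: "inj p" "\<And>i. prime (p i)"
    by (rule obtain_distinct_primes) blast
  obtain s0 where s0: "(1/2) ^ s0 < R/2" using real_arch_pow_inv[of "R/2" "1/2"] R by auto
  have ps: "1 / real (p i) ^ s \<le> (1/2) ^ s" for i s
    using prime_ge_2_nat[OF p(2)[of i]] by (simp add: power_divide frac_le power_mono)
  have psR: "1 / real (p i) ^ s \<le> R / 2" if "s \<ge> s0" for i s
  proof -
    have "(1/2::real) ^ s \<le> (1/2) ^ s0" by (rule power_decreasing[OF that]) auto
    then show ?thesis using ps[of i s] s0 by linarith
  qed
  have wle: "1 / real (godel p \<alpha>) ^ s0 \<le> (\<Prod>i\<in>UNIV. (R/2) ^ \<alpha> i)" for \<alpha>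
  proof -
    have "1 / real (godel p \<alpha>) ^ s0 = (\<Prod>i\<in>UNIV. (1 / real (p i) ^ s0) ^ \<alpha> i)"
      by (simp add: godel_def prod_power_distrib prod_dividef power_divide flip: power_mult)
         (simp add: mult.commute)
    also have "\<dots> \<le> (\<Prod>i\<in>UNIV. (R/2) ^ \<alpha> i)"
      by (intro prod_mono conjI power_mono psR) auto
    finally show ?thesis .
  qed
  \<comment> \<open>The factor \<open>2 ^ k\<close> compensates Cauchy's inequality on discs of radius \<open>2\<close>, so that all rescaled
      coefficient series have norm at most \<open>1\<close>.\<close>
  define \<mu> where "\<mu> k = 2 ^ k / (M * 2 ^ m)" for k :: nat
  have \<mu>0: "\<mu> k > 0" for k using M by (simp add: \<mu>_def)
  define c' where "c' k \<alpha> = of_real (\<mu> k) * c k \<alpha>" for k \<alpha>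
  have c'n: "norm (c' k \<alpha>) = \<mu> k * norm (c k \<alpha>)" for k \<alpha>
    using \<mu>0[of k] by (simp add: c'_def norm_mult)
  have c's: "(\<lambda>\<alpha>. norm (c' k \<alpha>) * (1 / real (godel p \<alpha>) ^ s0)) summable_on UNIV" (is "?s")
    and c'1: "(\<Sum>\<^sub>\<infinity>\<alpha>. norm (c' k \<alpha>) * (1 / real (godel p \<alpha>) ^ s0)) \<le> 1" for k
  proof -
    have s: "(\<lambda>\<alpha>. \<mu> k * (norm (c k \<alpha>) * (\<Prod>i\<in>UNIV. (R/2) ^ \<alpha> i))) summable_on UNIV"
      by (rule summable_on_cmult_right[OF c1])
    have le: "norm (c' k \<alpha>) * (1 / real (godel p \<alpha>) ^ s0) \<le> \<mu> k * (norm (c k \<alpha>) * (\<Prod>i\<in>UNIV. (R/2) ^ \<alpha> i))" for \<alpha>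
      unfolding c'n mult.assoc using \<mu>0[of k] wle by (intro mult_left_mono) auto
    show s1: "(\<lambda>\<alpha>. norm (c' k \<alpha>) * (1 / real (godel p \<alpha>) ^ s0)) summable_on UNIV"
      by (rule summable_on_comparison_test[OF s le]) auto
    have "(\<Sum>\<^sub>\<infinity>\<alpha>. norm (c' k \<alpha>) * (1 / real (godel p \<alpha>) ^ s0)) \<le> \<mu> k * (\<Sum>\<^sub>\<infinity>\<alpha>. norm (c k \<alpha>) * (\<Prod>i\<in>UNIV. (R/2) ^ \<alpha> i))"
      using infsum_mono[OF s1 s le] by (simp add: infsum_cmult_right')
    also have "\<dots> \<le> \<mu> k * (M / 2 ^ k * 2 ^ m)" by (rule mult_left_mono[OF c2]) (use \<mu>0[of k] in simp)
    also have "\<dots> = 1" using M by (simp add: \<mu>_def)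
    finally show "(\<Sum>\<^sub>\<infinity>\<alpha>. norm (c' k \<alpha>) * (1 / real (godel p \<alpha>) ^ s0)) \<le> 1" .
  qed
  have evc': "series_at (c' k) u = of_real (\<mu> k) * series_at (c k) u" for k u
    unfolding series_at_def c'_def mult.assoc by (rule infsum_cmult_right')
  obtain K s C where dom: "s \<ge> s0" "\<And>u j. (\<And>i. norm (u i) \<le> 1 / real (p i) ^ s) \<Longrightarrow>
    norm (series_at (c' j) u) \<le> C * (\<Sum>k\<le>K. norm (series_at (c' k) u))"
    by (rule coefficient_domination[of p c' s0, OF p c's c'1]) (rule that, assumption, blast)
  obtain \<delta> where \<delta>: "\<delta> > 0" "\<And>\<phi>. \<phi> holomorphic_on ball 0 2 \<Longrightarrow>
     (\<And>j. norm ((deriv ^^ j) \<phi> 0 / fact j) * 2 ^ j \<le> \<bar>C\<bar> * (\<Sum>k\<le>K. norm ((deriv ^^ k) \<phi> 0 / fact k) * 2 ^ k)) \<Longrightarrow>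
     (\<forall>x\<in>ball 0 2. \<phi> x = 0) \<or> (finite {x \<in> ball 0 \<delta>. \<phi> x = 0} \<and> card {x \<in> ball 0 \<delta>. \<phi> x = 0} \<le> K)"
    by (rule zero_count_by_coefficients[of "\<bar>C\<bar>" K]) (simp, blast)
  define e where "e = Min (range (\<lambda>i. 1 / real (p i) ^ s))"
  have e: "e > 0" "\<And>i. e \<le> 1 / real (p i) ^ s"
    unfolding e_def using p(2) by (auto simp: prime_gt_0_nat)
  define r where "r = e * min \<delta> 2"
  have rpos: "r > 0" using e(1) \<delta>(1) by (simp add: r_def)
  show ?thesis
  proof (rule exI[of _ e], rule conjI[OF e(1)], rule exI[of _ r], rule conjI[OF rpos], rule exI[of _ K], intro ballI allI impI)
    fix z w :: "complex^'n" assume z: "z \<in> ball z0 e" and w: "norm w = 1"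
    define u where "u = case_sum (\<lambda>i. (z - z0) $ i) (\<lambda>i. of_real e * w $ i)"
    have u: "norm (u i) \<le> 1 / real (p i) ^ s" for i
    proof -
      have "norm (u i) \<le> e"
      proof (cases i)
        case (Inl j)
        then show ?thesis using z Finite_Cartesian_Product.norm_nth_le[of "z - z0" j]
          by (simp add: u_def dist_norm norm_minus_commute)
      next
        case (Inr j)
        then show ?thesis using w e(1) Finite_Cartesian_Product.norm_nth_le[of w j]
          by (simp add: u_def norm_mult)
      qed
      then show ?thesis using e(2)[of i] by linarith
    qed
    have u2: "norm (u i) \<le> R/2" for i using u[of i] psR[OF dom(1), of i] by linarith
    then have u3: "norm (u i) < R" for i using R by (intro le_less_trans[OF u2[of i]]) simp
    have Fz: "F u \<sigma> = f (z + (of_real e * \<sigma>) *s w)" for \<sigma>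
      unfolding F_def by (rule arg_cong[where f=f]) (simp add: vec_eq_iff u_def algebra_simps)
    have dm: "norm (a j u) * 2 ^ j \<le> \<bar>C\<bar> * (\<Sum>k\<le>K. norm (a k u) * 2 ^ k)" for j
    proof -
      have eva: "series_at (c' k) u = of_real (\<mu> k) * a k u" for k
        using spec[OF c3[of k], of u] u2 by (simp add: evc')
      have nn: "norm (series_at (c' k) u) = (norm (a k u) * 2 ^ k) / (M * 2 ^ m)" for k
      proof -
        have "norm (series_at (c' k) u) = \<mu> k * norm (a k u)" using \<mu>0[of k] by (simp add: eva norm_mult)
        then show ?thesis by (simp add: \<mu>_def)
      qed
      have "norm (series_at (c' j) u) \<le> C * (\<Sum>k\<le>K. norm (series_at (c' k) u))" by (rule dom(2)[OF u])
      then have "(norm (a j u) * 2 ^ j) / (M * 2 ^ m) \<le> (C * (\<Sum>k\<le>K. norm (a k u) * 2 ^ k)) / (M * 2 ^ m)"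
        unfolding nn by (simp only: sum_divide_distrib[symmetric] times_divide_eq_right)
      then have "norm (a j u) * 2 ^ j \<le> C * (\<Sum>k\<le>K. norm (a k u) * 2 ^ k)"
        using M by (simp add: divide_le_cancel)
      also have "\<dots> \<le> \<bar>C\<bar> * (\<Sum>k\<le>K. norm (a k u) * 2 ^ k)" by (intro mult_right_mono sum_nonneg) auto
      finally show ?thesis .
    qed
    have "(\<forall>x\<in>ball 0 2. F u x = 0) \<or> (finite {x \<in> ball 0 \<delta>. F u x = 0} \<and> card {x \<in> ball 0 \<delta>. F u x = 0} \<le> K)"
      by (rule \<delta>(2)[OF Fsig[OF u3]]) (rule dm[unfolded a_def])
    then show "(\<forall>s. norm s < r \<longrightarrow> f (z + s *s w) = 0) \<or>
     (finite {s. norm s < r \<and> f (z + s *s w) = 0} \<and> card {s. norm s < r \<and> f (z + s *s w) = 0} \<le> K)"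
    proof
      assume 0: "\<forall>x\<in>ball 0 2. F u x = 0"
      have "f (z + s *s w) = 0" if "norm s < r" for s
      proof -
        have "e * min \<delta> 2 \<le> e * 2" using e(1) by (intro mult_left_mono) auto
        then have "norm s < e * 2" using that by (simp add: r_def)
        then have "norm (s / of_real e) < 2" using e(1) by (simp add: norm_divide field_simps)
        then have "F u (s / of_real e) = 0" using 0 by simp
        then show ?thesis using e(1) by (simp add: Fz)
      qed
      then show ?thesis by blast
    next
      assume fin: "finite {x \<in> ball 0 \<delta>. F u x = 0} \<and> card {x \<in> ball 0 \<delta>. F u x = 0} \<le> K"
      have sub: "{s. norm s < r \<and> f (z + s *s w) = 0} \<subseteq> (\<lambda>x. of_real e * x) ` {x \<in> ball 0 \<delta>. F u x = 0}"
      proof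
        fix s assume s: "s \<in> {s. norm s < r \<and> f (z + s *s w) = 0}"
        have "e * min \<delta> 2 \<le> e * \<delta>" using e(1) by (intro mult_left_mono) auto
        then have "norm s < e * \<delta>" using s by (simp add: r_def)
        then have "norm (s / of_real e) < \<delta>" using e(1) by (simp add: norm_divide field_simps)
        moreover have "F u (s / of_real e) = 0" using s e(1) by (simp add: Fz)
        ultimately show "s \<in> (\<lambda>x. of_real e * x) ` {x \<in> ball 0 \<delta>. F u x = 0}"
          using e(1) by (intro image_eqI[of _ _ "s / of_real e"]) auto
      qed
      have "finite {s. norm s < r \<and> f (z + s *s w) = 0}"
        using finite_subset[OF sub] fin by blast
      moreover have "card {s. norm s < r \<and> f (z + s *s w) = 0} \<le> K"
        using card_mono[OF _ sub] card_image_le[of "{x \<in> ball 0 \<delta>. F u x = 0}" "\<lambda>x. of_real e * x"] fin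
        by (meson finite_imageI order_trans)
      ultimately show ?thesis by blast
    qed
  qed
qed

lemma uniform_line_zero_bound:
  fixes f :: "complex^'n \<Rightarrow> complex"
  assumes N: "open N" "compact S" "S \<subseteq> N" and f: "holo_on f N"
  obtains r :: real and P :: nat where "r > 0"
    "\<And>z w. z \<in> S \<Longrightarrow> norm w = 1 \<Longrightarrow>
     (\<forall>s. norm s < r \<longrightarrow> f (z + s *s w) = 0) \<or>
     (finite {s. norm s < r \<and> f (z + s *s w) = 0} \<and> card {s. norm s < r \<and> f (z + s *s w) = 0} \<le> P)"
proof -
  define good where "good z r P \<longleftrightarrow> (\<forall>w. norm w = 1 \<longrightarrow>
     (\<forall>s. norm s < r \<longrightarrow> f (z + s *s w) = 0) \<or>
     (finite {s. norm s < r \<and> f (z + s *s w) = 0} \<and> card {s. norm s < r \<and> f (z + s *s w) = 0} \<le> P))"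
     for z and r :: real and P :: nat
  have mono: "good z r' P'" if g: "good z r P" and r: "r' \<le> r" and P: "P \<le> P'" for z r r' P P'
    unfolding good_def
  proof (intro allI impI)
    fix w :: "complex^'n" assume w: "norm w = 1"
    have sub: "{s. norm s < r' \<and> f (z + s *s w) = 0} \<subseteq> {s. norm s < r \<and> f (z + s *s w) = 0}" using r by auto
    have "(\<forall>s. norm s < r \<longrightarrow> f (z + s *s w) = 0) \<or>
     (finite {s. norm s < r \<and> f (z + s *s w) = 0} \<and> card {s. norm s < r \<and> f (z + s *s w) = 0} \<le> P)"
      using g w unfolding good_def by simp
    then show "(\<forall>s. norm s < r' \<longrightarrow> f (z + s *s w) = 0) \<or>
     (finite {s. norm s < r' \<and> f (z + s *s w) = 0} \<and> card {s. norm s < r' \<and> f (z + s *s w) = 0} \<le> P')"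
    proof
      assume fin: "finite {s. norm s < r \<and> f (z + s *s w) = 0} \<and> card {s. norm s < r \<and> f (z + s *s w) = 0} \<le> P"
      then have "card {s. norm s < r' \<and> f (z + s *s w) = 0} \<le> P'" using card_mono[OF _ sub] P by (meson order_trans)
      then show ?thesis using finite_subset[OF sub] fin by blast
    qed (use r in auto)
  qed
  have "\<forall>z0\<in>S. \<exists>e. \<exists>r. \<exists>P. e > 0 \<and> r > 0 \<and> (\<forall>z\<in>ball z0 e. good z r P)"
  proof
    fix z0 assume "z0 \<in> S"
    then have "z0 \<in> N" using N(3) by blast
    have "\<exists>e>0. \<exists>r>0. \<exists>P. \<forall>z\<in>ball z0 e. good z r P"
      unfolding good_def by (rule local_line_zero_bound[OF N(1) \<open>z0 \<in> N\<close> f])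
    then show "\<exists>e. \<exists>r. \<exists>P. e > 0 \<and> r > 0 \<and> (\<forall>z\<in>ball z0 e. good z r P)" by blast
  qed
  from this[unfolded bchoice_iff] obtain e r P where
    g: "\<forall>z0\<in>S. e z0 > 0 \<and> r z0 > 0 \<and> (\<forall>z\<in>ball z0 (e z0). good z (r z0) (P z0))"
    by (elim exE)
  have ge: "e z0 > 0" "r z0 > 0" "\<forall>z\<in>ball z0 (e z0). good z (r z0) (P z0)" if "z0 \<in> S" for z0
    using bspec[OF g that] by simp_all
  have cov: "S \<subseteq> (\<Union>z0\<in>S. ball z0 (e z0))"
    using ge(1) by (intro subsetI UN_I) auto
  obtain T where T: "T \<subseteq> S" "finite T" "S \<subseteq> (\<Union>z0\<in>T. ball z0 (e z0))"
    by (rule compactE_image[OF N(2) open_ball cov]) (rule that)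
  define r0 where "r0 = Min (insert 1 (r ` T))"
  define P0 where "P0 = Max (insert 0 (P ` T))"
  show thesis
  proof (rule that[of r0 P0])
    show "r0 > 0" unfolding r0_def using T(1,2) ge(2) by (subst Min_gr_iff) auto
    fix z w :: "complex^'n" assume z: "z \<in> S" and w: "norm w = 1"
    then obtain z0 where z0: "z0 \<in> T" "z \<in> ball z0 (e z0)" using T by blast
    have "good z (r z0) (P z0)" by (rule bspec[OF ge(3)[OF subsetD[OF T(1) z0(1)]] z0(2)])
    then have "good z r0 P0" by (rule mono) (use z0(1) T(2) in \<open>auto simp: r0_def P0_def\<close>)
    then show "(\<forall>s. norm s < r0 \<longrightarrow> f (z + s *s w) = 0) \<or>
     (finite {s. norm s < r0 \<and> f (z + s *s w) = 0} \<and> card {s. norm s < r0 \<and> f (z + s *s w) = 0} \<le> P0)"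
      using w unfolding good_def by simp
  qed
qed

section \<open>Divided differences and mean value inequalities\<close>

lemma divdiff_cong: "(\<And>x. x \<in> set ls \<Longrightarrow> h x = h' x) \<Longrightarrow> divdiff h ls = divdiff h' ls"
proof (induction h ls rule: divdiff.induct)
  case (3 h x y xs)
  have "divdiff h (butlast (x # y # xs)) = divdiff h' (butlast (x # y # xs))"
    by (rule "3.IH"(1)) (use "3.prems" in \<open>auto dest: in_set_butlastD split: if_splits\<close>)
  moreover have "divdiff h (y # xs) = divdiff h' (y # xs)"
    by (rule "3.IH"(2)) (use "3.prems" in auto)
  ultimately show ?case by simp
qed auto

text \<open>Induction on the recursion of divided differences, by the partial fraction identity
  \<open>(1 / (\<zeta> - x) - 1 / (\<zeta> - l)) / (x - l) = 1 / ((\<zeta> - x) * (\<zeta> - l))\<close> under the integral.\<close>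
lemma divdiff_contour_integral:
  assumes h: "h holomorphic_on cball 0 r"
  shows "ls \<noteq> [] \<Longrightarrow> distinct ls \<Longrightarrow> set ls \<subseteq> ball 0 r \<Longrightarrow>
    ((\<lambda>\<zeta>. h \<zeta> / (\<Prod>x\<leftarrow>ls. \<zeta> - x)) has_contour_integral (2 * of_real pi * \<i> * divdiff h ls)) (circlepath 0 r)"
proof (induction ls rule: length_induct)
  case (1 ls)
  consider x where "ls = [x]" | x m l where "ls = x # m @ [l]"
    using 1(2) by (metis append_butlast_last_id list.exhaust)
  then show ?case
  proof cases
    case (1 x)
    have "((\<lambda>u. h u / (u - x)) has_contour_integral (2 * of_real pi * \<i> * h x)) (circlepath 0 r)"
      by (rule Cauchy_integral_circlepath_simple[OF h]) (use "1.prems" 1 in auto)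
    then show ?thesis by (simp add: 1)
  next
    case (2 x m l)
    have r: "0 < r" using "1.prems" 2 by (auto intro: le_less_trans[OF norm_ge_zero])
    have xl: "x \<noteq> l" using "1.prems" 2 by auto
    have dd: "divdiff h ls = (divdiff h (x # m) - divdiff h (m @ [l])) / (x - l)"
      by (cases m) (simp_all add: 2 butlast_append)
    have IH: "((\<lambda>\<zeta>. h \<zeta> / (\<Prod>x\<leftarrow>ys. \<zeta> - x)) has_contour_integral (2 * of_real pi * \<i> * divdiff h ys)) (circlepath 0 r)"
      if "length ys < length ls" "ys \<noteq> []" "distinct ys" "set ys \<subseteq> ball 0 r" for ys
      using "1.IH" that by blast
    have i1: "((\<lambda>\<zeta>. h \<zeta> / (\<Prod>x\<leftarrow>x # m. \<zeta> - x)) has_contour_integral (2 * of_real pi * \<i> * divdiff h (x # m))) (circlepath 0 r)"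
      by (rule IH) (use "1.prems" in \<open>auto simp: 2\<close>)
    have i2: "((\<lambda>\<zeta>. h \<zeta> / (\<Prod>x\<leftarrow>m @ [l]. \<zeta> - x)) has_contour_integral (2 * of_real pi * \<i> * divdiff h (m @ [l]))) (circlepath 0 r)"
      by (rule IH) (use "1.prems" in \<open>auto simp: 2\<close>)
    have "((\<lambda>\<zeta>. (h \<zeta> / (\<Prod>x\<leftarrow>x # m. \<zeta> - x) - h \<zeta> / (\<Prod>x\<leftarrow>m @ [l]. \<zeta> - x)) / (x - l)) has_contour_integral
       (2 * of_real pi * \<i> * divdiff h (x # m) - 2 * of_real pi * \<i> * divdiff h (m @ [l])) / (x - l)) (circlepath 0 r)"
      by (intro has_contour_integral_div has_contour_integral_diff i1 i2)
    then have "((\<lambda>\<zeta>. (h \<zeta> / (\<Prod>x\<leftarrow>x # m. \<zeta> - x) - h \<zeta> / (\<Prod>x\<leftarrow>m @ [l]. \<zeta> - x)) / (x - l)) has_contour_integral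
       (2 * of_real pi * \<i> * divdiff h ls)) (circlepath 0 r)"
      by (simp add: dd right_diff_distrib diff_divide_distrib)
    then show ?thesis
    proof (rule has_contour_integral_eq)
      fix \<zeta> assume "\<zeta> \<in> path_image (circlepath 0 r)"
      then have nz: "norm \<zeta> = r" using r by simp
      have n: "\<zeta> - y \<noteq> 0" if "y \<in> set ls" for y
        using "1.prems"(3) that nz by (auto simp: subset_iff)
      have P: "(\<Prod>x\<leftarrow>m. \<zeta> - x) \<noteq> 0" using n by (auto simp: prod_list_zero_iff 2)
      have e: "(H / (a * P) - H / (P * b)) / (x - l) = H / (a * (P * b))"
        if "P \<noteq> 0" "a \<noteq> 0" "b \<noteq> 0" "b - a = x - l" for H a b P :: complex
      proof -
        have "H / (a * P) - H / (P * b) = (x - l) * (H / (a * (P * b)))"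
          unfolding that(4)[symmetric] using that by (simp add: field_simps)
        then show ?thesis using xl by simp
      qed
      show "(h \<zeta> / (\<Prod>x\<leftarrow>x # m. \<zeta> - x) - h \<zeta> / (\<Prod>x\<leftarrow>m @ [l]. \<zeta> - x)) / (x - l) = h \<zeta> / (\<Prod>x\<leftarrow>ls. \<zeta> - x)"
        using e[OF P, of "\<zeta> - x" "\<zeta> - l" "h \<zeta>"] n by (simp add: 2)
    qed
  qed
qed

text \<open>On the circle each factor \<open>\<zeta> - x\<close> is at least \<open>r / 2\<close>; the length of the circle cancels one of
  the resulting powers of \<open>1 / r\<close>.\<close>
lemma norm_divdiff_le:
  assumes h: "h holomorphic_on cball 0 r" and S: "\<And>\<zeta>. norm \<zeta> = r \<Longrightarrow> norm (h \<zeta>) \<le> S"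
    and r: "0 < r" and ls: "ls \<noteq> []" "distinct ls" "\<And>x. x \<in> set ls \<Longrightarrow> norm x \<le> r / 2"
  shows "norm (divdiff h ls) \<le> 2 * S * (2 / r) ^ (length ls - 1)"
proof -
  have S0: "S \<ge> 0" using order_trans[OF norm_ge_zero S[of "of_real r"]] r by simp
  have sub: "set ls \<subseteq> ball 0 r" using ls(3) r by force
  have "norm (2 * of_real pi * \<i> * divdiff h ls) \<le> (S * (2 / r) ^ length ls) * (2 * pi * r)"
  proof (rule has_contour_integral_bound_circlepath[OF divdiff_contour_integral[OF h ls(1,2) sub]])
    show "0 \<le> S * (2 / r) ^ length ls" using S0 r by simp
    fix \<zeta> :: complex assume "norm (\<zeta> - 0) = r"
    then have z: "norm \<zeta> = r" by simp
    have "(r / 2) ^ length ls \<le> norm (\<Prod>x\<leftarrow>ls. \<zeta> - x)"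
      using ls(3)
    proof (induction ls)
      case (Cons a ls)
      have "r / 2 \<le> norm (\<zeta> - a)" using Cons.prems[of a] z norm_triangle_ineq2[of \<zeta> a] by simp
      then have "(r / 2) * (r / 2) ^ length ls \<le> norm (\<zeta> - a) * norm (\<Prod>x\<leftarrow>ls. \<zeta> - x)"
        using Cons r by (intro mult_mono) auto
      then show ?case by (simp add: norm_mult)
    qed simp
    then have "norm (h \<zeta>) / norm (\<Prod>x\<leftarrow>ls. \<zeta> - x) \<le> S / (r / 2) ^ length ls"
      using S[OF z] S0 r by (intro frac_le) auto
    then show "norm (h \<zeta> / (\<Prod>x\<leftarrow>ls. \<zeta> - x)) \<le> S * (2 / r) ^ length ls"
      by (simp add: norm_divide power_divide)
  qed (rule r)
  then have "norm (divdiff h ls) \<le> S * (2 / r) ^ length ls * r"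
    by (simp add: norm_mult)
  also have "\<dots> = 2 * S * (2 / r) ^ (length ls - 1)"
    using ls(1) r by (cases ls) auto
  finally show ?thesis .
qed

lemma powr_above_tangent:
  fixes u x q :: real
  assumes "u \<ge> 0" "x > 0" "q \<ge> 1"
  shows "x powr q + q * x powr (q - 1) * (u - x) \<le> u powr q"
proof (cases "u = 0")
  case True
  have "x powr (q - 1) * x = x powr q" using assms by (simp add: powr_diff)
  then have "x powr q + q * x powr (q - 1) * (0 - x) = (1 - q) * x powr q"
    by (simp add: algebra_simps)
  also have "\<dots> \<le> 0" using assms by (intro mult_nonpos_nonneg) auto
  finally show ?thesis using True by simp
next
  case False
  have "((\<lambda>t. t powr q) has_real_derivative q * x powr (q - 1)) (at x within {0<..})"
    by (rule has_field_derivative_at_within[OF has_real_derivative_powr]) (rule assms)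
  then have "u powr q - x powr q \<ge> (q * x powr (q - 1)) * (u - x)"
    using assms False
    by (intro convex_on_imp_above_tangent[where A="{0<..}", OF powr_convex]) (auto simp: interior_open)
  then show ?thesis by simp
qed

text \<open>Jensen's inequality for the convex function \<open>t \<mapsto> t powr q\<close>, in the form of its tangent at
  \<open>norm (\<phi> 0)\<close>, applied to the mean value property.\<close>
lemma circle_mean_value:
  assumes \<phi>: "\<phi> holomorphic_on cball 0 1" and q: "q \<ge> 1"
  shows "ennreal (norm (\<phi> 0) powr q) \<le> (\<integral>\<^sup>+t. indicator {0..1} t * ennreal (norm (\<phi> (exp (2 * of_real pi * \<i> * of_real t))) powr q) \<partial>lborel)"
proof (cases "\<phi> 0 = 0")
  case False
  define \<gamma> where "\<gamma> t = exp (2 * of_real pi * \<i> * of_real t)" for t :: real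
  have g1: "norm (\<gamma> t) = 1" for t by (simp add: \<gamma>_def)
  have cg: "continuous_on {0..1} (\<lambda>t. \<phi> (\<gamma> t))"
  proof (rule continuous_on_compose2[OF holomorphic_on_imp_continuous_on[OF \<phi>]])
    show "continuous_on {0..1} \<gamma>" unfolding \<gamma>_def by (intro continuous_intros)
  qed (use g1 in auto)
  have "((\<lambda>u. \<phi> u / (u - 0)) has_contour_integral (2 * of_real pi * \<i> * \<phi> 0)) (circlepath 0 1)"
    by (rule Cauchy_integral_circlepath_simple[OF \<phi>]) simp
  then have "((\<lambda>t. \<phi> (circlepath 0 1 t) / (circlepath 0 1 t - 0) * vector_derivative (circlepath 0 1) (at t within {0..1}))
      has_integral (2 * of_real pi * \<i> * \<phi> 0)) {0..1}" unfolding has_contour_integral_def .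
  then have "((\<lambda>t. (2 * of_real pi * \<i>) * \<phi> (\<gamma> t)) has_integral (2 * of_real pi * \<i> * \<phi> 0)) {0..1}"
  proof (rule has_integral_eq[rotated])
    fix t :: real assume t: "t \<in> {0..1}"
    have 1: "circlepath 0 1 t = \<gamma> t" by (simp add: circlepath \<gamma>_def)
    have 2: "vector_derivative (circlepath 0 1) (at t within {0..1}) = 2 * of_real pi * \<i> * \<gamma> t"
      using vector_derivative_circlepath01[of t 0 1] t by (simp add: \<gamma>_def)
    have 3: "\<gamma> t \<noteq> 0" using g1[of t] by auto
    show "\<phi> (circlepath 0 1 t) / (circlepath 0 1 t - 0) * vector_derivative (circlepath 0 1) (at t within {0..1})
        = (2 * of_real pi * \<i>) * \<phi> (\<gamma> t)"
      unfolding 1 2 using 3 by simp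
  qed
  from has_integral_mult_right[OF this, of "1 / (2 * of_real pi * \<i>)"]
  have hi: "((\<lambda>t. \<phi> (\<gamma> t)) has_integral \<phi> 0) {0..1}" by simp
  define x where "x = norm (\<phi> 0)"
  have x: "x > 0" using False by (simp add: x_def)
  have ni: "(\<lambda>t. norm (\<phi> (\<gamma> t))) integrable_on {0..1}"
    by (intro integrable_continuous_interval continuous_on_norm cg)
  have le1: "x \<le> integral {0..1} (\<lambda>t. norm (\<phi> (\<gamma> t)))"
    unfolding x_def integral_unique[OF hi, symmetric]
    by (rule integral_norm_bound_integral[OF _ ni]) (use hi in \<open>auto simp: has_integral_integrable\<close>)
  have pi: "(\<lambda>t. norm (\<phi> (\<gamma> t)) powr q) integrable_on {0..1}"
    using q by (intro integrable_continuous_interval continuous_on_powr' continuous_on_norm cg continuous_on_const) auto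
  have "x powr q \<le> x powr q + q * x powr (q - 1) * (integral {0..1} (\<lambda>t. norm (\<phi> (\<gamma> t))) - x)"
    using le1 q by simp
  also have "\<dots> = integral {0..1} (\<lambda>t. x powr q + q * x powr (q - 1) * (norm (\<phi> (\<gamma> t)) - x))"
  proof -
    have "((\<lambda>t. x powr q + q * x powr (q - 1) * (norm (\<phi> (\<gamma> t)) - x)) has_integral
       (1 - 0) *\<^sub>R (x powr q) + q * x powr (q - 1) * (integral {0..1} (\<lambda>t. norm (\<phi> (\<gamma> t))) - (1 - 0) *\<^sub>R x)) {0..1}"
      by (intro has_integral_add has_integral_mult_right has_integral_diff integrable_integral ni)
         (use has_integral_const_real[of _ 0 1] in auto)
    then show ?thesis by (simp add: integral_unique)
  qed
  also have "\<dots> \<le> integral {0..1} (\<lambda>t. norm (\<phi> (\<gamma> t)) powr q)"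
  proof (rule integral_le[OF _ pi])
    show "(\<lambda>t. x powr q + q * x powr (q - 1) * (norm (\<phi> (\<gamma> t)) - x)) integrable_on {0..1}"
      by (intro integrable_continuous_interval continuous_intros cg)
  qed (intro powr_above_tangent x q norm_ge_zero)
  finally have "ennreal (x powr q) \<le> ennreal (integral {0..1} (\<lambda>t. norm (\<phi> (\<gamma> t)) powr q))"
    by (rule ennreal_leI)
  also have "\<dots> = (\<integral>\<^sup>+t. indicator {0..1} t * ennreal (norm (\<phi> (\<gamma> t)) powr q) \<partial>lborel)"
    using nn_integral_has_integral_lebesgue[OF _ integrable_integral[OF pi]]
    by (simp add: ennreal_mult' ennreal_indicator)
  finally show ?thesis by (simp add: x_def \<gamma>_def)
qed simp

text \<open>Up to a null set an open set is a disjoint union of countably many balls, by Vitali's covering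
  theorem, and an isometry maps balls to balls of the same radius. This gives rotation invariance of
  Lebesgue measure directly on spaces such as \<open>complex^'n\<close>.\<close>
lemma emeasure_isometry_image_open_le:
  fixes T :: "'a::euclidean_space \<Rightarrow> 'a"
  assumes iso: "\<And>x y. dist (T x) (T y) = dist x y" and surj: "surj T" and U: "open U"
  shows "emeasure lebesgue (T ` U) \<le> emeasure lebesgue U"
proof -
  define K where "K = {(x, r). 0 < r \<and> ball x r \<subseteq> U}"
  have cov: "\<exists>i. i \<in> K \<and> x \<in> ball (fst i) (snd i) \<and> snd i < d" if xU: "x \<in> U" and d: "0 < d" for x d
  proof -
    obtain e where e: "e > 0" "ball x e \<subseteq> U" by (rule openE[OF U xU])
    have "ball x (min e (d/2)) \<subseteq> U" using subset_ball[of "min e (d/2)" e x] e(2) by (meson min.cobounded1 order_trans)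
    then have "(x, min e (d/2)) \<in> K" using e(1) d by (simp add: K_def)
    moreover have "x \<in> ball x (min e (d/2))" "min e (d/2) < d" using e(1) d by auto
    ultimately show ?thesis by (intro exI[of _ "(x, min e (d/2))"]) simp
  qed
  obtain C where C: "countable C" "C \<subseteq> K"
     "pairwise (\<lambda>i j. disjnt (ball (fst i) (snd i)) (ball (fst j) (snd j))) C"
     "negligible (U - (\<Union>i\<in>C. ball (fst i) (snd i)))"
  proof (rule Vitali_covering_theorem_balls[of U K fst snd])
    fix x and d :: real assume "x \<in> U" "0 < d"
    then show "\<exists>i. i \<in> K \<and> x \<in> ball (fst i) (snd i) \<and> snd i < d" by (rule cov)
  qed (rule that)
  define N where "N = U - (\<Union>i\<in>C. ball (fst i) (snd i))"
  have Tb: "T ` ball x r = ball (T x) r" for x r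
  proof
    show "ball (T x) r \<subseteq> T ` ball x r"
    proof
      fix y assume y: "y \<in> ball (T x) r"
      obtain x' where "y = T x'" using surj by blast
      then show "y \<in> T ` ball x r" using y by (auto simp: iso)
    qed
  qed (auto simp: iso)
  have inj: "inj T"
  proof (rule injI)
    fix x y assume "T x = T y"
    then show "x = y" using iso[of x y] by simp
  qed
  have TN: "T ` N \<in> null_sets lebesgue"
    unfolding negligible_iff_null_sets[symmetric]
  proof (rule negligible_locally_Lipschitz_image[OF order_refl])
    show "negligible N" using C(4) by (simp add: N_def)
    show "\<exists>V B. open V \<and> x \<in> V \<and> (\<forall>y\<in>N \<inter> V. norm (T y - T x) \<le> B * norm (y - x))" for x
      using iso by (intro exI[of _ UNIV] exI[of _ 1]) (auto simp: dist_norm)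
  qed
  have disj: "disjoint_family_on (\<lambda>i. ball (fst i) (snd i)) C"
    using C(3) by (auto simp: disjoint_family_on_def pairwise_def disjnt_def)
  have Tdisj: "disjoint_family_on (\<lambda>i. ball (T (fst i)) (snd i)) C"
    unfolding Tb[symmetric] disjoint_family_on_def
  proof (intro ballI impI)
    fix i j assume "i \<in> C" "j \<in> C" "i \<noteq> j"
    then have "ball (fst i) (snd i) \<inter> ball (fst j) (snd j) = {}" using disj by (auto simp: disjoint_family_on_def)
    then show "T ` ball (fst i) (snd i) \<inter> T ` ball (fst j) (snd j) = {}"
      by (simp add: image_Int[OF inj, symmetric])
  qed
  have bl: "emeasure lebesgue (ball x r) = emeasure lebesgue (ball y r)" for x y :: 'a and r
    by (cases "r \<ge> 0") (simp_all add: emeasure_ball ball_empty)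
  have Uc: "open (\<Union>i\<in>C. ball (T (fst i)) (snd i))" by auto
  have "T ` U \<subseteq> (\<Union>i\<in>C. ball (T (fst i)) (snd i)) \<union> T ` N"
    unfolding Tb[symmetric] N_def by blast
  then have "emeasure lebesgue (T ` U) \<le> emeasure lebesgue ((\<Union>i\<in>C. ball (T (fst i)) (snd i)) \<union> T ` N)"
    using TN Uc by (intro emeasure_mono) (auto intro!: sets.Un)
  also have "\<dots> = emeasure lebesgue (\<Union>i\<in>C. ball (T (fst i)) (snd i))"
    by (rule emeasure_Un_null_set[OF _ TN]) (use Uc in simp)
  also have "\<dots> = (\<integral>\<^sup>+i. emeasure lebesgue (ball (T (fst i)) (snd i)) \<partial>count_space C)"
    by (rule emeasure_UN_countable[OF _ C(1) Tdisj]) simp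
  also have "\<dots> = (\<integral>\<^sup>+i. emeasure lebesgue (ball (fst i) (snd i)) \<partial>count_space C)"
    by (intro nn_integral_cong bl)
  also have "\<dots> = emeasure lebesgue (\<Union>i\<in>C. ball (fst i) (snd i))"
    by (rule emeasure_UN_countable[OF _ C(1) disj, symmetric]) simp
  also have "\<dots> \<le> emeasure lebesgue U"
  proof (rule emeasure_mono)
    show "(\<Union>i\<in>C. ball (fst i) (snd i)) \<subseteq> U"
    proof (rule UN_least)
      fix i assume "i \<in> C"
      then have "i \<in> K" using C(2) by blast
      then show "ball (fst i) (snd i) \<subseteq> U" by (cases i) (simp add: K_def)
    qed
  qed (use U in simp)
  finally show ?thesis .
qed

lemma distr_lborel_isometry:
  fixes T :: "'a::euclidean_space \<Rightarrow> 'a"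
  assumes iso: "\<And>x y. dist (T x) (T y) = dist x y" and surj: "surj T"
  shows "distr lborel lborel T = lborel"
proof (rule lborel_eqI[symmetric])
  have cont: "continuous_on UNIV T"
    unfolding continuous_on_iff by (auto simp: iso)
  then have Tm: "T \<in> borel_measurable borel" by (rule borel_measurable_continuous_onI)
  have inj: "inj T"
  proof (rule injI)
    fix x y assume "T x = T y"
    then show "x = y" using iso[of x y] by simp
  qed
  have isoi: "dist (inv T x) (inv T y) = dist x y" for x y
    using iso[of "inv T x" "inv T y"] surj by (simp add: surj_f_inv_f)
  fix l u :: 'a assume lu: "\<And>b. b \<in> Basis \<Longrightarrow> l \<bullet> b \<le> u \<bullet> b"
  define V where "V = T -` box l u"
  have oV: "open V" unfolding V_def using cont by (intro open_vimage) (auto simp: open_box)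
  have e: "V = inv T ` box l u" unfolding V_def
    by (rule bij_vimage_eq_inv_image) (use inj surj in \<open>simp add: bij_def\<close>)
  have "emeasure lebesgue V \<le> emeasure lebesgue (box l u)"
    unfolding e by (rule emeasure_isometry_image_open_le[OF isoi _ open_box]) (use inj in \<open>simp add: inj_imp_surj_inv\<close>)
  moreover have "T ` V = box l u" using surj by (auto simp: V_def)
  then have "emeasure lebesgue (box l u) \<le> emeasure lebesgue V"
    using emeasure_isometry_image_open_le[OF iso surj oV] by simp
  ultimately have "emeasure lborel V = emeasure lborel (box l u)"
    using oV by simp
  then show "emeasure (distr lborel lborel T) (box l u) = (\<Prod>b\<in>Basis. (u - l) \<bullet> b)"
    using Tm lu by (simp add: emeasure_distr V_def)
qed simp

lemma norm_vector_scalar_mult: "norm (c *s (x :: complex^'n)) = norm c * norm x"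
proof -
  have "norm (c *s x) = L2_set (\<lambda>i. norm c * norm (x $ i)) UNIV"
    by (simp add: norm_vec_def norm_mult)
  also have "\<dots> = norm c * norm x" by (simp add: norm_vec_def L2_set_right_distrib)
  finally show ?thesis .
qed

lemma distr_lborel_rotation:
  assumes "norm c = 1"
  shows "distr lborel lborel (\<lambda>y :: complex^'n. c *s y) = lborel"
proof (rule distr_lborel_isometry)
  show "dist (c *s x) (c *s y) = dist x y" for x y :: "complex^'n"
    using norm_vector_scalar_mult[of c "x - y"] assms by (simp add: dist_norm vector_ssub_ldistrib)
  have "c *s (inverse c *s y) = y" for y :: "complex^'n"
  proof -
    have "c \<noteq> 0" using assms by auto
    then show ?thesis by (simp add: vector_smult_assoc)
  qed
  then show "surj (\<lambda>y :: complex^'n. c *s y)" by (metis surjI)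
qed

lemma continuous_on_smult_vec:
  assumes "continuous_on A f" "continuous_on A g"
  shows "continuous_on A (\<lambda>x. f x *s (g x :: complex^'n))"
  unfolding vector_scalar_mult_def
  using assms by (intro continuous_intros continuous_on_vec_lambda)

text \<open>For each \<open>y\<close> in the circled set \<open>U\<close> the value at \<open>x\<close> is bounded by the mean over the circle
  through \<open>x + y\<close>. Integrating over \<open>y\<close> and exchanging the integrals, the rotation of \<open>y\<close> disappears by
  rotation invariance of Lebesgue measure.\<close>
lemma circled_mean_value:
  fixes G :: "complex^'n \<Rightarrow> complex"
  assumes D: "open D" and G: "holo_on G D" and U: "open U"
    and circ: "\<And>y c. y \<in> U \<Longrightarrow> norm c \<le> 1 \<Longrightarrow> c *s y \<in> U"
    and sub: "\<And>y. y \<in> U \<Longrightarrow> x + y \<in> E" and E: "E \<subseteq> D" "open E" and q: "q \<ge> 1"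
  shows "ennreal (norm (G x) powr q) * emeasure lborel U \<le> (\<integral>\<^sup>+w. indicator E w * ennreal (norm (G w) powr q) \<partial>lborel)"
proof -
  define rot where "rot t = exp (2 * of_real pi * \<i> * of_real t)" for t :: real
  have r1: "norm (rot t) = 1" for t by (simp add: rot_def)
  define F where "F y = indicator U y * ennreal (norm (G (x + y)) powr q)" for y
  have Gc: "continuous_on D G" by (rule holo_on_continuous_on[OF G])
  have pw: "continuous_on S (\<lambda>p. norm (g p) powr q)" if "continuous_on S g" for S and g :: "'c::topological_space \<Rightarrow> complex"
    using q that by (intro continuous_on_powr' continuous_on_norm continuous_on_const) auto
  have Fm: "F \<in> borel_measurable borel"
  proof -
    have "continuous_on U (\<lambda>y. norm (G (x + y)) powr q)"
      using sub E by (intro pw continuous_on_compose2[OF Gc] continuous_intros) auto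
    then have "(\<lambda>y. indicator U y *\<^sub>R (norm (G (x + y)) powr q)) \<in> borel_measurable borel"
      by (intro borel_measurable_continuous_on_indicator) (use U in auto)
    then have "(\<lambda>y. ennreal (indicator U y *\<^sub>R (norm (G (x + y)) powr q))) \<in> borel_measurable borel" by measurable
    moreover have "F = (\<lambda>y. ennreal (indicator U y *\<^sub>R (norm (G (x + y)) powr q)))"
      by (rule ext) (simp add: F_def split: split_indicator)
    ultimately show ?thesis by simp
  qed
  have rotm: "(\<lambda>p :: (complex^'n) \<times> real. rot (snd p) *s fst p) \<in> borel_measurable borel"
    unfolding rot_def by (intro borel_measurable_continuous_onI continuous_on_smult_vec continuous_intros)
  have Hm: "(\<lambda>p. indicator {0..1} (snd p) * F (rot (snd p) *s fst p)) \<in> borel_measurable (lborel \<Otimes>\<^sub>M (lborel :: real measure))"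
  proof -
    have 1: "(\<lambda>p. F (rot (snd p) *s fst p)) \<in> borel_measurable (borel :: ((complex^'n) \<times> real) measure)"
      using measurable_compose[OF rotm Fm] by simp
    have 2: "(\<lambda>p :: (complex^'n) \<times> real. snd p) \<in> borel_measurable borel"
      by (intro borel_measurable_continuous_onI continuous_intros)
    have "(\<lambda>p :: (complex^'n) \<times> real. indicator {0..1} (snd p) :: ennreal) \<in> borel_measurable borel"
      using measurable_compose[OF 2, of "indicator {0..1}" borel] by simp
    then have "(\<lambda>p. indicator {0..1} (snd p) * F (rot (snd p) *s fst p)) \<in> borel_measurable (borel :: ((complex^'n) \<times> real) measure)"
      using 1 by (intro borel_measurable_times_ennreal)
    then show ?thesis by (simp add: lborel_prod)
  qed
  have pt: "ennreal (norm (G x) powr q) * indicator U y \<le> (\<integral>\<^sup>+t. indicator {0..1} t * F (rot t *s y) \<partial>lborel)" for y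
  proof (cases "y \<in> U")
    case True
    have "(\<lambda>s. G (x + s *s y)) holomorphic_on cball 0 1"
      by (rule holo_on_affine[OF G]) (use sub circ True E in auto)
    from circle_mean_value[OF this q]
    have "ennreal (norm (G x) powr q) \<le> (\<integral>\<^sup>+t. indicator {0..1} t * ennreal (norm (G (x + rot t *s y)) powr q) \<partial>lborel)"
      by (simp add: rot_def)
    also have "\<dots> = (\<integral>\<^sup>+t. indicator {0..1} t * F (rot t *s y) \<partial>lborel)"
      using circ[OF True] r1 by (simp add: F_def)
    finally show ?thesis using True by simp
  qed simp
  have "ennreal (norm (G x) powr q) * emeasure lborel U = (\<integral>\<^sup>+y. ennreal (norm (G x) powr q) * indicator U y \<partial>lborel)"
    using U by (simp add: nn_integral_cmult_indicator)
  also have "\<dots> \<le> (\<integral>\<^sup>+y. \<integral>\<^sup>+t. indicator {0..1} t * F (rot t *s y) \<partial>lborel \<partial>lborel)"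
    by (intro nn_integral_mono pt)
  also have "\<dots> = (\<integral>\<^sup>+t. \<integral>\<^sup>+y. indicator {0..1} t * F (rot t *s y) \<partial>lborel \<partial>lborel)"
    using lborel_pair.Fubini'[of "\<lambda>y t. indicator {0..1} t * F (rot t *s y)"] Hm by (simp add: case_prod_unfold)
  also have "\<dots> = (\<integral>\<^sup>+t. indicator {0..1} t * (\<integral>\<^sup>+y. F y \<partial>lborel) \<partial>(lborel :: real measure))"
  proof (rule nn_integral_cong)
    fix t :: real
    have rm: "(\<lambda>y :: complex^'n. rot t *s y) \<in> borel_measurable borel"
      by (intro borel_measurable_continuous_onI continuous_on_smult_vec continuous_intros)
    have "(\<integral>\<^sup>+y. F y \<partial>lborel) = (\<integral>\<^sup>+y. F y \<partial>(distr lborel lborel (\<lambda>y :: complex^'n. rot t *s y)))"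
      by (simp add: distr_lborel_rotation[OF r1])
    also have "\<dots> = (\<integral>\<^sup>+y. F (rot t *s y) \<partial>lborel)"
      using rm Fm by (subst nn_integral_distr) auto
    finally have e: "(\<integral>\<^sup>+y. F y \<partial>lborel) = (\<integral>\<^sup>+y. F (rot t *s y) \<partial>lborel)" .
    have "(\<integral>\<^sup>+y. indicator {0..1} t * F (rot t *s y) \<partial>lborel) = indicator {0..1} t * (\<integral>\<^sup>+y. F (rot t *s y) \<partial>lborel)"
      by (rule nn_integral_cmult) (use measurable_compose[OF rm Fm] in simp)
    then show "(\<integral>\<^sup>+y. indicator {0..1} t * F (rot t *s y) \<partial>lborel) = indicator {0..1} t * (\<integral>\<^sup>+y. F y \<partial>lborel)"
      by (simp add: e)
  qed
  also have "\<dots> = (\<integral>\<^sup>+y. F y \<partial>lborel)"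
    by (subst nn_integral_multc) auto
  also have "\<dots> \<le> (\<integral>\<^sup>+y. indicator E (x + y) * ennreal (norm (G (x + y)) powr q) \<partial>lborel)"
    by (rule nn_integral_mono) (use sub in \<open>auto simp: F_def split: split_indicator\<close>)
  also have "\<dots> = (\<integral>\<^sup>+w. indicator E w * ennreal (norm (G w) powr q) \<partial>(distr lborel borel ((+) x)))"
  proof (rule nn_integral_distr[symmetric])
    have "continuous_on E (\<lambda>w. norm (G w) powr q)"
      by (rule pw[OF continuous_on_subset[OF Gc E(1)]])
    then have "(\<lambda>w. indicator E w *\<^sub>R (norm (G w) powr q)) \<in> borel_measurable borel"
      by (intro borel_measurable_continuous_on_indicator) (use E in auto)
    then have "(\<lambda>w. ennreal (indicator E w *\<^sub>R (norm (G w) powr q))) \<in> borel_measurable borel" by measurable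
    moreover have "(\<lambda>w. indicator E w * ennreal (norm (G w) powr q)) = (\<lambda>w. ennreal (indicator E w *\<^sub>R (norm (G w) powr q)))"
      by (rule ext) (simp split: split_indicator)
    ultimately show "(\<lambda>w. indicator E w * ennreal (norm (G w) powr q)) \<in> borel_measurable (distr lborel borel ((+) x))" by simp
  qed simp
  also have "\<dots> = (\<integral>\<^sup>+w. indicator E w * ennreal (norm (G w) powr q) \<partial>lborel)"
    by (simp add: lborel_distr_plus)
  finally show ?thesis .
qed

section \<open>Zero sets of separately holomorphic functions\<close>

lemma fsigma_ball: "fsigma (ball (x :: 'a::real_normed_vector) r)"
proof -
  have "ball x r = (\<Union>n::nat. cball x (r - inverse (real (Suc n))))"
  proof (intro equalityI subsetI)
    fix y assume "y \<in> ball x r"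
    then obtain n where "inverse (real (Suc n)) < r - dist x y"
      using reals_Archimedean[of "r - dist x y"] by auto
    then have "y \<in> cball x (r - inverse (real (Suc n)))" by simp
    then show "y \<in> (\<Union>n::nat. cball x (r - inverse (real (Suc n))))" by blast
  next
    fix y assume "y \<in> (\<Union>n::nat. cball x (r - inverse (real (Suc n))))"
    then obtain n :: nat where "dist x y \<le> r - inverse (real (Suc n))" by auto
    moreover have "inverse (real (Suc n)) > 0" by simp
    ultimately show "y \<in> ball x r" unfolding mem_ball by linarith
  qed
  then show ?thesis by (metis closed_cball fsigma.intros)
qed

text \<open>By induction on the number of variables, almost every slice in the new variable is a
  holomorphic function which is nonzero at the new coordinate of \<open>t0\<close>. Its zeros are countable, hence
  a null set, and Fubini's theorem concludes.\<close>
lemma AE_PiM_holomorphic_nonzero: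
  fixes h :: "('i \<Rightarrow> complex) \<Rightarrow> complex"
  assumes "finite I" "h \<in> borel_measurable (PiM I (\<lambda>_. lborel))"
    "\<And>t i. t \<in> PiE I (\<lambda>i. ball 0 (r i)) \<Longrightarrow> i \<in> I \<Longrightarrow> (\<lambda>x. h (t(i := x))) holomorphic_on ball 0 (r i)"
    "t0 \<in> PiE I (\<lambda>i. ball 0 (r i))" "h t0 \<noteq> 0"
  shows "AE t in PiM I (\<lambda>_. lborel). t \<in> PiE I (\<lambda>i. ball 0 (r i)) \<longrightarrow> h t \<noteq> 0"
  using assms
proof (induction I arbitrary: h t0 rule: finite_induct)
  case empty
  show ?case
  proof (rule AE_I2)
    fix t assume "t \<in> space (PiM {} (\<lambda>_ :: 'i. lborel :: complex measure))"
    then have "t = t0" using empty.prems(3) by (simp add: space_PiM)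
    then show "t \<in> PiE {} (\<lambda>i. ball 0 (r i)) \<longrightarrow> h t \<noteq> 0" using empty.prems(4) by auto
  qed
next
  case (insert i I)
  interpret product_sigma_finite "\<lambda>_ :: 'i. lborel :: complex measure"
    by (simp add: product_sigma_finite_def lborel.sigma_finite_measure_axioms)
  let ?Q = "\<lambda>I. PiE I (\<lambda>i. ball (0 :: complex) (r i))"
  define x0 where "x0 = t0 i"
  define t0' where "t0' = t0(i := undefined)"
  define h' where "h' t = h (t(i := x0))" for t
  have t0': "t0' \<in> ?Q I" using insert.prems(3) insert.hyps(2)
    by (auto simp: t0'_def PiE_iff extensional_def)
  have x0: "x0 \<in> ball 0 (r i)" using insert.prems(3) by (auto simp: x0_def PiE_iff)
  have upd: "t(i := x) \<in> ?Q (insert i I)" if "t \<in> ?Q I" "x \<in> ball 0 (r i)" for t x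
    using that by (intro PiE_fun_upd)
  have meas_upd: "(\<lambda>t. t(i := x)) \<in> measurable (PiM I (\<lambda>_. lborel)) (PiM (insert i I) (\<lambda>_. lborel :: complex measure))" for x
    by (rule measurable_fun_upd[where J=I]) auto
  have "h' \<in> borel_measurable (PiM I (\<lambda>_. lborel))"
    unfolding h'_def by (rule measurable_compose[OF meas_upd insert.prems(1)])
  moreover have "(\<lambda>x. h' (t(k := x))) holomorphic_on ball 0 (r k)" if t: "t \<in> ?Q I" and k: "k \<in> I" for t k
  proof -
    have "k \<noteq> i" using k insert.hyps by auto
    have "(\<lambda>x. h ((t(i := x0))(k := x))) holomorphic_on ball 0 (r k)"
      by (rule insert.prems(2)[OF upd[OF t x0]]) (use k in simp)
    then show ?thesis
      unfolding h'_def using fun_upd_twist[OF \<open>k \<noteq> i\<close>, of t] by simp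
  qed
  moreover have "h' t0' \<noteq> 0" using insert.prems(4) by (simp add: h'_def t0'_def x0_def)
  ultimately have IH: "AE t in PiM I (\<lambda>_. lborel). t \<in> ?Q I \<longrightarrow> h' t \<noteq> 0"
    using insert.IH t0' by blast
  define A where "A = {t \<in> space (PiM (insert i I) (\<lambda>_. lborel)). t \<in> ?Q (insert i I) \<and> h t = 0}"
  have Am: "A \<in> sets (PiM (insert i I) (\<lambda>_. lborel))"
  proof -
    have "?Q (insert i I) \<in> sets (PiM (insert i I) (\<lambda>_. lborel))"
      by (rule sets_PiM_I_finite) (use insert.hyps in auto)
    moreover have "{t \<in> space (PiM (insert i I) (\<lambda>_. lborel)). h t = 0} \<in> sets (PiM (insert i I) (\<lambda>_. lborel))"
    proof -
      have "h -` {0} \<inter> space (PiM (insert i I) (\<lambda>_. lborel)) \<in> sets (PiM (insert i I) (\<lambda>_. lborel))"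
        by (rule measurable_sets[OF insert.prems(1)]) simp
      moreover have "{t \<in> space (PiM (insert i I) (\<lambda>_. lborel)). h t = 0} = h -` {0} \<inter> space (PiM (insert i I) (\<lambda>_. lborel))"
        by auto
      ultimately show ?thesis by simp
    qed
    moreover have "A = ?Q (insert i I) \<inter> {t \<in> space (PiM (insert i I) (\<lambda>_. lborel)). h t = 0}"
      by (auto simp: A_def)
    ultimately show ?thesis by simp
  qed
  have "emeasure (PiM (insert i I) (\<lambda>_. lborel)) A
      = (\<integral>\<^sup>+t. indicator A t \<partial>PiM (insert i I) (\<lambda>_. lborel))" using Am by simp
  also have "\<dots> = (\<integral>\<^sup>+t. \<integral>\<^sup>+x. indicator A (t(i := x)) \<partial>lborel \<partial>PiM I (\<lambda>_. lborel))"
    by (rule product_nn_integral_insert) (use insert.hyps Am in auto)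
  also have "\<dots> = (\<integral>\<^sup>+t. 0 \<partial>PiM I (\<lambda>_. lborel :: complex measure))"
  proof (rule nn_integral_cong_AE)
    show "AE t in PiM I (\<lambda>_. lborel). (\<integral>\<^sup>+x. indicator A (t(i := x)) \<partial>lborel) = 0"
      using IH AE_space
    proof eventually_elim
      case (elim t)
      show ?case
      proof (cases "t \<in> ?Q I")
        case False
        have t: "t \<in> extensional I" using elim(2) by (simp add: space_PiM PiE_iff)
        have "indicator A (t(i := x)) = (0::ennreal)" for x
        proof -
          have "t \<in> ?Q I" if "t(i := x) \<in> ?Q (insert i I)"
          proof -
            have "(t(i := x))(i := undefined) \<in> ?Q I" by (rule fun_upd_in_PiE[OF insert.hyps(2) that])
            moreover have "(t(i := x))(i := undefined) = t" using t insert.hyps(2) by (auto simp: extensional_def)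
            ultimately show ?thesis by simp
          qed
          then have "t(i := x) \<notin> A" using False by (auto simp: A_def)
          then show ?thesis by (simp add: indicator_def)
        qed
        then show ?thesis by simp
      next
        case True
        then have nz: "h (t(i := x0)) \<noteq> 0" using elim by (simp add: h'_def)
        have hol: "(\<lambda>x. h (t(i := x))) holomorphic_on ball 0 (r i)"
        proof -
          have "(\<lambda>x. h ((t(i := x0))(i := x))) holomorphic_on ball 0 (r i)"
            by (rule insert.prems(2)[OF upd[OF True x0]]) simp
          then show ?thesis by simp
        qed
        have "countable {x \<in> ball 0 (r i). h (t(i := x)) = 0}"
        proof (cases "(\<lambda>x. h (t(i := x))) constant_on ball 0 (r i)")
          case True
          then have "{x \<in> ball 0 (r i). h (t(i := x)) = 0} = {}" using nz x0 by (auto simp: constant_on_def)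
          then show ?thesis by (simp only: countable_empty)
        next
          case False
          then show ?thesis by (intro holomorphic_countable_zeros[OF hol] fsigma_ball) auto
        qed
        then have "{x \<in> ball 0 (r i). h (t(i := x)) = 0} \<in> null_sets lborel"
          by (rule countable_imp_null_set_lborel)
        then have "AE x in lborel. x \<notin> {x \<in> ball 0 (r i). h (t(i := x)) = 0}" by (rule AE_not_in)
        then have "AE x in lborel. indicator A (t(i := x)) = (0::ennreal)"
          by eventually_elim (auto simp: A_def indicator_def PiE_iff)
        then show ?thesis by (subst nn_integral_cong_AE[where v="\<lambda>_. 0"]) auto
      qed
    qed
  qed
  finally have "A \<in> null_sets (PiM (insert i I) (\<lambda>_. lborel))" using Am by auto
  then have "AE t in PiM (insert i I) (\<lambda>_. lborel). t \<notin> A" by (rule AE_not_in)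
  then show ?case
    using AE_space by eventually_elim (auto simp: A_def)
qed

section \<open>Circled convex bodies attached to points of a convex domain\<close>

text \<open>For \<open>\<theta> = 1\<close> and convex \<open>D\<close> this is the largest circled convex set whose translate by \<open>z\<close> lies in
  \<open>D\<close>, a complex analogue of a Macbeath region; in general it is the dilate of that body by \<open>\<theta>\<close>.\<close>
definition disc_body :: "(complex^'n) set \<Rightarrow> complex^'n \<Rightarrow> real \<Rightarrow> (complex^'n) set" where
  "disc_body D z \<theta> = {y. \<forall>s. norm s \<le> 1 / \<theta> \<longrightarrow> z + s *s y \<in> D}"

lemma scaleR_conv_smult: "r *\<^sub>R (x :: complex^'n) = of_real r *s x"
  by (simp add: vec_eq_iff) (simp add: scaleR_conv_of_real)

lemma disc_body_mono: "0 < \<theta> \<Longrightarrow> \<theta> \<le> \<theta>' \<Longrightarrow> disc_body D z \<theta> \<subseteq> disc_body D z \<theta>'"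
proof (intro subsetI)
  fix y assume t: "0 < \<theta>" "\<theta> \<le> \<theta>'" and y: "y \<in> disc_body D z \<theta>"
  have "1 / \<theta>' \<le> 1 / \<theta>" using t by (simp add: frac_le)
  then show "y \<in> disc_body D z \<theta>'" using y unfolding disc_body_def by auto
qed

lemma disc_body_smult:
  assumes "y \<in> disc_body D z \<theta>" "norm c \<le> k" "0 < k" "0 < \<theta>"
  shows "c *s y \<in> disc_body D z (k * \<theta>)"
  unfolding disc_body_def
proof (safe)
  fix s :: complex assume s: "norm s \<le> 1 / (k * \<theta>)"
  have "norm (s * c) \<le> 1 / (k * \<theta>) * k"
    unfolding norm_mult using s assms by (intro mult_mono) auto
  then have "norm (s * c) \<le> 1 / \<theta>" using assms by simp
  then show "z + s *s (c *s y) \<in> D" using assms(1) by (simp add: disc_body_def vector_smult_assoc)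
qed

lemma norm_mult_of_real_le:
  assumes "norm (s :: complex) \<le> 1 / p" "0 < k"
  shows "norm (s * of_real k) \<le> k / p"
proof -
  have "norm (s * of_real k) = norm s * k" using assms(2) by (simp add: norm_mult)
  also have "\<dots> \<le> (1 / p) * k" by (rule mult_right_mono) (use assms in auto)
  finally show ?thesis by simp
qed

lemma disc_body_memD: "y \<in> disc_body D z \<theta> \<Longrightarrow> norm s \<le> 1 / \<theta> \<Longrightarrow> z + s *s y \<in> D"
  by (simp add: disc_body_def)

lemma disc_body_add:
  assumes D: "convex D" and a: "y \<in> disc_body D z a" "0 < a" and b: "u \<in> disc_body D z b" "0 < b"
  shows "y + u \<in> disc_body D z (a + b)"
  unfolding disc_body_def
proof safe
  fix s :: complex assume s: "norm s \<le> 1 / (a + b)"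
  have 1: "z + (s * of_real ((a + b) / a)) *s y \<in> D"
    by (rule disc_body_memD[OF a(1) order_trans[OF norm_mult_of_real_le[OF s]]]) (use a b in auto)
  have 2: "z + (s * of_real ((a + b) / b)) *s u \<in> D"
    by (rule disc_body_memD[OF b(1) order_trans[OF norm_mult_of_real_le[OF s]]]) (use a b in auto)
  have "(a / (a + b)) *\<^sub>R (z + (s * of_real ((a + b) / a)) *s y) + (b / (a + b)) *\<^sub>R (z + (s * of_real ((a + b) / b)) *s u) \<in> D"
    by (rule convexD[OF D 1 2]) (use a b in \<open>auto simp: add_divide_distrib[symmetric]\<close>)
  also have "(a / (a + b)) *\<^sub>R (z + (s * of_real ((a + b) / a)) *s y) + (b / (a + b)) *\<^sub>R (z + (s * of_real ((a + b) / b)) *s u)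
     = z + s *s (y + u)"
  proof -
    have ab: "complex_of_real a + complex_of_real b \<noteq> 0" using a b by (simp flip: of_real_add)
    have "of_real (a / (a + b)) * (z' + (s * of_real ((a + b) / a)) * y') + of_real (b / (a + b)) * (z' + (s * of_real ((a + b) / b)) * u')
       = z' + s * (y' + u')" for z' y' u' :: complex
      using a b ab by (simp add: divide_simps) (simp add: algebra_simps)
    then show ?thesis unfolding scaleR_conv_smult vec_eq_iff vector_add_component vector_smult_component by blast
  qed
  finally show "z + s *s (y + u) \<in> D" .
qed

text \<open>The point \<open>z + s *s u\<close> is a convex combination of a point of a disc centred at \<open>z + y\<close> and of the
  point \<open>z - y / \<theta>\<close>, which lies on the far side of \<open>z\<close>.\<close>
lemma disc_body_recenter:
  assumes D: "convex D" and y: "y \<in> disc_body D z \<theta>" "0 < \<theta>" and u: "u \<in> disc_body D (z + y) \<eta>" "0 < \<eta>"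
  shows "u \<in> disc_body D z ((1 + \<theta>) * \<eta>)"
  unfolding disc_body_def
proof safe
  fix s :: complex assume s: "norm s \<le> 1 / ((1 + \<theta>) * \<eta>)"
  have 1: "z + y + (s * of_real (1 + \<theta>)) *s u \<in> D"
    by (rule disc_body_memD[OF u(1) order_trans[OF norm_mult_of_real_le[OF s]]]) (use y u in auto)
  have 2: "z + (- of_real (1 / \<theta>)) *s y \<in> D"
    by (rule disc_body_memD[OF y(1)]) (use y in \<open>simp add: norm_divide\<close>)
  have "(1 / (1 + \<theta>)) *\<^sub>R (z + y + (s * of_real (1 + \<theta>)) *s u) + (\<theta> / (1 + \<theta>)) *\<^sub>R (z + (- of_real (1 / \<theta>)) *s y) \<in> D"
    by (rule convexD[OF D 1 2]) (use y in \<open>auto simp: add_divide_distrib[symmetric]\<close>)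
  also have "(1 / (1 + \<theta>)) *\<^sub>R (z + y + (s * of_real (1 + \<theta>)) *s u) + (\<theta> / (1 + \<theta>)) *\<^sub>R (z + (- of_real (1 / \<theta>)) *s y) = z + s *s u"
  proof -
    have ab: "1 + complex_of_real \<theta> \<noteq> 0" using y by (metis add_pos_pos of_real_1 of_real_add of_real_eq_0_iff order_less_irrefl zero_less_one)
    have "of_real (1 / (1 + \<theta>)) * (z' + y' + (s * of_real (1 + \<theta>)) * u') + of_real (\<theta> / (1 + \<theta>)) * (z' + (- of_real (1 / \<theta>)) * y')
       = z' + s * u'" for z' y' u' :: complex
      using y ab by (simp add: divide_simps) (simp add: algebra_simps)
    then show ?thesis unfolding scaleR_conv_smult vec_eq_iff vector_add_component vector_smult_component by blast
  qed
  finally show "z + s *s u \<in> D" .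
qed

text \<open>Conversely, \<open>z + y + s *s u\<close> is a convex combination of \<open>z + y / \<theta>\<close> and of a point of a disc centred
  at \<open>z\<close>.\<close>
lemma disc_body_recenter':
  assumes D: "convex D" and y: "y \<in> disc_body D z \<theta>" "0 < \<theta>" "\<theta> < 1" and u: "u \<in> disc_body D z \<eta>" "0 < \<eta>"
  shows "u \<in> disc_body D (z + y) (\<eta> / (1 - \<theta>))"
  unfolding disc_body_def
proof safe
  fix s :: complex assume s: "norm s \<le> 1 / (\<eta> / (1 - \<theta>))"
  have 1: "z + (of_real (1 / \<theta>)) *s y \<in> D"
    by (rule disc_body_memD[OF y(1)]) (use y in \<open>simp add: norm_divide\<close>)
  have 2: "z + (s * of_real (1 / (1 - \<theta>))) *s u \<in> D"
    by (rule disc_body_memD[OF u(1) order_trans[OF norm_mult_of_real_le[OF s]]]) (use y u in auto)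
  have "\<theta> *\<^sub>R (z + (of_real (1 / \<theta>)) *s y) + (1 - \<theta>) *\<^sub>R (z + (s * of_real (1 / (1 - \<theta>))) *s u) \<in> D"
    by (rule convexD[OF D 1 2]) (use y in auto)
  also have "\<theta> *\<^sub>R (z + (of_real (1 / \<theta>)) *s y) + (1 - \<theta>) *\<^sub>R (z + (s * of_real (1 / (1 - \<theta>))) *s u) = z + y + s *s u"
  proof -
    have ab: "1 - complex_of_real \<theta> \<noteq> 0" using y by (metis of_real_1 of_real_diff of_real_eq_0_iff diff_gt_0_iff_gt order_less_irrefl)
    have "of_real \<theta> * (z' + (of_real (1 / \<theta>)) * y') + of_real (1 - \<theta>) * (z' + (s * of_real (1 / (1 - \<theta>))) * u')
       = z' + y' + s * u'" for z' y' u' :: complex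
      using y ab by (simp add: divide_simps) (simp add: algebra_simps)
    then show ?thesis unfolding scaleR_conv_smult vec_eq_iff vector_add_component vector_smult_component by blast
  qed
  finally show "z + y + s *s u \<in> D" .
qed

lemma open_disc_body:
  assumes D: "open D" and t: "0 < \<theta>"
  shows "open (disc_body D z \<theta>)"
  unfolding open_contains_ball
proof
  fix y assume y: "y \<in> disc_body D z \<theta>"
  define K where "K = (\<lambda>s. z + s *s y) ` cball 0 (1 / \<theta>)"
  have "compact K" unfolding K_def
    by (intro compact_continuous_image continuous_intros continuous_on_smult_vec) auto
  moreover have "K \<subseteq> D" using y by (auto simp: K_def disc_body_def)
  ultimately obtain e where e: "e > 0" "(\<Union>x\<in>K. ball x e) \<subseteq> D"
    using compact_subset_open_imp_ball_epsilon_subset[OF _ D] by blast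
  have "ball y (e * \<theta>) \<subseteq> disc_body D z \<theta>"
    unfolding disc_body_def
  proof (intro subsetI CollectI allI impI)
    fix u and s :: complex assume u: "u \<in> ball y (e * \<theta>)" and s: "norm s \<le> 1 / \<theta>"
    have "dist (z + s *s y) (z + s *s u) = norm s * dist y u"
      using norm_vector_scalar_mult[of s "y - u"] by (simp add: dist_norm vector_ssub_ldistrib)
    also have "\<dots> \<le> (1 / \<theta>) * dist y u" by (rule mult_right_mono[OF s]) simp
    also have "\<dots> < e" using u t by (simp add: field_simps)
    finally have "z + s *s u \<in> ball (z + s *s y) e" by simp
    moreover have "z + s *s y \<in> K" using s by (auto simp: K_def)
    ultimately show "z + s *s u \<in> D" using e(2) by (meson UN_I subsetD)
  qed
  then show "\<exists>e>0. ball y e \<subseteq> disc_body D z \<theta>" using e(1) t by (intro exI[of _ "e * \<theta>"]) auto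
qed

lemma emeasure_disc_body_scale:
  assumes D: "open D" and t: "0 < \<theta>"
  shows "emeasure lborel (disc_body D (z :: complex^'n) \<theta>) = ennreal (\<theta> ^ (2 * CARD('n))) * emeasure lborel (disc_body D z 1)"
proof -
  have "disc_body D z \<theta> = (\<lambda>x. \<theta> *\<^sub>R x + 0) ` disc_body D z 1"
  proof safe
    fix y assume y: "y \<in> disc_body D z \<theta>"
    have "of_real (1/\<theta>) *s y \<in> disc_body D z ((1/\<theta>) * \<theta>)"
      by (rule disc_body_smult[OF y]) (use t in \<open>auto simp: norm_divide\<close>)
    then show "y \<in> (\<lambda>x. \<theta> *\<^sub>R x + 0) ` disc_body D z 1"
      using t by (intro image_eqI[of _ _ "of_real (1/\<theta>) *s y"]) (auto simp: scaleR_conv_smult vector_smult_assoc simp flip: of_real_mult)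
  next
    fix y assume y: "y \<in> disc_body D z 1"
    have "of_real \<theta> *s y \<in> disc_body D z (\<theta> * 1)"
      by (rule disc_body_smult[OF y]) (use t in auto)
    then show "\<theta> *\<^sub>R y + 0 \<in> disc_body D z \<theta>" by (simp add: scaleR_conv_smult)
  qed
  then have "emeasure lebesgue (disc_body D z \<theta>) = ennreal (\<theta> ^ DIM(complex^'n)) * emeasure lebesgue (disc_body D z 1)"
    using emeasure_lebesgue_affine[of \<theta> 0 "disc_body D z 1"] t by simp
  then show ?thesis using open_disc_body[OF D t, of z] open_disc_body[OF D, of 1 z]
    by (simp add: mult.commute)
qed

section \<open>Hermitian products, slabs and Koranyi balls\<close>

lemma hinner_add_left: "hinner (x + y) z = hinner x z + hinner y z"
  by (simp add: hinner_def sum.distrib algebra_simps)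

lemma hinner_diff_left: "hinner (x - y) z = hinner x z - hinner y z"
  by (simp add: hinner_def sum_subtractf algebra_simps)

lemma hinner_diff_right: "hinner x (y - z) = hinner x y - hinner x z"
  by (simp add: hinner_def sum_subtractf algebra_simps)

lemma hinner_smult_left: "hinner (c *s x) z = c * hinner x z"
  by (simp add: hinner_def sum_distrib_left mult.assoc)

lemma hinner_sum_left: "hinner (\<Sum>i\<in>S. f i) z = (\<Sum>i\<in>S. hinner (f i) z)"
  by (induction S rule: infinite_finite_induct) (auto simp: hinner_add_left, simp_all add: hinner_def)

lemma hinner_commute: "hinner x y = cnj (hinner y x)"
  by (simp add: hinner_def mult.commute)

lemma Re_hinner: "Re (hinner x y) = x \<bullet> y"
  by (simp add: hinner_def inner_vec_def inner_complex_def)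

lemma hinner_self: "hinner x x = of_real ((norm x)\<^sup>2)"
proof (rule complex_eqI)
  show "Re (hinner x x) = Re (of_real ((norm x)\<^sup>2))" by (simp add: Re_hinner power2_norm_eq_inner)
  show "Im (hinner x x) = Im (of_real ((norm x)\<^sup>2))" by (simp add: hinner_def)
qed

lemma norm_hinner_le: "norm (hinner x y) \<le> norm x * norm y"
proof (cases "hinner x y = 0")
  case False
  define c where "c = cnj (hinner x y) / of_real (norm (hinner x y))"
  have c1: "norm c = 1" using False by (simp add: c_def norm_divide)
  have "hinner (c *s x) y = hinner x y * cnj (hinner x y) / of_real (norm (hinner x y))"
    by (simp add: hinner_smult_left c_def)
  also have "\<dots> = of_real (norm (hinner x y)) * of_real (norm (hinner x y)) / of_real (norm (hinner x y))"
    by (simp only: complex_norm_square[symmetric] power2_eq_square of_real_mult)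
  also have "\<dots> = of_real (norm (hinner x y))" using False by simp
  finally have "hinner (c *s x) y = of_real (norm (hinner x y))" .
  then have "norm (hinner x y) = (c *s x) \<bullet> y"
    using Re_hinner[of "c *s x" y] by simp
  also have "\<dots> \<le> norm (c *s x) * norm y" by (rule norm_cauchy_schwarz)
  finally show ?thesis by (simp add: norm_vector_scalar_mult c1)
qed simp

lemma emeasure_lborel_translation:
  fixes A :: "'a::euclidean_space set"
  assumes "open A" shows "emeasure lborel ((+) w ` A) = emeasure lborel A"
proof -
  have "emeasure lborel ((+) w ` A) = emeasure lebesgue ((\<lambda>x. 1 *\<^sub>R x + w) ` A)"
    using open_translation[OF assms, of w] by (simp add: add.commute)
  also have "\<dots> = emeasure lborel A" by (subst emeasure_lebesgue_affine) (use assms in simp)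
  finally show ?thesis .
qed

text \<open>With \<open>R = sqrt a\<close>, the ball of radius \<open>R / 8\<close> is covered by at most \<open>(3 / R)\<^sup>2 = 9 / a\<close> translates of
  the slab in the complex direction \<open>\<eta>\<close>, so the slab has at least \<open>a / 9\<close> times the volume of this
  ball.\<close>
lemma slab_volume_ge:
  "\<exists>c>0. \<forall>(\<eta> :: complex^'n) a. norm \<eta> = 1 \<longrightarrow> 0 < a \<longrightarrow> a \<le> 1 \<longrightarrow>
       ennreal (c * a ^ (CARD('n) + 1)) \<le> emeasure lborel {y. norm (hinner y \<eta>) < a \<and> (norm y)\<^sup>2 < a}"
proof -
  define V where "V = unit_ball_vol (real (2 * CARD('n)))"
  have V: "V > 0" by (simp add: V_def)
  define c where "c = V / (9 * 8 ^ (2 * CARD('n)))"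
  show ?thesis
  proof (intro exI[of _ c] conjI allI impI)
    show "c > 0" using V by (simp add: c_def)
    fix \<eta> :: "complex^'n" and a :: real assume e: "norm \<eta> = 1" and a: "0 < a" "a \<le> 1"
    define Q where "Q = {y. norm (hinner y \<eta>) < a \<and> (norm y)\<^sup>2 < a}"
    define R where "R = sqrt a"
    have R: "0 < R" "R \<le> 1" "R\<^sup>2 = a" "a \<le> R" using a by (auto simp: R_def real_le_rsqrt power2_eq_square mult_left_le)
    have ch: "continuous_on UNIV (\<lambda>y. hinner y \<eta>)"
      unfolding hinner_def by (intro continuous_intros)
    have oQ: "open Q"
      unfolding Q_def by (intro open_Collect_conj open_Collect_less continuous_intros ch)
    define L where "L = {k :: int. \<bar>real_of_int k\<bar> \<le> 1 / (4 * R) + 1 / 2}"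
    define m where "m = \<lfloor>1 / (4 * R) + 1 / 2\<rfloor>"
    have Lm: "L = {-m..m}"
    proof (rule set_eqI)
      fix k
      have "k \<in> L \<longleftrightarrow> real_of_int \<bar>k\<bar> \<le> 1 / (4 * R) + 1 / 2" unfolding L_def mem_Collect_eq of_int_abs ..
      also have "\<dots> \<longleftrightarrow> \<bar>k\<bar> \<le> m" unfolding m_def by (rule le_floor_iff[symmetric])
      also have "\<dots> \<longleftrightarrow> k \<in> {-m..m}" by auto
      finally show "k \<in> L \<longleftrightarrow> k \<in> {-m..m}" .
    qed
    have m0: "m \<ge> 0" using R by (simp add: m_def)
    have Lfin: "finite L" by (simp add: Lm)
    have Lcard: "real (card L) \<le> 3 / R"
    proof -
      have "real (card L) = 2 * real_of_int m + 1" using m0 by (simp add: Lm)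
      also have "\<dots> \<le> 2 * (1 / (4 * R) + 1 / 2) + 1"
        unfolding m_def by (intro add_right_mono mult_left_mono of_int_floor_le) auto
      also have "\<dots> \<le> 3 / R" using R by (simp add: field_simps)
      finally show ?thesis .
    qed
    define g where "g = (\<lambda>(p, q). (of_real (real_of_int p * (a / 2)) + \<i> * of_real (real_of_int q * (a / 2))) *s \<eta>)"
    have cover: "ball 0 (R / 8) \<subseteq> (\<Union>k\<in>L \<times> L. (+) (g k) ` Q)"
    proof
      fix x :: "complex^'n" assume "x \<in> ball 0 (R / 8)"
      then have x: "norm x < R / 8" by simp
      define h where "h = hinner x \<eta>"
      have hn: "norm h < R / 8" using norm_hinner_le[of x \<eta>] e x by (simp add: h_def)
      define p q where "p = round (Re h / (a / 2))" and "q = round (Im h / (a / 2))"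
      define w where "w = (of_real (real_of_int p * (a / 2)) + \<i> * of_real (real_of_int q * (a / 2)) :: complex)"
      have near: "\<bar>t - real_of_int (round (t / (a / 2))) * (a / 2)\<bar> \<le> a / 4" for t
      proof -
        define X k where "X = t / (a / 2)" and "k = real_of_int (round X)"
        have "\<bar>X - k\<bar> \<le> 1 / 2" unfolding k_def
          by (subst abs_minus_commute) (rule of_int_round_abs_le)
        then have 1: "\<bar>X - k\<bar> * (a / 2) \<le> 1 / 2 * (a / 2)"
          using a by (intro mult_right_mono) auto
        have "X * (a / 2) = t" using a(1) by (simp add: X_def)
        then have "t - k * (a / 2) = (X - k) * (a / 2)" by (simp only: left_diff_distrib)
        then have "\<bar>t - k * (a / 2)\<bar> = \<bar>(X - k) * (a / 2)\<bar>" by (rule arg_cong)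
        also have "\<dots> = \<bar>X - k\<bar> * \<bar>a / 2\<bar>" by (rule abs_mult)
        also have "\<dots> = \<bar>X - k\<bar> * (a / 2)" using a(1) by simp
        also have "\<dots> \<le> 1 / 2 * (a / 2)" by (rule 1)
        also have "\<dots> = a / 4" by simp
        finally show ?thesis unfolding k_def X_def .
      qed
      have inL: "round (t / (a / 2)) \<in> L" if t: "\<bar>t\<bar> < R / 8" for t
      proof -
        have "\<bar>t / (a / 2)\<bar> \<le> (R / 8) / (a / 2)"
        proof -
          have "\<bar>t / (a / 2)\<bar> = \<bar>t\<bar> / (a / 2)" using a by (simp add: abs_divide)
          also have "\<dots> \<le> (R / 8) / (a / 2)" using t a by (intro divide_right_mono) auto
          finally show ?thesis .
        qed
        also have "\<dots> = 1 / (4 * R)" using R(1) by (simp add: R(3)[symmetric] power2_eq_square)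
        finally have "\<bar>t / (a / 2)\<bar> \<le> 1 / (4 * R)" .
        then show ?thesis using of_int_round_abs_le[of "t / (a / 2)"] unfolding L_def mem_Collect_eq by linarith
      qed
      have pL: "p \<in> L" unfolding p_def by (rule inL) (use hn abs_Re_le_cmod[of h] in linarith)
      have qL: "q \<in> L" unfolding q_def by (rule inL) (use hn abs_Im_le_cmod[of h] in linarith)
      have hw: "norm (h - w) \<le> a / 2"
        using cmod_le[of "h - w"] near[of "Re h"] near[of "Im h"] by (simp add: w_def p_def q_def)
      have gw: "g (p, q) = w *s \<eta>" by (simp add: g_def w_def)
      have "hinner (x - g (p, q)) \<eta> = h - w"
        by (simp add: gw hinner_diff_left hinner_smult_left hinner_self e h_def)
      then have 1: "norm (hinner (x - g (p, q)) \<eta>) < a" using hw a by simp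
      have "norm (x - g (p, q)) \<le> norm x + norm w"
        using norm_triangle_ineq4[of x "w *s \<eta>"] by (simp add: gw norm_vector_scalar_mult e)
      also have "\<dots> < R"
        using x hn hw R norm_triangle_ineq3[of w h] by (simp add: norm_minus_commute)
      finally have "(norm (x - g (p, q)))\<^sup>2 < R\<^sup>2" by (intro power_strict_mono) auto
      then have "x - g (p, q) \<in> Q" using 1 R by (simp add: Q_def)
      then have "x \<in> (+) (g (p, q)) ` Q" by (intro image_eqI[of _ _ "x - g (p, q)"]) auto
      then show "x \<in> (\<Union>k\<in>L \<times> L. (+) (g k) ` Q)" using pL qL by blast
    qed
    note trans = emeasure_lborel_translation[OF oQ]
    have "ennreal (V * (R / 8) ^ (2 * CARD('n))) = emeasure lborel (ball (0 :: complex^'n) (R / 8))"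
      using R by (subst emeasure_ball) (simp_all add: V_def mult.commute)
    also have "\<dots> \<le> emeasure lborel (\<Union>k\<in>L \<times> L. (+) (g k) ` Q)"
      using open_translation[OF oQ] by (intro emeasure_mono cover) auto
    also have "\<dots> \<le> (\<Sum>k\<in>L \<times> L. emeasure lborel ((+) (g k) ` Q))"
      using open_translation[OF oQ] Lfin by (intro emeasure_subadditive_finite) auto
    also have "\<dots> = of_nat (card L * card L) * emeasure lborel Q"
      using Lfin by (simp add: trans)
    also have "\<dots> \<le> ennreal (9 / a) * emeasure lborel Q"
    proof (rule mult_right_mono)
      have "real (card L) * real (card L) \<le> (3 / R) * (3 / R)" by (intro mult_mono Lcard) (use R in auto)
      also have "\<dots> = 9 / a" using R(1) by (simp add: R(3)[symmetric] power2_eq_square)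
      finally have "real (card L * card L) \<le> 9 / a" by simp
      then show "of_nat (card L * card L) \<le> ennreal (9 / a)"
        by (metis ennreal_leI ennreal_of_nat_eq_real_of_nat)
    qed simp
    finally have fin: "ennreal (V * (R / 8) ^ (2 * CARD('n))) \<le> ennreal (9 / a) * emeasure lborel Q" .
    have "ennreal (a / 9) * ennreal (V * (R / 8) ^ (2 * CARD('n))) \<le> ennreal (a / 9) * (ennreal (9 / a) * emeasure lborel Q)"
      by (rule mult_left_mono[OF fin]) simp
    also have "\<dots> = emeasure lborel Q"
      using a by (simp add: mult.assoc[symmetric] ennreal_mult[symmetric])
    also have "ennreal (a / 9) * ennreal (V * (R / 8) ^ (2 * CARD('n))) = ennreal (c * a ^ (CARD('n) + 1))"
    proof -
      have "R ^ (2 * CARD('n)) = a ^ CARD('n)" by (simp add: power_mult R(3))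
      then have "(a / 9) * (V * (R / 8) ^ (2 * CARD('n))) = c * a ^ (CARD('n) + 1)"
        by (simp add: c_def power_divide)
      moreover have "ennreal (a / 9) * ennreal (V * (R / 8) ^ (2 * CARD('n))) = ennreal ((a / 9) * (V * (R / 8) ^ (2 * CARD('n))))"
        using a(1) V R(1) by (intro ennreal_mult[symmetric]) auto
      ultimately show ?thesis by (simp only:)
    qed
    finally show "ennreal (c * a ^ (CARD('n) + 1)) \<le> emeasure lborel {y. norm (hinner y \<eta>) < a \<and> (norm y)\<^sup>2 < a}"
      by (simp add: Q_def)
  qed
qed

text \<open>An orthonormal family of \<open>CARD('n)\<close> vectors gives a matrix with a right inverse; that a right inverse
  of a square matrix is also a left inverse is the completeness of the family.\<close>
lemma orthonormal_expansion:
  fixes b :: "nat \<Rightarrow> complex^'n"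
  assumes b: "orthonormal_basis b"
  shows "x = (\<Sum>i\<in>{1..CARD('n)}. hinner x (b i) *s b i)"
proof -
  obtain \<phi> where \<phi>: "bij_betw \<phi> (UNIV :: 'n set) {1..CARD('n)}"
    using finite_same_card_bij[of "UNIV :: 'n set" "{1..CARD('n)}"] by auto
  have in\<phi>: "\<phi> i \<in> {1..CARD('n)}" for i using \<phi> by (auto simp: bij_betw_def)
  have inj: "\<phi> i = \<phi> j \<longleftrightarrow> i = j" for i j using \<phi> by (auto simp: bij_betw_def inj_eq)
  define A :: "complex^'n^'n" where "A = (\<chi> i j. cnj (b (\<phi> i) $ j))"
  define B :: "complex^'n^'n" where "B = (\<chi> j i. b (\<phi> i) $ j)"
  have "(A ** B) $ i $ k = mat 1 $ i $ k" for i k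
  proof -
    have "(A ** B) $ i $ k = hinner (b (\<phi> k)) (b (\<phi> i))"
      by (simp add: matrix_matrix_mult_def A_def B_def hinner_def mult.commute)
    then show ?thesis using b in\<phi>[of i] in\<phi>[of k] inj[of k i]
      by (cases "i = k") (simp_all add: orthonormal_basis_def mat_def)
  qed
  then have "A ** B = mat 1" by (simp add: vec_eq_iff)
  then have BA: "B ** A = mat 1" by (rule matrix_left_right_inverse[THEN iffD1])
  have "x = B *v (A *v x)" by (simp add: matrix_vector_mul_assoc BA)
  also have "\<dots> = (\<Sum>i\<in>UNIV. hinner x (b (\<phi> i)) *s b (\<phi> i))"
    by (simp add: vec_eq_iff matrix_vector_mult_def A_def B_def hinner_def mult.commute)
  also have "\<dots> = (\<Sum>i\<in>{1..CARD('n)}. hinner x (b i) *s b i)"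
    by (rule sum.reindex_bij_betw[OF \<phi>])
  finally show ?thesis .
qed

lemma hinner_orthonormal_sum:
  fixes b :: "nat \<Rightarrow> complex^'n"
  assumes b: "orthonormal_basis b" and S: "S \<subseteq> {1..CARD('n)}" and k: "k \<in> {1..CARD('n)}"
  shows "hinner (\<Sum>i\<in>S. t i *s b i) (b k) = (if k \<in> S then t k else 0)"
proof -
  have fin: "finite S" using S finite_subset by blast
  have "hinner (\<Sum>i\<in>S. t i *s b i) (b k) = (\<Sum>i\<in>S. t i * (if i = k then 1 else 0))"
    unfolding hinner_sum_left hinner_smult_left
    by (rule sum.cong[OF refl]) (use b S k in \<open>auto simp: orthonormal_basis_def\<close>)
  also have "\<dots> = (if k \<in> S then t k else 0)" using fin by (simp add: sum.delta if_distrib cong: if_cong)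
  finally show ?thesis .
qed

lemma norm_orthonormal_sum:
  fixes b :: "nat \<Rightarrow> complex^'n"
  assumes b: "orthonormal_basis b" and S: "S \<subseteq> {1..CARD('n)}"
  shows "(norm (\<Sum>i\<in>S. t i *s b i))\<^sup>2 = (\<Sum>i\<in>S. (norm (t i))\<^sup>2)"
proof -
  define y where "y = (\<Sum>i\<in>S. t i *s b i)"
  have "complex_of_real ((norm y)\<^sup>2) = (\<Sum>i\<in>S. t i * hinner (b i) y)"
    unfolding hinner_self[symmetric] by (subst y_def) (simp add: hinner_sum_left hinner_smult_left)
  also have "\<dots> = (\<Sum>i\<in>S. of_real ((norm (t i))\<^sup>2))"
  proof (rule sum.cong[OF refl])
    fix i assume i: "i \<in> S"
    then have "hinner y (b i) = t i" unfolding y_def using hinner_orthonormal_sum[OF b S, of i t] S by auto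
    then have "hinner (b i) y = cnj (t i)" using hinner_commute[of "b i" y] by simp
    then show "t i * hinner (b i) y = of_real ((norm (t i))\<^sup>2)" by (simp only: complex_norm_square)
  qed
  finally have "complex_of_real ((norm y)\<^sup>2) = complex_of_real (\<Sum>i\<in>S. (norm (t i))\<^sup>2)" by simp
  then show ?thesis unfolding y_def by (simp only: of_real_eq_iff)
qed

lemma norm_orthonormal_basis:
  fixes b :: "nat \<Rightarrow> complex^'n"
  assumes "orthonormal_basis b" "k \<in> {1..CARD('n)}"
  shows "norm (b k) = 1"
proof -
  have "hinner (b k) (b k) = 1"
    using bspec[OF bspec[OF assms(1)[unfolded orthonormal_basis_def] assms(2)] assms(2)] by simp
  then have "(norm (b k))\<^sup>2 = 1\<^sup>2" by (simp only: hinner_self of_real_eq_1_iff power_one)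
  then show ?thesis by (rule power2_eq_imp_eq) auto
qed

lemma koranyi_dist_le:
  fixes b :: "complex^'n \<Rightarrow> nat \<Rightarrow> complex^'n"
  assumes b: "orthonormal_basis (b z)" and r: "0 < r"
    and y: "norm (hinner (y - z) (b z 1)) < r" "(norm (y - z))\<^sup>2 < r"
  shows "koranyi_dist b z y \<le> r"
proof -
  have "norm (y - z) < sqrt r" using y(2) by (simp add: real_less_rsqrt)
  then have mu: "norm (hinner (y - z) (b z i)) < sqrt r" if "i \<in> {1..CARD('n)}" for i
    using norm_hinner_le[of "y - z" "b z i"] norm_orthonormal_basis[OF b that] by simp
  have ins: "{1..CARD('n)} = insert 1 {2..CARD('n)}" by auto
  have "y - z = hinner (y - z) (b z 1) *s b z 1 + (\<Sum>i=2..CARD('n). hinner (y - z) (b z i) *s b z i)"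
    using orthonormal_expansion[OF b, of "y - z"] unfolding ins by simp
  then have e: "y = z + hinner (y - z) (b z 1) *s b z 1 + (\<Sum>i=2..CARD('n). hinner (y - z) (b z i) *s b z i)"
    by (simp only: add.assoc diff_eq_eq) (simp only: add_ac)
  have "y \<in> koranyi_ball b r z"
    unfolding koranyi_ball_def mem_Collect_eq
  proof (rule exI[of _ "hinner (y - z) (b z 1)"], rule exI[of _ "\<lambda>i. hinner (y - z) (b z i)"], intro conjI ballI)
    show "norm (hinner (y - z) (b z i)) < sqrt r" if "i \<in> {2..CARD('n)}" for i
      by (rule mu) (use that in auto)
  qed (rule e, rule y(1))
  then have m: "r \<in> {\<epsilon>. 0 < \<epsilon> \<and> y \<in> koranyi_ball b \<epsilon> z}" using r by simp
  have "bdd_below {\<epsilon>. 0 < \<epsilon> \<and> y \<in> koranyi_ball b \<epsilon> z}" by (rule bdd_belowI[of _ 0]) simp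
  then show ?thesis unfolding koranyi_dist_def by (rule cInf_lower[OF m])
qed

section \<open>Smooth strictly convex domains\<close>

lemma grad_has_derivative:
  fixes \<rho> :: "'a::euclidean_space \<Rightarrow> real"
  assumes "\<rho> differentiable (at z)"
  shows "(\<rho> has_derivative (\<lambda>h. h \<bullet> grad \<rho> z)) (at z)"
proof -
  obtain f' where f': "(\<rho> has_derivative f') (at z)" using assms by (auto simp: differentiable_def)
  interpret bounded_linear f' by (rule has_derivative_bounded_linear[OF f'])
  define d where "d = (\<Sum>b\<in>Basis. f' b *\<^sub>R b)"
  have "f' h = h \<bullet> d" for h
  proof -
    have "f' h = f' (\<Sum>b\<in>Basis. (h \<bullet> b) *\<^sub>R b)" by (simp only: euclidean_representation)
    also have "\<dots> = (\<Sum>b\<in>Basis. (h \<bullet> b) * f' b)" by (simp only: sum scaleR real_scaleR_def)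
    also have "\<dots> = h \<bullet> d" by (simp add: d_def inner_sum_right mult.commute)
    finally show ?thesis .
  qed
  then have "f' = (\<lambda>h. h \<bullet> d)" by auto
  then have d: "GDERIV \<rho> z :> d" using f' by (simp add: gderiv_def)
  have "grad \<rho> z = d" unfolding grad_def
  proof (rule the_equality, rule d)
    fix d' assume "GDERIV \<rho> z :> d'"
    then have "(\<lambda>h. h \<bullet> d') = (\<lambda>h. h \<bullet> d)"
      using d unfolding gderiv_def by (rule has_derivative_unique)
    then have "\<forall>h. h \<bullet> d' = h \<bullet> d" by (simp add: fun_eq_iff)
    then show "d' = d" by (simp only: vector_eq_ldot)
  qed
  then show ?thesis using d by (simp add: gderiv_def)
qed

lemma continuous_derivative_imp_lipschitz:
  fixes g :: "'a::euclidean_space \<Rightarrow> real"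
  assumes d: "g differentiable_on UNIV"
    and c: "\<And>v. continuous_on UNIV (\<lambda>x. frechet_derivative g (at x) v)"
    and K: "compact K" "convex K"
  shows "\<exists>L\<ge>0. \<forall>x\<in>K. \<forall>y\<in>K. norm (g x - g y) \<le> L * norm (x - y)"
proof -
  have "\<exists>B. \<forall>x\<in>K. norm (frechet_derivative g (at x) v) \<le> B" for v
  proof -
    have "compact ((\<lambda>x. frechet_derivative g (at x) v) ` K)"
      by (rule compact_continuous_image[OF continuous_on_subset[OF c] K(1)]) simp
    then have "bounded ((\<lambda>x. frechet_derivative g (at x) v) ` K)" by (rule compact_imp_bounded)
    then show ?thesis unfolding bounded_iff by blast
  qed
  then obtain B where B: "\<And>v x. x \<in> K \<Longrightarrow> norm (frechet_derivative g (at x) v) \<le> B v" by metis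
  define L where "L = (\<Sum>b\<in>Basis. \<bar>B b\<bar>)"
  have L0: "L \<ge> 0" by (simp add: L_def sum_nonneg)
  have hd: "(g has_derivative frechet_derivative g (at x)) (at x)" for x
    using d by (simp add: differentiable_on_def frechet_derivative_works)
  have on: "onorm (frechet_derivative g (at x)) \<le> L" if x: "x \<in> K" for x
  proof (rule onorm_bound[OF L0])
    fix h :: 'a
    interpret bounded_linear "frechet_derivative g (at x)" by (rule has_derivative_bounded_linear[OF hd])
    have "frechet_derivative g (at x) h = frechet_derivative g (at x) (\<Sum>b\<in>Basis. (h \<bullet> b) *\<^sub>R b)"
      by (simp only: euclidean_representation)
    also have "\<dots> = (\<Sum>b\<in>Basis. (h \<bullet> b) * frechet_derivative g (at x) b)" by (simp only: sum scaleR real_scaleR_def)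
    finally have "norm (frechet_derivative g (at x) h) \<le> (\<Sum>b\<in>Basis. norm ((h \<bullet> b) * frechet_derivative g (at x) b))"
      by (simp only: norm_sum)
    also have "\<dots> \<le> (\<Sum>b\<in>Basis. \<bar>B b\<bar> * norm h)"
    proof (rule sum_mono)
      fix b :: 'a assume b: "b \<in> Basis"
      have "norm ((h \<bullet> b) * frechet_derivative g (at x) b) = \<bar>h \<bullet> b\<bar> * norm (frechet_derivative g (at x) b)" by (simp add: abs_mult)
      also have "\<dots> \<le> norm h * \<bar>B b\<bar>"
        using Basis_le_norm[OF b, of h] B[OF x, of b] by (intro mult_mono) auto
      finally show "norm ((h \<bullet> b) * frechet_derivative g (at x) b) \<le> \<bar>B b\<bar> * norm h" by (simp add: mult.commute)
    qed
    also have "\<dots> = L * norm h" by (simp add: L_def sum_distrib_right)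
    finally show "norm (frechet_derivative g (at x) h) \<le> L * norm h" .
  qed
  show ?thesis
  proof (intro exI[of _ L] conjI ballI L0)
    fix x y assume "x \<in> K" "y \<in> K"
    then show "norm (g x - g y) \<le> L * norm (x - y)"
      by (intro differentiable_bound[OF K(2), of g "\<lambda>x. frechet_derivative g (at x)"] has_derivative_at_withinI[OF hd] on)
  qed
qed

lemma smooth_grad_lipschitz:
  fixes \<rho> :: "'a::euclidean_space \<Rightarrow> real"
  assumes s: "smooth \<rho>" and K: "compact K" "convex K"
  shows "\<exists>L\<ge>0. \<forall>x\<in>K. \<forall>y\<in>K. norm (grad \<rho> x - grad \<rho> y) \<le> L * norm (x - y)"
proof -
  have C2: "Ck (Suc (Suc 0)) \<rho>" using s by (simp add: smooth_def)
  have dr: "\<rho> differentiable (at z)" for z using C2 by (simp add: differentiable_on_def)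
  have fg: "frechet_derivative \<rho> (at z) v = v \<bullet> grad \<rho> z" for z v
    using fun_cong[OF frechet_derivative_at[OF grad_has_derivative[OF dr]], of v z] by (rule sym)
  have "\<exists>L\<ge>0. \<forall>x\<in>K. \<forall>y\<in>K. norm (v \<bullet> grad \<rho> x - v \<bullet> grad \<rho> y) \<le> L * norm (x - y)" for v
  proof -
    have "Ck (Suc 0) (\<lambda>x. frechet_derivative \<rho> (at x) v)" using C2 by simp
    then have "Ck (Suc 0) (\<lambda>x. v \<bullet> grad \<rho> x)" by (simp only: fg)
    then show ?thesis by (intro continuous_derivative_imp_lipschitz K) auto
  qed
  then obtain L where L: "\<And>v. L v \<ge> 0" "\<And>v x y. x \<in> K \<Longrightarrow> y \<in> K \<Longrightarrow> norm (v \<bullet> grad \<rho> x - v \<bullet> grad \<rho> y) \<le> L v * norm (x - y)"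
    by metis
  show ?thesis
  proof (intro exI[of _ "\<Sum>b\<in>Basis. L b"] conjI ballI sum_nonneg L(1))
    fix x y assume xy: "x \<in> K" "y \<in> K"
    have "norm (grad \<rho> x - grad \<rho> y) \<le> (\<Sum>b\<in>Basis. \<bar>(grad \<rho> x - grad \<rho> y) \<bullet> b\<bar>)" by (rule norm_le_l1)
    also have "\<dots> \<le> (\<Sum>b\<in>Basis. L b * norm (x - y))"
    proof (rule sum_mono)
      fix b :: 'a
      show "\<bar>(grad \<rho> x - grad \<rho> y) \<bullet> b\<bar> \<le> L b * norm (x - y)"
        using L(2)[OF xy, of b] by (simp add: inner_diff_left inner_diff_right inner_commute)
    qed
    finally show "norm (grad \<rho> x - grad \<rho> y) \<le> (\<Sum>b\<in>Basis. L b) * norm (x - y)" by (simp add: sum_distrib_right)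
  qed
qed

lemma smooth_upper_taylor:
  fixes \<rho> :: "'a::euclidean_space \<Rightarrow> real"
  assumes s: "smooth \<rho>" and K: "convex K"
    and L: "\<And>x y. x \<in> K \<Longrightarrow> y \<in> K \<Longrightarrow> norm (grad \<rho> x - grad \<rho> y) \<le> L * norm (x - y)"
    and x: "x \<in> K" "x + y \<in> K" and L0: "L \<ge> 0"
  shows "\<rho> (x + y) \<le> \<rho> x + y \<bullet> grad \<rho> x + L * (norm y)\<^sup>2"
proof -
  have C2: "Ck (Suc (Suc 0)) \<rho>" using s by (simp add: smooth_def)
  have hd: "(\<rho> has_derivative (\<lambda>h. h \<bullet> grad \<rho> z)) (at z)" for z
    by (rule grad_has_derivative) (use C2 in \<open>simp add: differentiable_on_def\<close>)
  define g where "g t = \<rho> (x + t *\<^sub>R y)" for t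
  have gd: "(g has_derivative (\<lambda>h. (h *\<^sub>R y) \<bullet> grad \<rho> (x + t *\<^sub>R y))) (at t within {0..1})" for t
  proof -
    have "((\<lambda>t. x + t *\<^sub>R y) has_derivative (\<lambda>h. h *\<^sub>R y)) (at t within {0..1})"
      by (auto intro!: derivative_eq_intros)
    from has_derivative_compose[OF this hd] show ?thesis unfolding g_def .
  qed
  obtain t where t: "t \<in> {0<..<1}" "g 1 - g 0 = ((1 - 0) *\<^sub>R y) \<bullet> grad \<rho> (x + t *\<^sub>R y)"
    using mvt_simple[of 0 1 g "\<lambda>t h. (h *\<^sub>R y) \<bullet> grad \<rho> (x + t *\<^sub>R y)"] gd by auto
  have "x + t *\<^sub>R y = (1 - t) *\<^sub>R x + t *\<^sub>R (x + y)" by (simp add: algebra_simps)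
  then have inK: "x + t *\<^sub>R y \<in> K" using convexD[OF K x, of "1 - t" t] t(1) by simp
  have "\<rho> (x + y) - \<rho> x = y \<bullet> grad \<rho> x + y \<bullet> (grad \<rho> (x + t *\<^sub>R y) - grad \<rho> x)"
    using t(2) by (simp add: g_def inner_diff_right)
  also have "y \<bullet> (grad \<rho> (x + t *\<^sub>R y) - grad \<rho> x) \<le> norm y * norm (grad \<rho> (x + t *\<^sub>R y) - grad \<rho> x)"
    by (rule norm_cauchy_schwarz)
  also have "\<dots> \<le> norm y * (L * norm y)"
  proof (rule mult_left_mono)
    have "norm (grad \<rho> (x + t *\<^sub>R y) - grad \<rho> x) \<le> L * norm (t *\<^sub>R y)" using L[OF inK x(1)] by simp
    also have "\<dots> \<le> L * norm y" using t(1) L0 by (intro mult_left_mono) (auto simp: mult_left_le_one_le)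
    finally show "norm (grad \<rho> (x + t *\<^sub>R y) - grad \<rho> x) \<le> L * norm y" .
  qed simp
  finally show ?thesis by (simp add: power2_eq_square algebra_simps)
qed

lemma strictly_convex_le:
  assumes "strictly_convex \<rho>" "0 \<le> t" "t \<le> 1"
  shows "\<rho> ((1 - t) *\<^sub>R x + t *\<^sub>R y) \<le> (1 - t) * \<rho> x + t * \<rho> y"
proof (cases "x = y \<or> t = 0 \<or> t = 1")
  case True
  then show ?thesis by (auto simp: algebra_simps)
next
  case False
  then show ?thesis using assms unfolding strictly_convex_def by (simp add: less_imp_le)
qed

lemma convex_sublevel: "strictly_convex \<rho> \<Longrightarrow> convex (sublevel \<rho> r)"
  unfolding convex_alt sublevel_def
proof safe
  fix x y u assume s: "strictly_convex \<rho>" and h: "\<rho> x < r" "\<rho> y < r" and u: "0 \<le> (u::real)" "u \<le> 1"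
  have "\<rho> ((1 - u) *\<^sub>R x + u *\<^sub>R y) \<le> (1 - u) * \<rho> x + u * \<rho> y" by (rule strictly_convex_le[OF s u])
  also have "\<dots> < r"
  proof (cases "u = 0")
    case False
    then have "u * \<rho> y < u * r" using h u by simp
    moreover have "(1 - u) * \<rho> x \<le> (1 - u) * r" using h u by (intro mult_left_mono) auto
    ultimately show ?thesis by (simp add: algebra_simps)
  qed (use h in simp)
  finally show "\<rho> ((1 - u) *\<^sub>R x + u *\<^sub>R y) < r" .
qed

lemma normalize_lipschitz:
  fixes u v :: "'a::real_inner"
  assumes "norm u \<ge> m" "m > 0" "v \<noteq> 0"
  shows "norm (u /\<^sub>R norm u - v /\<^sub>R norm v) \<le> 2 / m * norm (u - v)"
proof -
  have u: "norm u > 0" using assms by linarith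
  have "u /\<^sub>R norm u - v /\<^sub>R norm v = (1 / norm u) *\<^sub>R ((u - v) + (norm v - norm u) *\<^sub>R (v /\<^sub>R norm v))"
    using u assms(3) by (simp add: algebra_simps divide_inverse)
  then have "norm (u /\<^sub>R norm u - v /\<^sub>R norm v) = (1 / norm u) * norm ((u - v) + (norm v - norm u) *\<^sub>R (v /\<^sub>R norm v))"
    using u by simp
  also have "\<dots> \<le> (1 / norm u) * (2 * norm (u - v))"
  proof (rule mult_left_mono)
    have "norm ((norm v - norm u) *\<^sub>R (v /\<^sub>R norm v)) \<le> norm (u - v)"
    proof -
      have 1: "norm (v /\<^sub>R norm v) = 1" using assms(3) by simp
      have "norm ((norm v - norm u) *\<^sub>R (v /\<^sub>R norm v)) = \<bar>norm v - norm u\<bar>"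
        unfolding norm_scaleR[of "norm v - norm u"] 1 by simp
      also have "\<dots> \<le> norm (v - u)" by (rule norm_triangle_ineq3)
      finally show ?thesis by (simp add: norm_minus_commute)
    qed
    then show "norm ((u - v) + (norm v - norm u) *\<^sub>R (v /\<^sub>R norm v)) \<le> 2 * norm (u - v)"
      using norm_triangle_ineq[of "u - v" "(norm v - norm u) *\<^sub>R (v /\<^sub>R norm v)"] by linarith
  qed (use u in simp)
  also have "\<dots> \<le> (1 / m) * (2 * norm (u - v))"
    using assms u by (intro mult_right_mono divide_left_mono) auto
  finally show ?thesis by simp
qed

lemma smooth_continuous:
  fixes \<rho> :: "'a::euclidean_space \<Rightarrow> real"
  assumes "smooth \<rho>" shows "continuous_on UNIV \<rho>"
proof -
  have "Ck 0 \<rho>" using assms by (simp add: smooth_def)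
  then show ?thesis by simp
qed

text \<open>For \<open>y\<close> in the slab, the linear and the quadratic term of the Taylor expansion of \<open>\<rho>\<close> at \<open>\<zeta>\<close> are both
  bounded by a small multiple of \<open>\<bar>\<rho> \<zeta>\<bar>\<close> along the whole disc spanned by \<open>y\<close>. At points with vanishing
  gradient the linear term vanishes, so the constant is uniform on \<open>D\<close>.\<close>
lemma slab_subset_disc_body:
  fixes \<rho> :: "complex^'n \<Rightarrow> real"
  assumes s: "smooth \<rho>" and D: "D = sublevel \<rho> 0" "bounded D"
  shows "\<exists>a>0. a \<le> 1 \<and> (\<forall>\<zeta>\<in>D. \<forall>y. norm (hinner y (unit_normal \<rho> \<zeta>)) \<le> a * \<bar>\<rho> \<zeta>\<bar> \<longrightarrow>
     (norm y)\<^sup>2 \<le> a * \<bar>\<rho> \<zeta>\<bar> \<longrightarrow> y \<in> disc_body D \<zeta> 1)"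
proof -
  obtain R where R: "R > 0" "\<And>x. x \<in> D \<Longrightarrow> norm x \<le> R" using D(2) bounded_pos by metis
  define K where "K = cball (0 :: complex^'n) (R + 1)"
  have K: "compact K" "convex K" "0 \<in> K" using R by (auto simp: K_def)
  obtain L where L: "L \<ge> 0" "\<And>x y. x \<in> K \<Longrightarrow> y \<in> K \<Longrightarrow> norm (grad \<rho> x - grad \<rho> y) \<le> L * norm (x - y)"
    using smooth_grad_lipschitz[OF s K(1,2)] by metis
  define A where "A = norm (grad \<rho> 0) + L * (R + 1)"
  have A0: "A \<ge> 0" using L(1) R by (simp add: A_def)
  have gA: "norm (grad \<rho> x) \<le> A" if "x \<in> K" for x
  proof -
    have "norm (grad \<rho> x - grad \<rho> 0) \<le> L * norm (x - 0)" by (rule L(2)[OF that K(3)])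
    also have "\<dots> \<le> L * (R + 1)" using that L(1) by (intro mult_left_mono) (auto simp: K_def)
    finally show ?thesis using norm_triangle_ineq2[of "grad \<rho> x" "grad \<rho> 0"] by (simp add: A_def)
  qed
  have "compact (\<rho> ` K)" by (rule compact_continuous_image[OF continuous_on_subset[OF smooth_continuous[OF s]] K(1)]) simp
  then have "bounded (\<rho> ` K)" by (rule compact_imp_bounded)
  then obtain M where M: "M > 0" "\<And>x. x \<in> K \<Longrightarrow> \<bar>\<rho> x\<bar> \<le> M" unfolding bounded_pos by auto
  define a where "a = 1 / (2 * (A + L + M + 1))"
  have pos: "A + L + M + 1 > 0" using A0 L(1) M(1) by linarith
  have a: "a > 0" "a \<le> 1" "a * (A + L) \<le> 1 / 2" "a * M \<le> 1"
    using A0 L(1) M(1) pos by (auto simp: a_def field_simps)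
  show ?thesis
  proof (rule exI[of _ a], intro conjI ballI allI impI a(1,2))
    fix \<zeta> y assume z: "\<zeta> \<in> D" and h1: "norm (hinner y (unit_normal \<rho> \<zeta>)) \<le> a * \<bar>\<rho> \<zeta>\<bar>"
      and h2: "(norm y)\<^sup>2 \<le> a * \<bar>\<rho> \<zeta>\<bar>"
    have zK: "\<zeta> \<in> K" using R(2)[OF z] by (simp add: K_def)
    have neg: "\<rho> \<zeta> < 0" using z by (simp add: D(1) sublevel_def)
    show "y \<in> disc_body D \<zeta> 1"
      unfolding disc_body_def mem_Collect_eq
    proof (intro allI impI)
      fix t :: complex assume "norm t \<le> 1 / 1"
      then have t: "norm t \<le> 1" by simp
      define u where "u = t *s y"
      have nu: "norm u \<le> norm y" unfolding u_def norm_vector_scalar_mult using t by (intro mult_left_le_one_le) auto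
      then have u2: "(norm u)\<^sup>2 \<le> a * \<bar>\<rho> \<zeta>\<bar>" using h2 power_mono[OF nu norm_ge_zero, of 2] by linarith
      have "a * \<bar>\<rho> \<zeta>\<bar> \<le> a * M" using M(2)[OF zK] a(1) by (intro mult_left_mono) auto
      then have "(norm u)\<^sup>2 \<le> 1" using u2 a(4) by linarith
      then have "norm u \<le> 1" by (simp add: power_le_one_iff)
      then have uK: "\<zeta> + u \<in> K" using R(2)[OF z] norm_triangle_ineq[of \<zeta> u] by (simp add: K_def)
      have "grad \<rho> \<zeta> = norm (grad \<rho> \<zeta>) *\<^sub>R unit_normal \<rho> \<zeta>"
        by (cases "grad \<rho> \<zeta> = 0") (simp_all add: unit_normal_def)
      then have "u \<bullet> grad \<rho> \<zeta> = norm (grad \<rho> \<zeta>) * (u \<bullet> unit_normal \<rho> \<zeta>)" by (metis inner_scaleR_right)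
      also have "\<dots> \<le> norm (grad \<rho> \<zeta>) * (a * \<bar>\<rho> \<zeta>\<bar>)"
      proof (rule mult_left_mono)
        have "u \<bullet> unit_normal \<rho> \<zeta> \<le> norm (hinner u (unit_normal \<rho> \<zeta>))"
          unfolding Re_hinner[symmetric] by (rule complex_Re_le_cmod)
        also have "\<dots> = norm t * norm (hinner y (unit_normal \<rho> \<zeta>))" by (simp add: u_def hinner_smult_left norm_mult)
        also have "\<dots> \<le> norm (hinner y (unit_normal \<rho> \<zeta>))" using t by (intro mult_left_le_one_le) auto
        finally show "u \<bullet> unit_normal \<rho> \<zeta> \<le> a * \<bar>\<rho> \<zeta>\<bar>" using h1 by linarith
      qed simp
      also have "\<dots> \<le> A * (a * \<bar>\<rho> \<zeta>\<bar>)" using gA[OF zK] a(1) by (intro mult_right_mono) auto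
      finally have g: "u \<bullet> grad \<rho> \<zeta> \<le> A * (a * \<bar>\<rho> \<zeta>\<bar>)" .
      have "\<rho> (\<zeta> + u) \<le> \<rho> \<zeta> + u \<bullet> grad \<rho> \<zeta> + L * (norm u)\<^sup>2"
        by (rule smooth_upper_taylor[OF s K(2) L(2) zK uK L(1)])
      also have "\<dots> \<le> \<rho> \<zeta> + A * (a * \<bar>\<rho> \<zeta>\<bar>) + L * (a * \<bar>\<rho> \<zeta>\<bar>)"
        using g mult_left_mono[OF u2 L(1)] by linarith
      also have "\<dots> = \<rho> \<zeta> + (a * (A + L)) * \<bar>\<rho> \<zeta>\<bar>" by (simp add: algebra_simps)
      also have "\<dots> \<le> \<rho> \<zeta> + (1 / 2) * \<bar>\<rho> \<zeta>\<bar>" using a(3) by (intro add_left_mono mult_right_mono) auto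
      also have "\<dots> < 0" using neg by simp
      finally show "\<zeta> + t *s y \<in> D" by (simp add: D(1) sublevel_def u_def)
    qed
  qed
qed

lemma frontier_sublevel:
  assumes "continuous_on UNIV \<rho>" "x \<in> frontier (sublevel \<rho> r)"
  shows "\<rho> x = (r :: real)"
proof -
  have "open (sublevel \<rho> r)" unfolding sublevel_def by (intro open_Collect_less assms continuous_on_const)
  then have "x \<notin> sublevel \<rho> r" using assms(2) by (simp add: frontier_def interior_open)
  moreover have "closed {x. \<rho> x \<le> r}" by (intro closed_Collect_le assms continuous_on_const)
  then have "closure (sublevel \<rho> r) \<subseteq> {x. \<rho> x \<le> r}"
    by (intro closure_minimal) (auto simp: sublevel_def)
  then have "\<rho> x \<le> r" using assms(2) by (auto simp: frontier_def)
  ultimately show ?thesis by (simp add: sublevel_def)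
qed

text \<open>Outside a neighbourhood of the boundary \<open>\<rho>\<close> is bounded away from \<open>0\<close> by compactness. Hence a collar
  \<open>{- e < \<rho>} \<inter> D\<close> stays where the gradient is nonzero, and there its norm has a positive lower bound.\<close>
lemma unit_normal_lipschitz_collar:
  fixes \<rho> :: "complex^'n \<Rightarrow> real"
  assumes s: "smooth \<rho>" and D: "D = sublevel \<rho> 0" "bounded D"
    and g: "\<exists>V. open V \<and> frontier D \<subseteq> V \<and> (\<forall>z\<in>V. grad \<rho> z \<noteq> 0)"
  shows "\<exists>e>0. \<exists>L\<ge>0. (\<forall>\<zeta>\<in>D. - e < \<rho> \<zeta> \<longrightarrow> grad \<rho> \<zeta> \<noteq> 0) \<and>
     (\<forall>\<zeta>\<in>D. \<forall>\<xi>\<in>D. - e < \<rho> \<zeta> \<longrightarrow> - e < \<rho> \<xi> \<longrightarrow>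
        norm (unit_normal \<rho> \<zeta> - unit_normal \<rho> \<xi>) \<le> L * norm (\<zeta> - \<xi>))"
proof -
  note c = smooth_continuous[OF s]
  obtain V where V: "open V" "frontier D \<subseteq> V" "\<And>z. z \<in> V \<Longrightarrow> grad \<rho> z \<noteq> 0" using g by metis
  have oD: "open D" unfolding D(1) sublevel_def by (intro open_Collect_less c continuous_on_const)
  have cD: "compact (closure D)" using D(2) by (simp add: compact_closure)
  have clD: "closure D = D \<union> frontier D" using oD by (simp add: closure_Un_frontier)
  define C0 where "C0 = closure D - V"
  have C0: "compact C0" unfolding C0_def by (rule compact_diff[OF cD V(1)])
  have "C0 \<subseteq> D" using clD V(2) by (auto simp: C0_def)
  have "\<exists>e>0. \<forall>x\<in>C0. \<rho> x \<le> - e"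
  proof (cases "C0 = {}")
    case False
    then obtain x0 where x0: "x0 \<in> C0" "\<And>x. x \<in> C0 \<Longrightarrow> \<rho> x \<le> \<rho> x0"
      using continuous_attains_sup[OF C0 False continuous_on_subset[OF c]] by auto
    have "\<rho> x0 < 0" using x0(1) \<open>C0 \<subseteq> D\<close> by (auto simp: D(1) sublevel_def)
    then show ?thesis using x0(2) by (intro exI[of _ "- \<rho> x0"]) auto
  qed (auto intro: exI[of _ 1])
  then obtain e' where e': "e' > 0" "\<And>x. x \<in> C0 \<Longrightarrow> \<rho> x \<le> - e'" by blast
  define e where "e = e' / 2"
  define C1 where "C1 = closure D \<inter> {x. - e \<le> \<rho> x}"
  have "closed {x. - e \<le> \<rho> x}" by (intro closed_Collect_le c continuous_on_const)
  then have C1: "compact C1" unfolding C1_def by (rule compact_Int_closed[OF cD])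
  have C1V: "x \<in> V" if "x \<in> C1" for x
  proof (rule ccontr)
    assume "x \<notin> V"
    then have "\<rho> x \<le> - e'" using that e'(2)[of x] by (simp add: C0_def C1_def)
    then show False using that e'(1) by (simp add: C1_def e_def)
  qed
  obtain R where R: "R > 0" "\<And>x. x \<in> closure D \<Longrightarrow> norm x \<le> R"
    using compact_imp_bounded[OF cD] bounded_pos by metis
  obtain L where L: "L \<ge> 0" "\<forall>x\<in>cball 0 R. \<forall>y\<in>cball 0 R. norm (grad \<rho> x - grad \<rho> y) \<le> L * norm (x - y)"
    using smooth_grad_lipschitz[OF s compact_cball convex_cball, of 0 R] by metis
  have LC: "norm (grad \<rho> x - grad \<rho> y) \<le> L * norm (x - y)" if "x \<in> closure D" "y \<in> closure D" for x y
    using L(2) R(2)[OF that(1)] R(2)[OF that(2)] by simp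
  have gc: "continuous_on C1 (\<lambda>x. norm (grad \<rho> x))"
  proof (rule continuous_on_norm, rule lipschitz_on_continuous_on)
    show "L-lipschitz_on C1 (grad \<rho>)"
      by (rule lipschitz_onI[OF _ L(1)]) (use LC in \<open>auto simp: C1_def dist_norm\<close>)
  qed
  have "\<exists>m>0. \<forall>x\<in>C1. m \<le> norm (grad \<rho> x)"
  proof (cases "C1 = {}")
    case False
    then obtain x0 where x0: "x0 \<in> C1" "\<And>x. x \<in> C1 \<Longrightarrow> norm (grad \<rho> x0) \<le> norm (grad \<rho> x)"
      using continuous_attains_inf[OF C1 False gc] by auto
    then show ?thesis using V(3)[OF C1V[OF x0(1)]] by (intro exI[of _ "norm (grad \<rho> x0)"]) auto
  qed (auto intro: exI[of _ 1])
  then obtain m where m: "m > 0" "\<And>x. x \<in> C1 \<Longrightarrow> m \<le> norm (grad \<rho> x)" by blast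
  have inC1: "\<zeta> \<in> C1" if "\<zeta> \<in> D" "- e < \<rho> \<zeta>" for \<zeta>
    using that closure_subset[of D] by (auto simp: C1_def)
  have nz: "grad \<rho> \<zeta> \<noteq> 0" if "\<zeta> \<in> D" "- e < \<rho> \<zeta>" for \<zeta>
    using m(1) m(2)[OF inC1[OF that]] by auto
  show ?thesis
  proof (rule exI[of _ e], intro conjI exI[of _ "2 / m * L"] ballI impI nz)
    show "e > 0" using e'(1) by (simp add: e_def)
    show "2 / m * L \<ge> 0" using m(1) L(1) by simp
    fix \<zeta> \<xi> assume z: "\<zeta> \<in> D" "\<xi> \<in> D" "- e < \<rho> \<zeta>" "- e < \<rho> \<xi>"
    have "norm (unit_normal \<rho> \<zeta> - unit_normal \<rho> \<xi>) \<le> 2 / m * norm (grad \<rho> \<zeta> - grad \<rho> \<xi>)"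
      unfolding unit_normal_def by (rule normalize_lipschitz[OF m(2)[OF inC1[OF z(1,3)]] m(1) nz[OF z(2,4)]])
    also have "\<dots> \<le> 2 / m * (L * norm (\<zeta> - \<xi>))"
      using LC z(1,2) closure_subset[of D] m(1) by (intro mult_left_mono LC) auto
    finally show "norm (unit_normal \<rho> \<zeta> - unit_normal \<rho> \<xi>) \<le> 2 / m * L * norm (\<zeta> - \<xi>)" by simp
  qed
qed

section \<open>Bounded overlap of the bodies\<close>

lemma disc_body_fmeasurable:
  assumes D: "open D" "bounded D" and t: "0 < \<theta>"
  shows "disc_body D (z :: complex^'n) \<theta> \<in> fmeasurable lborel"
proof -
  obtain R where R: "\<And>x. x \<in> D \<Longrightarrow> norm x \<le> R" using D(2) unfolding bounded_iff by blast
  have "disc_body D z \<theta> \<subseteq> cball 0 (\<theta> * (R + norm z))"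
  proof
    fix y assume y: "y \<in> disc_body D z \<theta>"
    have "z + of_real (1 / \<theta>) *s y \<in> D" by (rule disc_body_memD[OF y]) (use t in \<open>simp add: norm_divide\<close>)
    then have "norm (z + of_real (1 / \<theta>) *s y) \<le> R" by (rule R)
    then have "norm (of_real (1 / \<theta>) *s y) \<le> R + norm z"
      using norm_triangle_ineq4[of "z + of_real (1 / \<theta>) *s y" z] by simp
    then have "norm y / \<theta> \<le> R + norm z" using t by (simp add: norm_vector_scalar_mult norm_divide)
    then show "y \<in> cball 0 (\<theta> * (R + norm z))" using t by (simp add: field_simps)
  qed
  then have "bounded (disc_body D z \<theta>)" by (rule bounded_subset[OF bounded_cball])
  then have "emeasure lborel (disc_body D z \<theta>) < \<infinity>" by (rule emeasure_bounded_finite)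
  then show ?thesis using open_disc_body[OF D(1) t] by (intro fmeasurableI) auto
qed

lemma measure_disc_body_pos:
  assumes D: "open D" "bounded D" "z \<in> D"
  shows "measure lborel (disc_body D (z :: complex^'n) 1) > 0"
proof -
  have "0 \<in> disc_body D z 1" using D(3) by (simp add: disc_body_def)
  then obtain e where e: "e > 0" "ball 0 e \<subseteq> disc_body D z 1"
    by (rule openE[OF open_disc_body[OF D(1) zero_less_one]])
  have "0 < measure lborel (ball (0 :: complex^'n) e)" using e(1) by simp
  also have "\<dots> \<le> measure lborel (disc_body D z 1)"
    by (rule measure_mono_fmeasurable[OF e(2) _ disc_body_fmeasurable[OF D(1,2)]]) auto
  finally show ?thesis .
qed

lemma measure_disc_body_scale:
  assumes D: "open D" "bounded D" and t: "0 < \<theta>"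
  shows "measure lborel (disc_body D (z :: complex^'n) \<theta>) = \<theta> ^ (2 * CARD('n)) * measure lborel (disc_body D z 1)"
proof -
  have "ennreal (measure lborel (disc_body D z \<theta>)) = ennreal (\<theta> ^ (2 * CARD('n)) * measure lborel (disc_body D z 1))"
    using emeasure_disc_body_scale[OF D(1) t, of z] t
      emeasure_eq_measure2[OF disc_body_fmeasurable[OF D t, of z]]
      emeasure_eq_measure2[OF disc_body_fmeasurable[OF D zero_less_one, of z]]
    by (simp add: ennreal_mult)
  then show ?thesis using t by (subst (asm) ennreal_inj) auto
qed

text \<open>Let \<open>x\<close> lie in \<open>z j + 3/4\<close> times the body of \<open>z j\<close>. Recentring shows that the body of \<open>z j\<close> has
  at least \<open>(4/7)\<^sup>2\<^sup>n\<close> times the volume of the body of \<open>x\<close>, and that the slab at \<open>z j\<close> lies in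
  \<open>x + 7\<close> times the body of \<open>x\<close>. The slabs of one level are disjoint, so for each level the sum of
  \<open>r j ^ (n + 1)\<close> is at most a constant times the volume of the body of \<open>x\<close>, and \<open>K0\<close> bounds the
  number of levels.\<close>
lemma bounded_overlap:
  fixes z \<eta> :: "nat \<Rightarrow> complex^'n" and lev :: "nat \<Rightarrow> nat"
  defines "S \<equiv> \<lambda>\<eta> a. {y :: complex^'n. norm (hinner y \<eta>) < a \<and> (norm y)\<^sup>2 < (a :: real)}"
  assumes D: "open D" "bounded D" "convex D"
    and cs: "cs > 0" "\<And>\<eta> a. norm \<eta> = 1 \<Longrightarrow> 0 < a \<Longrightarrow> a \<le> 1 \<Longrightarrow> ennreal (cs * a ^ (CARD('n) + 1)) \<le> emeasure lborel (S \<eta> a)"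
    and z: "\<And>j. z j \<in> D" and r: "\<And>j. 0 < r j" and a: "0 < a" "\<And>j. a * r j \<le> 1"
    and \<eta>: "\<And>j. norm (\<eta> j) = 1"
    and slab: "\<And>j. S (\<eta> j) (a * r j) \<subseteq> disc_body D (z j) 1"
    and disj: "\<And>i j. i \<noteq> j \<Longrightarrow> lev i = lev j \<Longrightarrow> (+) (z i) ` S (\<eta> i) (a * r i) \<inter> (+) (z j) ` S (\<eta> j) (a * r j) = {}"
    and lev: "\<And>F. finite F \<Longrightarrow> (\<And>j. j \<in> F \<Longrightarrow> x - z j \<in> disc_body D (z j) (3/4)) \<Longrightarrow> card (lev ` F) \<le> K0"
    and x: "x \<in> D"
  shows "(\<Sum>j. indicator (disc_body D (z j) (3/4)) (x - z j) * ennreal (r j ^ (CARD('n) + 1) / measure lborel (disc_body D (z j) 1)))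
     \<le> ennreal ((7/4) ^ (2 * CARD('n)) * 7 ^ (2 * CARD('n)) * real K0 / (cs * a ^ (CARD('n) + 1)))"
proof -
  define n where "n = CARD('n)"
  define v where "v y = measure lborel (disc_body D y 1)" for y
  have vpos: "v y > 0" if "y \<in> D" for y unfolding v_def by (rule measure_disc_body_pos[OF D(1,2) that])
  define Q where "Q j = (+) (z j) ` S (\<eta> j) (a * r j)" for j
  define X where "X = (+) x ` disc_body D x 7"
  have oS: "open (S \<eta> b)" for \<eta> b
    unfolding S_def hinner_def by (intro open_Collect_conj open_Collect_less continuous_intros)
  have oX: "open X" unfolding X_def by (intro open_translation open_disc_body D(1)) simp
  have oQ: "open (Q j)" for j unfolding Q_def by (intro open_translation oS)
  have eX: "emeasure lborel X = ennreal (7 ^ (2 * n) * v x)"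
    unfolding X_def v_def n_def
    by (subst emeasure_lborel_translation[OF open_disc_body[OF D(1)]], simp, subst emeasure_disc_body_scale[OF D(1)], simp)
       (simp add: emeasure_eq_measure2[OF disc_body_fmeasurable[OF D(1,2)]] ennreal_mult)
  have eQ: "ennreal (cs * (a * r j) ^ (n + 1)) \<le> emeasure lborel (Q j)" for j
    unfolding Q_def emeasure_lborel_translation[OF oS] n_def by (rule cs(2)[OF \<eta>]) (use a r in auto)
  define C where "C = (7/4) ^ (2 * n) * 7 ^ (2 * n) * real K0 / (cs * a ^ (n + 1))"
  have fin: "(\<Sum>j\<in>F. r j ^ (n + 1) / v (z j)) \<le> C"
    if F: "finite F" "\<And>j. j \<in> F \<Longrightarrow> x - z j \<in> disc_body D (z j) (3/4)" for F
  proof -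
    have vle: "v x \<le> (7/4) ^ (2 * n) * v (z j)" if j: "j \<in> F" for j
    proof -
      have sub: "disc_body D x 1 \<subseteq> disc_body D (z j) (7/4)"
      proof
        fix u assume "u \<in> disc_body D x 1"
        then have "u \<in> disc_body D (z j + (x - z j)) 1" by simp
        from disc_body_recenter[OF D(3) F(2)[OF j] _ this] show "u \<in> disc_body D (z j) (7/4)" by simp
      qed
      have "v x \<le> measure lborel (disc_body D (z j) (7/4))"
        unfolding v_def
        by (rule measure_mono_fmeasurable[OF sub _ disc_body_fmeasurable[OF D(1,2)]])
           (use open_disc_body[OF D(1), of 1 x] in auto)
      then show ?thesis unfolding v_def n_def by (subst (asm) measure_disc_body_scale[OF D(1,2)]) auto
    qed
    have QX: "Q j \<subseteq> X" if j: "j \<in> F" for j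
    proof
      fix w assume "w \<in> Q j"
      then obtain y where y: "w = z j + y" "y \<in> S (\<eta> j) (a * r j)" by (auto simp: Q_def)
      have 1: "y \<in> disc_body D (z j) 1" using slab y(2) by blast
      have 2: "(-1) *s (x - z j) \<in> disc_body D (z j) (1 * (3/4))"
        by (rule disc_body_smult[OF F(2)[OF j]]) auto
      \<comment> \<open>Recentring from \<open>z j\<close> to \<open>x\<close> turns the dilation \<open>7/4\<close> into \<open>(7/4) / (1 - 3/4) = 7\<close>.\<close>
      have "y + (-1) *s (x - z j) \<in> disc_body D (z j) (1 + 1 * (3/4))"
        by (rule disc_body_add[OF D(3) 1 _ 2]) auto
      from disc_body_recenter'[OF D(3) F(2)[OF j] _ _ this]
      have "y + (-1) *s (x - z j) \<in> disc_body D x 7" by simp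
      moreover have "w = x + (y + (-1) *s (x - z j))" by (simp add: y(1) vec_eq_iff)
      ultimately show "w \<in> X" unfolding X_def by (rule rev_image_eqI)
    qed
    have "(\<Sum>j\<in>F. ennreal (cs * (a * r j) ^ (n + 1))) \<le> (\<Sum>j\<in>F. emeasure lborel (Q j))"
      by (rule sum_mono) (rule eQ)
    also have "\<dots> = (\<Sum>k\<in>lev ` F. \<Sum>j\<in>{j \<in> F. lev j = k}. emeasure lborel (Q j))"
      by (rule sum.image_gen[OF F(1)])
    also have "\<dots> \<le> (\<Sum>k\<in>lev ` F. emeasure lborel X)"
    proof (rule sum_mono)
      fix k
      have "disjoint_family_on Q {j \<in> F. lev j = k}"
        unfolding disjoint_family_on_def Q_def using disj by auto
      then have "(\<Sum>j\<in>{j \<in> F. lev j = k}. emeasure lborel (Q j)) = emeasure lborel (\<Union>j\<in>{j \<in> F. lev j = k}. Q j)"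
        using F(1) oQ by (intro sum_emeasure) auto
      also have "\<dots> \<le> emeasure lborel X"
        using oX QX by (intro emeasure_mono) auto
      finally show "(\<Sum>j\<in>{j \<in> F. lev j = k}. emeasure lborel (Q j)) \<le> emeasure lborel X" .
    qed
    also have "\<dots> = of_nat (card (lev ` F)) * ennreal (7 ^ (2 * n) * v x)" by (simp add: eX)
    also have "\<dots> \<le> of_nat K0 * ennreal (7 ^ (2 * n) * v x)"
      by (rule mult_right_mono) (use lev[OF F] in auto)
    also have "\<dots> = ennreal (real K0 * (7 ^ (2 * n) * v x))"
      using vpos[OF x] by (simp add: ennreal_mult ennreal_of_nat_eq_real_of_nat)
    also have "(\<Sum>j\<in>F. ennreal (cs * (a * r j) ^ (n + 1))) = ennreal (\<Sum>j\<in>F. cs * (a * r j) ^ (n + 1))"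
      by (rule sum_ennreal) (use cs(1) a(1) r in \<open>auto simp: less_imp_le\<close>)
    finally have "(\<Sum>j\<in>F. cs * (a * r j) ^ (n + 1)) \<le> real K0 * (7 ^ (2 * n) * v x)"
      using vpos[OF x] by (subst (asm) ennreal_le_iff) auto
    then have "(cs * a ^ (n + 1)) * (\<Sum>j\<in>F. r j ^ (n + 1)) \<le> real K0 * (7 ^ (2 * n) * v x)"
      by (simp add: power_mult_distrib sum_distrib_left mult.assoc del: power_Suc)
    then have s1: "(\<Sum>j\<in>F. r j ^ (n + 1)) \<le> real K0 * (7 ^ (2 * n) * v x) / (cs * a ^ (n + 1))"
      using cs(1) a(1) by (subst pos_le_divide_eq) (auto simp: mult.commute)
    have "(\<Sum>j\<in>F. r j ^ (n + 1) / v (z j)) \<le> (\<Sum>j\<in>F. r j ^ (n + 1) * ((7/4) ^ (2 * n) / v x))"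
    proof (rule sum_mono)
      fix j assume j: "j \<in> F"
      have "1 / v (z j) \<le> (7/4) ^ (2 * n) / v x"
        using vle[OF j] vpos[OF x] vpos[OF z[of j]] by (simp add: divide_simps mult.commute)
      then have "r j ^ (n + 1) * (1 / v (z j)) \<le> r j ^ (n + 1) * ((7/4) ^ (2 * n) / v x)"
        by (rule mult_left_mono) (use less_imp_le[OF r] in simp)
      then show "r j ^ (n + 1) / v (z j) \<le> r j ^ (n + 1) * ((7/4) ^ (2 * n) / v x)" by simp
    qed
    also have "\<dots> = (\<Sum>j\<in>F. r j ^ (n + 1)) * ((7/4) ^ (2 * n) / v x)" by (simp only: sum_distrib_right)
    also have "\<dots> \<le> (real K0 * (7 ^ (2 * n) * v x) / (cs * a ^ (n + 1))) * ((7/4) ^ (2 * n) / v x)"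
      by (rule mult_right_mono[OF s1]) (use vpos[OF x] in auto)
    also have "\<dots> = C" using vpos[OF x] by (simp add: C_def)
    finally show ?thesis .
  qed
  have "(\<Sum>j. indicator (disc_body D (z j) (3/4)) (x - z j) * ennreal (r j ^ (n + 1) / v (z j))) \<le> ennreal C"
    unfolding suminf_eq_SUP
  proof (rule SUP_least)
    fix m :: nat
    define F where "F = {j \<in> {..<m}. x - z j \<in> disc_body D (z j) (3/4)}"
    have "(\<Sum>j<m. indicator (disc_body D (z j) (3/4)) (x - z j) * ennreal (r j ^ (n + 1) / v (z j)))
        = (\<Sum>j\<in>F. ennreal (r j ^ (n + 1) / v (z j)))"
      by (rule sum.mono_neutral_cong_right) (auto simp: F_def)
    also have "\<dots> = ennreal (\<Sum>j\<in>F. r j ^ (n + 1) / v (z j))"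
      by (rule sum_ennreal) (use less_imp_le[OF r] less_imp_le[OF vpos[OF z]] in auto)
    also have "\<dots> \<le> ennreal C" by (intro ennreal_leI fin) (auto simp: F_def)
    finally show "(\<Sum>j<m. indicator (disc_body D (z j) (3/4)) (x - z j) * ennreal (r j ^ (n + 1) / v (z j))) \<le> ennreal C" .
  qed
  then show ?thesis by (simp add: C_def n_def v_def)
qed

section \<open>Coordinate polydiscs and complex lines through them\<close>

definition polydisc_radius :: "real \<Rightarrow> nat \<Rightarrow> real" where
  "polydisc_radius \<epsilon> i = (if i = 1 then \<epsilon> else sqrt \<epsilon>)"

lemma coord_polydisc_eq_PiE:
  assumes "2 \<le> n"
  shows "coord_polydisc n \<epsilon> = PiE {1..<n} (\<lambda>i. ball 0 (polydisc_radius \<epsilon> i))"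
proof (rule set_eqI)
  fix t :: "nat \<Rightarrow> complex"
  have "{1..<n} = insert 1 {2..<n}" using assms by auto
  then have "(\<forall>i\<in>{1..<n}. norm (t i) < polydisc_radius \<epsilon> i) \<longleftrightarrow>
      norm (t 1) < \<epsilon> \<and> (\<forall>i\<in>{2..<n}. norm (t i) < sqrt \<epsilon>)"
    by (simp add: polydisc_radius_def)
  then show "t \<in> coord_polydisc n \<epsilon> \<longleftrightarrow> t \<in> PiE {1..<n} (\<lambda>i. ball 0 (polydisc_radius \<epsilon> i))"
    by (auto simp: coord_polydisc_def PiE_iff)
qed

lemma emeasure_coord_polydisc_le:
  assumes n: "2 \<le> n" and e: "0 < \<epsilon>"
  shows "emeasure (PiM {1..<n} (\<lambda>_. lborel :: complex measure)) (coord_polydisc n \<epsilon>) \<le> ennreal (4 ^ n * \<epsilon> ^ n)"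
proof -
  interpret product_sigma_finite "\<lambda>_ :: nat. lborel :: complex measure"
    by (simp add: product_sigma_finite_def lborel.sigma_finite_measure_axioms)
  have b: "emeasure lborel (ball (0::complex) r) = ennreal (pi * r\<^sup>2)" if "r \<ge> 0" for r
    using that by (simp add: emeasure_ball unit_ball_vol_2)
  have "emeasure (PiM {1..<n} (\<lambda>_. lborel :: complex measure)) (coord_polydisc n \<epsilon>)
      = (\<Prod>i\<in>{1..<n}. emeasure lborel (ball (0::complex) (polydisc_radius \<epsilon> i)))"
    unfolding coord_polydisc_eq_PiE[OF n] by (rule emeasure_PiM) auto
  also have "\<dots> = ennreal (pi * \<epsilon>\<^sup>2) * ennreal (pi * \<epsilon>) ^ (n - 2)"
  proof -
    have ins: "{1..<n} = insert 1 {2..<n}" using n by auto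
    have "(\<Prod>i\<in>{2..<n}. emeasure lborel (ball (0::complex) (polydisc_radius \<epsilon> i))) = (\<Prod>i\<in>{2..<n}. ennreal (pi * \<epsilon>))"
      by (rule prod.cong[OF refl]) (use e in \<open>simp add: polydisc_radius_def b\<close>)
    then show ?thesis using e unfolding ins by (simp add: polydisc_radius_def b)
  qed
  also have "\<dots> = ennreal (pi * \<epsilon>\<^sup>2 * (pi * \<epsilon>) ^ (n - 2))"
    using e by (simp add: ennreal_power ennreal_mult[symmetric])
  also have "\<dots> \<le> ennreal (4 ^ n * \<epsilon> ^ n)"
  proof (rule ennreal_leI)
    obtain m where m: "n = Suc (Suc m)" using n le_Suc_ex[OF n] by auto
    have "pi * \<epsilon>\<^sup>2 * (pi * \<epsilon>) ^ (n - 2) = pi ^ Suc m * \<epsilon> ^ n"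
      by (simp add: m power_mult_distrib power2_eq_square)
    also have "\<dots> \<le> 4 ^ n * \<epsilon> ^ n"
    proof (rule mult_right_mono)
      have "pi ^ Suc m \<le> 4 ^ Suc m" using pi_less_4 by (intro power_mono) auto
      also have "\<dots> \<le> 4 ^ n" by (rule power_increasing) (auto simp: m)
      finally show "pi ^ Suc m \<le> 4 ^ n" .
    qed (use e in simp)
    finally show "pi * \<epsilon>\<^sup>2 * (pi * \<epsilon>) ^ (n - 2) \<le> 4 ^ n * \<epsilon> ^ n" .
  qed
  finally show ?thesis .
qed

text \<open>If an open set near \<open>z\<close> were contained in \<open>X\<close>, it would contain a point over which the covering has only
  finitely many sheets, but the whole disc in the direction \<open>w\<close> around this point would lie in \<open>X\<close>.\<close>
lemma sheeted_covering_complement: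
  fixes X :: "(complex^'n) set"
  assumes U: "open U" "z \<in> U" and cov: "sheeted_covering X U z w p" and w: "norm w = 1"
    and D: "open D" "z \<in> D"
  shows "\<exists>x\<in>D. x \<notin> X"
proof (rule ccontr)
  assume "\<not> ?thesis"
  then have DX: "D \<subseteq> X" by blast
  define \<pi> where "\<pi> = hyperplane_proj z w"
  define B where "B = \<pi> ` U"
  from cov[unfolded sheeted_covering_def Let_def, folded \<pi>_def, folded B_def]
  obtain \<sigma> where s: "B \<subseteq> closure (B - \<sigma>)"
     "\<forall>y\<in>B - \<sigma>. \<exists>V a. open V \<and> y \<in> V \<and> (\<forall>i<p. holo_on (a i) V) \<and>
              (\<forall>x\<in>V \<inter> B. inj_on (\<lambda>i. a i x) {..<p} \<and>
                 {s. x + s *s w \<in> X \<inter> U} = (\<lambda>i. a i x) ` {..<p})"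
    by (elim conjE exE)
  have "\<pi> z = z" by (simp add: \<pi>_def hyperplane_proj_def hinner_def)
  then have "z \<in> B" unfolding B_def using U(2) by (metis image_eqI)
  then have "z \<in> closure (B - \<sigma>)" using s(1) by blast
  moreover have oW: "open (U \<inter> D)" "z \<in> U \<inter> D" using U D by auto
  ultimately obtain y where y: "y \<in> B - \<sigma>" "y \<in> U \<inter> D"
    using open_Int_closure_eq_empty[OF oW(1), of "B - \<sigma>"] by blast
  have "\<exists>V a. open V \<and> y \<in> V \<and> (\<forall>i<p. holo_on (a i) V) \<and>
              (\<forall>x\<in>V \<inter> B. inj_on (\<lambda>i. a i x) {..<p} \<and>
                 {s. x + s *s w \<in> X \<inter> U} = (\<lambda>i. a i x) ` {..<p})"
    by (rule bspec[OF s(2) y(1)])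
  then obtain V a where "y \<in> V" "\<forall>x\<in>V \<inter> B. inj_on (\<lambda>i. a i x) {..<p} \<and>
                 {s. x + s *s w \<in> X \<inter> U} = (\<lambda>i. a i x) ` {..<p}" by (elim exE conjE)
  moreover have "y \<in> V \<inter> B" using y(1) \<open>y \<in> V\<close> by blast
  ultimately have "{s. y + s *s w \<in> X \<inter> U} = (\<lambda>i. a i y) ` {..<p}" by blast
  then have fin: "finite {s. y + s *s w \<in> X \<inter> U}" by simp
  obtain e where e: "e > 0" "ball y e \<subseteq> U \<inter> D" by (rule openE[OF oW(1) y(2)])
  have "ball 0 e \<subseteq> {s. y + s *s w \<in> X \<inter> U}"
  proof
    fix s :: complex assume "s \<in> ball 0 e"
    then have "y + s *s w \<in> ball y e" by (simp add: dist_norm norm_vector_scalar_mult w)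
    then show "s \<in> {s. y + s *s w \<in> X \<inter> U}" using e(2) DX by blast
  qed
  then have "finite (ball (0::complex) e)" using fin finite_subset by blast
  then show False using uncountable_ball[OF e(1), of "0::complex"] countable_finite[of "ball (0::complex) e"] by simp
qed

text \<open>With \<open>\<epsilon> = \<bar>\<rho> z\<bar>\<close> the condition in \<open>tau\<close> says that the disc lies in \<open>D\<close>. Boundedness of \<open>D\<close> makes
  the supremum finite, which is what its order properties rely on.\<close>
lemma tau_sublevel:
  fixes \<rho> :: "complex^'n \<Rightarrow> real"
  assumes D: "D = sublevel \<rho> 0" and R: "\<And>x. x \<in> D \<Longrightarrow> norm x \<le> R" and z: "z \<in> D" and w: "norm w = 1"
    and c: "0 < c" "\<And>s. norm s < c \<Longrightarrow> z + s *s w \<in> D"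
  shows "c \<le> tau \<rho> z w \<bar>\<rho> z\<bar>" and "tau \<rho> z w \<bar>\<rho> z\<bar> \<le> 4 * R + 1"
    and "\<And>s. norm s < tau \<rho> z w \<bar>\<rho> z\<bar> \<Longrightarrow> z + s *s w \<in> D"
proof -
  define A where "A = {t. 0 < t \<and> (\<forall>s. norm s < t \<longrightarrow> \<rho> (z + s *s w) - \<rho> z < \<bar>\<rho> z\<bar>)}"
  have tau: "tau \<rho> z w \<bar>\<rho> z\<bar> = Sup A" by (simp add: tau_def A_def)
  have "\<rho> z < 0" using z by (simp add: D sublevel_def)
  then have iff: "\<rho> (z + s *s w) - \<rho> z < \<bar>\<rho> z\<bar> \<longleftrightarrow> z + s *s w \<in> D" for s by (simp add: D sublevel_def)
  have cA: "c \<in> A" using c by (simp add: A_def iff)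
  have R0: "R \<ge> 0" by (rule order_trans[OF norm_ge_zero R[OF z]])
  have bd: "t \<le> 4 * R + 1" if "t \<in> A" for t
  proof (rule ccontr)
    assume "\<not> t \<le> 4 * R + 1"
    moreover have "norm (complex_of_real (4 * R + 1)) = 4 * R + 1" using R0 by (subst norm_of_real) simp
    ultimately have "norm (complex_of_real (4 * R + 1)) < t" by simp
    then have "z + complex_of_real (4 * R + 1) *s w \<in> D" using that by (simp only: A_def mem_Collect_eq iff)
    then have "norm (z + complex_of_real (4 * R + 1) *s w) \<le> R" by (rule R)
    moreover have "norm (complex_of_real (4 * R + 1) *s w) = 4 * R + 1"
      using R0 by (simp only: norm_vector_scalar_mult w norm_of_real) simp
    ultimately show False
      using R[OF z] R0 norm_triangle_ineq4[of "z + complex_of_real (4 * R + 1) *s w" z] by simp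
  qed
  have bdd: "bdd_above A" by (rule bdd_aboveI[of A "4 * R + 1"]) (rule bd)
  show "c \<le> tau \<rho> z w \<bar>\<rho> z\<bar>" unfolding tau by (rule cSup_upper[OF cA bdd])
  show "tau \<rho> z w \<bar>\<rho> z\<bar> \<le> 4 * R + 1" unfolding tau using cA by (intro cSup_least bd) auto
  show "z + s *s w \<in> D" if "norm s < tau \<rho> z w \<bar>\<rho> z\<bar>" for s
  proof -
    have ne: "A \<noteq> {}" using cA by blast
    have "norm s < Sup A" using that by (simp only: tau)
    then have "\<exists>t\<in>A. norm s < t" by (rule less_cSupD[OF ne])
    then obtain t where "t \<in> A" "norm s < t" by (elim bexE)
    then show ?thesis by (simp add: A_def iff)
  qed
qed

text \<open>Here \<open>T\<close> stands for \<open>tau\<close>, \<open>k + 1\<close> for the length of the tuple and \<open>M\<close> for the mean value of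
  \<open>\<bar>G\<bar>\<^sup>q\<close>. As \<open>T\<close> is at least a multiple of \<open>sqrt \<delta>\<close>, the product \<open>sqrt \<delta> ^ k * (16 / T) ^ k\<close> is bounded.\<close>
lemma weighted_divdiff_term_le:
  fixes q a \<delta> T M :: real
  assumes dd: "dd \<le> 2 * S * (16 / T) ^ k" "0 \<le> dd" and S: "S = M powr (1 / q)" "0 \<le> M"
    and q: "1 \<le> q" and a: "0 < a" "a \<le> 1" and \<delta>: "0 < \<delta>" and T: "sqrt (a * \<delta>) / 2 \<le> T" and k: "k \<le> P"
  shows "\<delta> powr (q * (real k / 2) + 1) * dd powr q \<le> \<delta> * ((32 / sqrt a) powr (q * real P) * 2 powr q * M)"
proof -
  define A where "A = 32 / sqrt a"
  have sa: "0 < sqrt a" "sqrt a \<le> 1" "0 < sqrt \<delta>" using a \<delta> by auto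
  have "sqrt a \<le> 32" using sa(2) by linarith
  then have A1: "A \<ge> 1" unfolding A_def by (simp only: le_divide_eq_1_pos[OF sa(1)])
  have "0 < sqrt (a * \<delta>) / 2" using a \<delta> by simp
  then have T0: "T > 0" using T by linarith
  have S0: "S \<ge> 0" using S by simp
  have "sqrt \<delta> * (16 / T) \<le> A"
  proof -
    have "sqrt \<delta> * 16 \<le> A * (sqrt (a * \<delta>) / 2)" using sa by (simp add: A_def real_sqrt_mult)
    also have "\<dots> \<le> A * T" using T A1 by (intro mult_left_mono) auto
    finally show ?thesis using T0 by (simp add: field_simps)
  qed
  then have "(sqrt \<delta> * (16 / T)) ^ k \<le> A ^ k" using sa T0 by (intro power_mono) auto
  also have "\<dots> \<le> A ^ P" using A1 k by (intro power_increasing)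
  finally have p: "(sqrt \<delta> * (16 / T)) ^ k \<le> A ^ P" .
  have dq: "\<delta> powr (q * (real k / 2)) = ((sqrt \<delta>) ^ k) powr q"
  proof -
    have "(sqrt \<delta>) ^ k = \<delta> powr (real k / 2)"
      using \<delta> by (simp add: powr_half_sqrt[symmetric] powr_realpow[symmetric] powr_powr)
    then show ?thesis using \<delta> by (simp add: powr_powr mult.commute)
  qed
  have "\<delta> powr (q * (real k / 2)) * dd powr q = ((sqrt \<delta>) ^ k * dd) powr q"
    unfolding dq using dd(2) sa by (simp add: powr_mult)
  also have "\<dots> \<le> (2 * S * A ^ P) powr q"
  proof (rule powr_mono2)
    have "(sqrt \<delta>) ^ k * dd \<le> (sqrt \<delta>) ^ k * (2 * S * (16 / T) ^ k)" using dd(1) sa by (intro mult_left_mono) auto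
    also have "\<dots> = 2 * S * (sqrt \<delta> * (16 / T)) ^ k" by (simp only: power_mult_distrib mult_ac)
    also have "\<dots> \<le> 2 * S * A ^ P" using p S0 by (intro mult_left_mono) auto
    finally show "(sqrt \<delta>) ^ k * dd \<le> 2 * S * A ^ P" .
  qed (use q dd(2) sa in auto)
  also have "\<dots> = 2 powr q * M * A powr (q * real P)"
  proof -
    have "A ^ P = A powr real P" using A1 by (simp add: powr_realpow)
    then have "(A ^ P) powr q = A powr (q * real P)" by (simp add: powr_powr mult.commute)
    moreover have "S powr q = M" using S q by (simp add: powr_powr)
    ultimately show ?thesis using S0 A1 by (simp add: powr_mult)
  qed
  finally have "\<delta> powr (q * (real k / 2)) * dd powr q \<le> 2 powr q * M * A powr (q * real P)" .
  then have "\<delta> * (\<delta> powr (q * (real k / 2)) * dd powr q) \<le> \<delta> * (2 powr q * M * A powr (q * real P))"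
    using \<delta> by (intro mult_left_mono) auto
  then show ?thesis using \<delta> by (simp add: powr_add A_def mult_ac)
qed

text \<open>Eight times a point of the polydisc lies in the slab: this is what the smallness of \<open>\<kappa>\<close> in
  comparison with \<open>a\<close> ensures.\<close>
lemma polydisc_point_in_disc_body:
  fixes W :: "nat \<Rightarrow> complex^'n"
  assumes slab: "\<And>y. norm (hinner y (W 1)) \<le> a * \<delta> \<Longrightarrow> (norm y)\<^sup>2 \<le> a * \<delta> \<Longrightarrow> y \<in> disc_body D z 1"
    and W: "orthonormal_basis W" and n: "2 \<le> CARD('n)"
    and \<delta>: "0 < \<delta>" "\<delta> \<le> 1" and \<kappa>: "0 < \<kappa>" "\<kappa> \<le> 1" "64 * (4 + 2 * real CARD('n)) * \<kappa> \<le> a"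
    and t: "t \<in> coord_polydisc CARD('n) (2 * \<kappa> * \<delta>)"
  shows "(\<Sum>i\<in>{1..<CARD('n)}. t i *s W i) \<in> disc_body D z (1/8)"
proof -
  define n where "n = CARD('n)"
  define y where "y = (\<Sum>i\<in>{1..<n}. t i *s W i)"
  define \<epsilon> where "\<epsilon> = 2 * \<kappa> * \<delta>"
  have e: "0 < \<epsilon>" using \<delta> \<kappa> by (simp add: \<epsilon>_def)
  have t1: "norm (t 1) < \<epsilon>" and ti: "\<And>i. i \<in> {2..<n} \<Longrightarrow> norm (t i) < sqrt \<epsilon>"
    using t by (auto simp: coord_polydisc_def \<epsilon>_def n_def)
  have S: "{1..<n} \<subseteq> {1..CARD('n)}" by (auto simp: n_def)
  have h: "hinner y (W 1) = t 1"
    unfolding y_def using hinner_orthonormal_sum[OF W S, of 1 t] n by (simp add: n_def)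
  have n2: "(norm y)\<^sup>2 \<le> \<epsilon>\<^sup>2 + real n * \<epsilon>"
  proof -
    have "(norm y)\<^sup>2 = (\<Sum>i\<in>{1..<n}. (norm (t i))\<^sup>2)" unfolding y_def by (rule norm_orthonormal_sum[OF W S])
    also have "\<dots> = (norm (t 1))\<^sup>2 + (\<Sum>i\<in>{2..<n}. (norm (t i))\<^sup>2)"
    proof -
      have ins: "{1..<n} = insert 1 {2..<n}" using n by (auto simp: n_def)
      show ?thesis unfolding ins by simp
    qed
    also have "\<dots> \<le> \<epsilon>\<^sup>2 + (\<Sum>i\<in>{2..<n}. \<epsilon>)"
    proof (rule add_mono)
      show "(norm (t 1))\<^sup>2 \<le> \<epsilon>\<^sup>2" using t1 by (intro power_mono) auto
      show "(\<Sum>i\<in>{2..<n}. (norm (t i))\<^sup>2) \<le> (\<Sum>i\<in>{2..<n}. \<epsilon>)"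
      proof (rule sum_mono)
        fix i assume "i \<in> {2..<n}"
        then have "(norm (t i))\<^sup>2 \<le> (sqrt \<epsilon>)\<^sup>2" using ti[of i] by (intro power_mono) auto
        then show "(norm (t i))\<^sup>2 \<le> \<epsilon>" using e by simp
      qed
    qed
    also have "\<dots> \<le> \<epsilon>\<^sup>2 + real n * \<epsilon>" using e by (simp add: of_nat_diff mult_right_mono)
    finally show ?thesis .
  qed
  have e2: "\<epsilon>\<^sup>2 \<le> 4 * \<kappa> * \<delta>"
  proof -
    have "\<kappa> * \<delta> \<le> 1" using \<kappa> \<delta> mult_mono[of \<kappa> 1 \<delta> 1] by simp
    then have "(\<kappa> * \<delta>) * (\<kappa> * \<delta>) \<le> 1 * (\<kappa> * \<delta>)" using \<kappa> \<delta> by (intro mult_right_mono) auto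
    moreover have "\<epsilon>\<^sup>2 = 4 * ((\<kappa> * \<delta>) * (\<kappa> * \<delta>))" by (simp add: \<epsilon>_def power2_eq_square)
    ultimately show ?thesis unfolding mult.assoc by linarith
  qed
  have big: "64 * (\<epsilon>\<^sup>2 + real n * \<epsilon>) \<le> a * \<delta>"
  proof -
    have "64 * (\<epsilon>\<^sup>2 + real n * \<epsilon>) \<le> 64 * (4 * \<kappa> * \<delta> + real n * \<epsilon>)"
      by (intro mult_left_mono add_right_mono e2) simp
    also have "\<dots> = (64 * (4 + 2 * real n) * \<kappa>) * \<delta>" by (simp add: \<epsilon>_def algebra_simps)
    also have "\<dots> \<le> a * \<delta>" using \<kappa>(3) \<delta> by (intro mult_right_mono) (auto simp: n_def)
    finally show ?thesis .
  qed
  have "8 *s y \<in> disc_body D z 1"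
  proof (rule slab)
    have "real n \<ge> 1" using n by (simp add: n_def)
    then have "\<epsilon> \<le> real n * \<epsilon>" using e by simp
    then have "8 * \<epsilon> \<le> a * \<delta>" using big zero_le_power2[of \<epsilon>] e unfolding distrib_left by linarith
    then show "norm (hinner (8 *s y) (W 1)) \<le> a * \<delta>" using t1 unfolding hinner_smult_left h norm_mult by simp
    have "(norm (8 *s y))\<^sup>2 = 64 * (norm y)\<^sup>2" by (simp add: norm_vector_scalar_mult power_mult_distrib)
    then show "(norm (8 *s y))\<^sup>2 \<le> a * \<delta>" using n2 big unfolding distrib_left by linarith
  qed
  then have "(1/8) *s (8 *s y) \<in> disc_body D z ((1/8) * 1)" by (rule disc_body_smult) (auto simp: norm_divide)
  then show ?thesis by (simp add: y_def n_def vector_smult_assoc)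
qed

text \<open>The covering property provides a point \<open>x\<close> with \<open>f x \<noteq> 0\<close> arbitrarily close to \<open>z\<close>. Let \<open>s0\<close> be its
  coordinate in the direction \<open>W n\<close>. The function \<open>t \<mapsto> f (coord_point z W t + s0 *s W n)\<close> is separately
  holomorphic and nonzero at the remaining coordinates of \<open>x\<close>, hence nonzero almost everywhere.\<close>
lemma AE_line_not_in_zero_set:
  fixes f :: "complex^'n \<Rightarrow> complex" and W :: "nat \<Rightarrow> complex^'n"
  defines "n \<equiv> CARD('n)"
  assumes W: "orthonormal_basis W" and n: "2 \<le> CARD('n)" and f: "holo_on f N" "open N"
    and cov: "open U" "z \<in> U" "sheeted_covering {x \<in> N. f x = 0} U z (W n) p"
    and pos: "0 < \<epsilon>" "0 < c"
    and inN: "\<And>t s. t \<in> coord_polydisc n \<epsilon> \<Longrightarrow> norm s < c \<Longrightarrow> coord_point z W t + s *s W n \<in> N"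
  shows "AE t in PiM {1..<n} (\<lambda>_. lborel :: complex measure).
           t \<in> coord_polydisc n \<epsilon> \<longrightarrow> (\<exists>s. norm s < c \<and> f (coord_point z W t + s *s W n) \<noteq> 0)"
proof -
  have nin: "n \<in> {1..CARD('n)}" using n by (auto simp: n_def)
  have nn: "2 \<le> n" using n by (simp add: n_def)
  have w1: "norm (W n) = 1" by (rule norm_orthonormal_basis[OF W nin])
  have cp: "coord_point z W t = z + (\<Sum>i\<in>{1..<n}. t i *s W i)" for t by (simp add: coord_point_def n_def)
  have zero: "(\<lambda>i\<in>{1..<n}. 0) \<in> coord_polydisc n \<epsilon>"
    using pos nn by (auto simp: coord_polydisc_def)
  have "coord_point z W (\<lambda>i\<in>{1..<n}. 0) = z" by (simp add: cp)
  then have zN: "z \<in> N" using inN[OF zero, of 0] pos by simp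
  define e where "e = min \<epsilon> (min (sqrt \<epsilon>) c)"
  have e: "0 < e" "e \<le> \<epsilon>" "e \<le> sqrt \<epsilon>" "e \<le> c" using pos by (auto simp: e_def)
  have oD: "open (ball z e \<inter> N)" using f(2) by blast
  have zD: "z \<in> ball z e \<inter> N" using zN e by simp
  obtain x where x: "x \<in> ball z e \<inter> N" "x \<notin> {x \<in> N. f x = 0}"
    using sheeted_covering_complement[OF cov w1 oD zD] by (elim bexE)
  define k where "k i = hinner (x - z) (W i)" for i
  have k: "norm (k i) < e" if "i \<in> {1..CARD('n)}" for i
  proof -
    have "norm (k i) \<le> norm (x - z) * norm (W i)" unfolding k_def by (rule norm_hinner_le)
    also have "\<dots> = norm (x - z)" by (simp add: norm_orthonormal_basis[OF W that])
    also have "\<dots> < e" using x(1) by (simp add: dist_norm norm_minus_commute)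
    finally show ?thesis .
  qed
  define t0 where "t0 = restrict k {1..<n}"
  define s0 where "s0 = k n"
  have s0: "norm s0 < c" using k[OF nin] e by (simp add: s0_def)
  have t0: "t0 \<in> PiE {1..<n} (\<lambda>i. ball 0 (polydisc_radius \<epsilon> i))"
  proof (rule PiE_I)
    fix i assume i: "i \<in> {1..<n}"
    then have "norm (k i) < e" by (intro k) (auto simp: n_def)
    then show "t0 i \<in> ball 0 (polydisc_radius \<epsilon> i)" using i e by (auto simp: t0_def polydisc_radius_def)
  qed (auto simp: t0_def)
  define pt where "pt t = coord_point z W t + s0 *s W n" for t
  have pt0: "pt t0 = x"
  proof -
    have S: "{1..CARD('n)} = insert n {1..<n}" using n by (auto simp: n_def)
    have "x - z = (\<Sum>i\<in>{1..CARD('n)}. k i *s W i)" unfolding k_def by (rule orthonormal_expansion[OF W])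
    also have "\<dots> = s0 *s W n + (\<Sum>i\<in>{1..<n}. k i *s W i)" unfolding S by (simp add: s0_def)
    also have "(\<Sum>i\<in>{1..<n}. k i *s W i) = (\<Sum>i\<in>{1..<n}. t0 i *s W i)"
      by (rule sum.cong) (auto simp: t0_def)
    finally show ?thesis by (simp add: pt_def cp algebra_simps)
  qed
  \<comment> \<open>The indicator makes the function measurable on the whole coordinate space; on the polydisc it
      equals \<open>1\<close>.\<close>
  define h where "h t = indicator N (pt t) *\<^sub>R f (pt t)" for t
  have ptN: "pt t \<in> N" if "t \<in> PiE {1..<n} (\<lambda>i. ball 0 (polydisc_radius \<epsilon> i))" for t
    unfolding pt_def by (rule inN[OF _ s0]) (use that in \<open>simp only: coord_polydisc_eq_PiE[OF nn]\<close>)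
  have "AE t in PiM {1..<n} (\<lambda>_. lborel :: complex measure).
          t \<in> PiE {1..<n} (\<lambda>i. ball 0 (polydisc_radius \<epsilon> i)) \<longrightarrow> h t \<noteq> 0"
  proof (rule AE_PiM_holomorphic_nonzero[OF _ _ _ t0])
    have "(\<lambda>x. indicator N x *\<^sub>R f x) \<in> borel_measurable borel"
      by (rule borel_measurable_continuous_on_indicator[OF _ holo_on_continuous_on[OF f(1)]]) (use f(2) in simp)
    moreover have "pt \<in> borel_measurable (PiM {1..<n} (\<lambda>_. lborel :: complex measure))"
    proof -
      have cs: "(\<lambda>x. x *s v) \<in> borel_measurable lborel" for v :: "complex^'n"
        using borel_measurable_continuous_onI[OF linear_continuous_on[OF linear_linear[THEN iffD2, OF linear_scale_vec[of v]], of UNIV]]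
        by simp
      have "(\<lambda>t. t i *s W i) \<in> borel_measurable (PiM {1..<n} (\<lambda>_. lborel :: complex measure))" if "i \<in> {1..<n}" for i
        by (rule measurable_compose[OF measurable_component_singleton[OF that] cs])
      then show ?thesis unfolding pt_def cp by (intro borel_measurable_add borel_measurable_sum borel_measurable_const)
    qed
    ultimately show "h \<in> borel_measurable (PiM {1..<n} (\<lambda>_. lborel))"
      unfolding h_def by (rule measurable_compose[rotated])
  next
    fix t :: "nat \<Rightarrow> complex" and i
    assume t: "t \<in> PiE {1..<n} (\<lambda>i. ball 0 (polydisc_radius \<epsilon> i))" and i: "i \<in> {1..<n}"
    define q where "q = z + (\<Sum>j\<in>{1..<n} - {i}. t j *s W j) + s0 *s W n"
    have ptu: "pt (t(i := u)) = q + u *s W i" for u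
    proof -
      have "(\<Sum>j\<in>{1..<n}. (t(i := u)) j *s W j) = u *s W i + (\<Sum>j\<in>{1..<n} - {i}. (t(i := u)) j *s W j)"
        using i by (subst sum.remove[of _ i]) auto
      also have "(\<Sum>j\<in>{1..<n} - {i}. (t(i := u)) j *s W j) = (\<Sum>j\<in>{1..<n} - {i}. t j *s W j)"
        by (rule sum.cong) auto
      finally show ?thesis by (simp add: pt_def cp q_def algebra_simps)
    qed
    have inN': "q + u *s W i \<in> N" if u: "u \<in> ball 0 (polydisc_radius \<epsilon> i)" for u
    proof -
      have "t(i := u) \<in> PiE {1..<n} (\<lambda>i. ball 0 (polydisc_radius \<epsilon> i))"
        using t u i by (auto simp: PiE_iff extensional_def)
      from ptN[OF this] show ?thesis by (simp only: ptu)
    qed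
    have "(\<lambda>u. f (q + u *s W i)) holomorphic_on ball 0 (polydisc_radius \<epsilon> i)"
      by (rule holo_on_affine[OF f(1) inN'])
    then show "(\<lambda>u. h (t(i := u))) holomorphic_on ball 0 (polydisc_radius \<epsilon> i)"
      by (rule holomorphic_transform) (simp only: h_def ptu indicator_simps(1)[OF inN'] scaleR_one)
  next
    show "h t0 \<noteq> 0" using x by (simp add: h_def pt0)
  qed simp
  then show ?thesis
  proof (rule AE_mp, intro AE_I2 impI)
    fix t assume "t \<in> PiE {1..<n} (\<lambda>i. ball 0 (polydisc_radius \<epsilon> i)) \<longrightarrow> h t \<noteq> 0" "t \<in> coord_polydisc n \<epsilon>"
    then have "f (pt t) \<noteq> 0" by (simp add: coord_polydisc_eq_PiE[OF nn] h_def)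
    then show "\<exists>s. norm s < c \<and> f (coord_point z W t + s *s W n) \<noteq> 0" using s0 unfolding pt_def by blast
  qed
qed

section \<open>The contribution of one centre\<close>

text \<open>For \<open>t\<close> in the polydisc let \<open>T t\<close> be the value of \<open>tau\<close> at \<open>coord_point z W t\<close>. The points of \<open>Lam\<close> lie in
  the disc of radius \<open>T t / 16\<close>, and \<open>G\<close> is estimated on the circle of radius \<open>T t / 8\<close>. The points of this
  circle lie in \<open>z\<close> plus half the body of \<open>z\<close>, so the mean value inequality over a quarter of the body
  stays within three quarters of it; this produces \<open>J\<close>. For almost every \<open>t\<close> there are at most \<open>P\<close>
  points in \<open>Lam\<close>, so the inner sum is finite with at most \<open>\<Sum>i\<le>P. P ^ i\<close> terms.\<close>
lemma polydisc_integral_le: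
  fixes \<rho> :: "complex^'n \<Rightarrow> real" and f g G :: "complex^'n \<Rightarrow> complex"
  defines "n \<equiv> CARD('n)"
  assumes n: "2 \<le> CARD('n)" and D: "D = sublevel \<rho> 0" "open D" "convex D" "bounded D" and R: "\<And>x. x \<in> D \<Longrightarrow> norm x \<le> R"
    and a: "0 < a" "a \<le> 1"
    and slab: "\<And>y. norm (hinner y (unit_normal \<rho> z)) \<le> a * \<bar>\<rho> z\<bar> \<Longrightarrow> (norm y)\<^sup>2 \<le> a * \<bar>\<rho> z\<bar> \<Longrightarrow> y \<in> disc_body D z 1"
    and f: "holo_on f N" "open N" "D \<subseteq> N" and X: "X = {x \<in> N. f x = 0}"
    and zeros: "\<And>x w. x \<in> D \<Longrightarrow> norm w = 1 \<Longrightarrow> (\<forall>s. norm s < r0 \<longrightarrow> f (x + s *s w) = 0) \<or>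
     (finite {s. norm s < r0 \<and> f (x + s *s w) = 0} \<and> card {s. norm s < r0 \<and> f (x + s *s w) = 0} \<le> P)" "0 < r0"
    and \<kappa>: "0 < \<kappa>" "48 * \<kappa> \<le> 1" "64 * (4 + 2 * real CARD('n)) * \<kappa> \<le> a" "3 * \<kappa> * (4 * R + 1) \<le> r0"
    and z: "z \<in> D" "\<bar>\<rho> z\<bar> \<le> 1" and W: "admissible_basis \<rho> X z W"
    and G: "holo_on G D" "\<And>x. x \<in> X \<inter> D \<Longrightarrow> G x = g x" and q: "1 \<le> q"
    and J: "J = (\<integral>\<^sup>+w. indicator ((+) z ` disc_body D z (3/4)) w * ennreal (norm (G w) powr q) \<partial>lborel)" "J < \<infinity>"
  shows "(\<integral>\<^sup>+ t \<in> coord_polydisc CARD('n) (2 * \<kappa> * \<bar>\<rho> z\<bar>).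
        (let z' = coord_point z W t; w = W CARD('n) in
         \<Sum>\<^sub>\<infinity>ls\<in>{ls. ls \<noteq> [] \<and> distinct ls \<and> set ls \<subseteq> Lam \<rho> X \<kappa> z' w}.
           ennreal (\<bar>\<rho> z\<bar> powr (q * ((real (length ls) - 1) / 2) + 1)
                    * norm (divdiff (\<lambda>s. g (z' + s *s w)) ls) powr q))
        \<partial>(\<Pi>\<^sub>M i\<in>{1..<CARD('n)}. (lborel :: complex measure)))
     \<le> ennreal ((\<Sum>i\<le>P. real P ^ i) * (32 / sqrt a) powr (q * real P) * 2 powr q * 16 ^ n * 4 ^ n)
        * (ennreal (\<bar>\<rho> z\<bar> ^ (n + 1) / measure lborel (disc_body D z 1)) * J)"
proof -
  define \<delta> where "\<delta> = \<bar>\<rho> z\<bar>"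
  define w where "w = W n"
  define v where "v = measure lborel (disc_body D z 1)"
  define M where "M = 16 ^ n * enn2real J / v"
  define S where "S = M powr (1 / q)"
  define Q where "Q = PiM {1..<n} (\<lambda>_. lborel :: complex measure)"
  define PD where "PD = coord_polydisc n (2 * \<kappa> * \<delta>)"
  have neg: "\<rho> z < 0" using z(1) by (simp add: D(1) sublevel_def)
  have \<delta>: "0 < \<delta>" "\<delta> \<le> 1" using neg z(2) by (auto simp: \<delta>_def)
  have \<kappa>1: "\<kappa> \<le> 1" using \<kappa> by simp
  have Wb: "orthonormal_basis W" and W1: "W 1 = unit_normal \<rho> z" using W by (auto simp: admissible_basis_def)
  have nin: "n \<in> {1..CARD('n)}" "(1::nat) \<in> {1..CARD('n)}" "n \<noteq> 1" using n by (auto simp: n_def)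
  have w1: "norm w = 1" unfolding w_def by (rule norm_orthonormal_basis[OF Wb nin(1)])
  have hw: "hinner w (W 1) = 0" using Wb nin unfolding w_def orthonormal_basis_def by auto
  have v: "v > 0" unfolding v_def by (rule measure_disc_body_pos[OF D(2,4) z(1)])
  have M0: "M \<ge> 0" using v by (simp add: M_def)
  have ybody: "(\<Sum>i\<in>{1..<n}. t i *s W i) \<in> disc_body D z (1/8)" if "t \<in> PD" for t
    unfolding n_def
    by (rule polydisc_point_in_disc_body[OF slab[folded W1 \<delta>_def] Wb n \<delta> \<kappa>(1) \<kappa>1 \<kappa>(3)])
       (use that in \<open>simp_all only: PD_def n_def\<close>)
  have cp: "coord_point z W t = z + (\<Sum>i\<in>{1..<n}. t i *s W i)" for t by (simp add: coord_point_def n_def)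
  define c where "c = sqrt (a * \<delta>) / 2"
  have c: "c > 0" using a \<delta> by (simp add: c_def)
  have wbody: "s *s w \<in> disc_body D z (1/2)" if s: "norm s < c" for s
  proof -
    have "(2 * s) *s w \<in> disc_body D z 1"
    proof (rule slab)
      show "norm (hinner ((2 * s) *s w) (unit_normal \<rho> z)) \<le> a * \<bar>\<rho> z\<bar>"
        using hw a(1) by (simp add: W1[symmetric] hinner_smult_left)
      have "norm ((2 * s) *s w) \<le> sqrt (a * \<delta>)" using s by (simp add: norm_vector_scalar_mult w1 norm_mult c_def)
      then have "(norm ((2 * s) *s w))\<^sup>2 \<le> (sqrt (a * \<delta>))\<^sup>2" by (intro power_mono) auto
      then show "(norm ((2 * s) *s w))\<^sup>2 \<le> a * \<bar>\<rho> z\<bar>" using a(1) \<delta> by (simp add: \<delta>_def)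
    qed
    then have "(1/2) *s ((2 * s) *s w) \<in> disc_body D z ((1/2) * 1)" by (rule disc_body_smult) (auto simp: norm_divide)
    then show ?thesis by (simp add: vector_smult_assoc)
  qed
  have inD: "z + y \<in> D" if "y \<in> disc_body D z \<theta>" "0 < \<theta>" "\<theta> \<le> 1" for y \<theta>
    using disc_body_memD[OF that(1), of 1] that(2,3) by simp
  have z'D: "coord_point z W t \<in> D" if "t \<in> PD" for t
    unfolding cp by (rule inD[OF ybody[OF that]]) auto
  have z'w: "coord_point z W t + s *s w \<in> D" if "t \<in> PD" "norm s < c" for t s
    using inD[OF disc_body_add[OF D(3) ybody[OF that(1)] _ wbody[OF that(2)]]] by (simp add: cp add.assoc)
  define T where "T t = tau \<rho> (coord_point z W t) w \<bar>\<rho> (coord_point z W t)\<bar>" for t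
  have T: "c \<le> T t" "T t \<le> 4 * R + 1" "\<And>s. norm s < T t \<Longrightarrow> coord_point z W t + s *s w \<in> D" if "t \<in> PD" for t
    unfolding T_def using tau_sublevel[OF D(1) R z'D[OF that] w1 c z'w[OF that]] by auto
  have Gbd: "norm (G (coord_point z W t + s *s w)) \<le> S" if t: "t \<in> PD" and s: "norm s \<le> T t / 8" for t s
  proof -
    define y where "y = (\<Sum>i\<in>{1..<n}. t i *s W i)"
    have Tp: "T t > 0" using T(1)[OF t] c by linarith
    have yb: "y \<in> disc_body D z (1/8)" unfolding y_def by (rule ybody[OF t])
    have "s *s w \<in> disc_body D (z + y) (1/4)"
      unfolding disc_body_def mem_Collect_eq
    proof (intro allI impI)
      fix u :: complex assume "norm u \<le> 1 / (1/4)"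
      then have "norm (u * s) \<le> 4 * (T t / 8)" unfolding norm_mult using s by (intro mult_mono) auto
      then have "norm (u * s) < T t" using Tp by simp
      from T(3)[OF t this] show "z + y + u *s (s *s w) \<in> D" by (simp add: cp y_def vector_smult_assoc)
    qed
    \<comment> \<open>\<open>(1 + 1/8) * 1/4 = 9/32\<close>, and adding \<open>1/8\<close> gives \<open>13/32\<close>, which is below \<open>1/2\<close>.\<close>
    from disc_body_recenter[OF D(3) yb _ this] have "s *s w \<in> disc_body D z (9/32)" by simp
    from disc_body_add[OF D(3) yb _ this] have "y + s *s w \<in> disc_body D z (13/32)" by simp
    then have ys: "y + s *s w \<in> disc_body D z (1/2)" using disc_body_mono[of "13/32" "1/2" D z] by auto
    define x where "x = z + (y + s *s w)"
    have "ennreal (norm (G x) powr q) * emeasure lborel (disc_body D z (1/4)) \<le> J"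
      unfolding J
    proof (rule circled_mean_value[OF D(2) G(1)])
      show "open (disc_body D z (1/4))" by (rule open_disc_body[OF D(2)]) simp
      show "c *s u \<in> disc_body D z (1/4)" if "u \<in> disc_body D z (1/4)" "norm c \<le> 1" for u c
        using disc_body_smult[OF that, of] by simp
      show "x + u \<in> (+) z ` disc_body D z (3/4)" if u: "u \<in> disc_body D z (1/4)" for u
      proof (rule image_eqI)
        show "x + u = z + ((y + s *s w) + u)" by (simp add: x_def)
        show "(y + s *s w) + u \<in> disc_body D z (3/4)"
          using disc_body_add[OF D(3) ys _ u] by simp
      qed
      show "(+) z ` disc_body D z (3/4) \<subseteq> D"
      proof
        fix u assume "u \<in> (+) z ` disc_body D z (3/4)"
        then obtain y' where "u = z + y'" "y' \<in> disc_body D z (3/4)" by blast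
        then show "u \<in> D" using inD[of y' "3/4"] by simp
      qed
      show "open ((+) z ` disc_body D z (3/4))" by (intro open_translation open_disc_body D(2)) simp
    qed (rule q)
    also have "emeasure lborel (disc_body D z (1/4)) = ennreal ((1/4) ^ (2 * n) * v)"
      using emeasure_eq_measure2[OF disc_body_fmeasurable[OF D(2,4), of "1/4" z]]
        measure_disc_body_scale[OF D(2,4), of "1/4" z] by (simp add: v_def n_def)
    finally have "ennreal (norm (G x) powr q * ((1/4) ^ (2 * n) * v)) \<le> J"
      using v by (subst ennreal_mult) auto
    also have "J = ennreal (enn2real J)" using J(2) by simp
    finally have "norm (G x) powr q * ((1/4) ^ (2 * n) * v) \<le> enn2real J"
      by (subst (asm) ennreal_le_iff) auto
    then have "norm (G x) powr q \<le> enn2real J / ((1/4) ^ (2 * n) * v)"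
      using v by (subst pos_le_divide_eq) auto
    also have "\<dots> = M"
      using v by (simp add: M_def power_mult power_divide)
    finally have "(norm (G x) powr q) powr (1 / q) \<le> M powr (1 / q)" using q by (intro powr_mono2) auto
    then have "norm (G x) \<le> S" using q by (simp add: S_def powr_powr)
    then show ?thesis by (simp add: x_def y_def cp add.assoc)
  qed
  define B where "B = (\<Sum>i\<le>P. real P ^ i) * (\<delta> * ((32 / sqrt a) powr (q * real P) * 2 powr q * M))"
  have B0: "B \<ge> 0" using M0 \<delta> by (auto simp: B_def intro!: mult_nonneg_nonneg sum_nonneg)
  have inner: "(\<Sum>\<^sub>\<infinity>ls\<in>{ls. ls \<noteq> [] \<and> distinct ls \<and> set ls \<subseteq> Lam \<rho> X \<kappa> (coord_point z W t) w}.
           ennreal (\<delta> powr (q * ((real (length ls) - 1) / 2) + 1)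
                    * norm (divdiff (\<lambda>s. g (coord_point z W t + s *s w)) ls) powr q)) \<le> ennreal B"
    if t: "t \<in> PD" and nz: "\<not> (\<forall>s. norm s < r0 \<longrightarrow> f (coord_point z W t + s *s w) = 0)" for t
  proof -
    define z' where "z' = coord_point z W t"
    define \<Lambda> where "\<Lambda> = Lam \<rho> X \<kappa> z' w"
    define ZZ where "ZZ = {s. norm s < r0 \<and> f (z' + s *s w) = 0}"
    have Tp: "T t > 0" using T(1)[OF t] c by linarith
    have ZZ: "finite ZZ" "card ZZ \<le> P"
      using zeros(1)[OF z'D[OF t] w1] nz by (auto simp: ZZ_def z'_def)
    have Lam1: "norm s < 3 * \<kappa> * T t" "z' + s *s w \<in> X" if "s \<in> \<Lambda>" for s
      using that by (auto simp: \<Lambda>_def Lam_def T_def z'_def)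
    have sub: "\<Lambda> \<subseteq> ZZ"
    proof
      fix s assume s: "s \<in> \<Lambda>"
      have "3 * \<kappa> * T t \<le> 3 * \<kappa> * (4 * R + 1)" using T(2)[OF t] \<kappa>(1) by (intro mult_left_mono) auto
      then show "s \<in> ZZ" using Lam1[OF s] \<kappa>(4) by (auto simp: ZZ_def X)
    qed
    have \<Lambda>: "finite \<Lambda>" "card \<Lambda> \<le> P" using finite_subset[OF sub ZZ(1)] card_mono[OF ZZ(1) sub] ZZ(2) by auto
    have small: "norm s \<le> (T t / 8) / 2" if "s \<in> \<Lambda>" for s
    proof -
      have "3 * \<kappa> * T t \<le> (1/16) * T t" using \<kappa>(2) Tp by (intro mult_right_mono) auto
      then show ?thesis using Lam1(1)[OF that] by simp
    qed
    define LL where "LL = {ls. ls \<noteq> [] \<and> distinct ls \<and> set ls \<subseteq> \<Lambda>}"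
    have LLsub: "LL \<subseteq> {ls. set ls \<subseteq> \<Lambda> \<and> length ls \<le> P}"
    proof
      fix ls assume "ls \<in> LL"
      then have "set ls \<subseteq> \<Lambda>" "distinct ls" by (auto simp: LL_def)
      then show "ls \<in> {ls. set ls \<subseteq> \<Lambda> \<and> length ls \<le> P}"
        using card_mono[OF \<Lambda>(1), of "set ls"] \<Lambda>(2) distinct_card[of ls] by simp
    qed
    have LLfin: "finite LL" by (rule finite_subset[OF LLsub finite_lists_length_le[OF \<Lambda>(1)]])
    have LLcard: "real (card LL) \<le> (\<Sum>i\<le>P. real P ^ i)"
    proof -
      have "card LL \<le> (\<Sum>i\<le>P. card \<Lambda> ^ i)"
        using card_mono[OF finite_lists_length_le[OF \<Lambda>(1)] LLsub] card_lists_length_le[OF \<Lambda>(1), of P] by simp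
      also have "\<dots> \<le> (\<Sum>i\<le>P. P ^ i)" by (intro sum_mono power_mono \<Lambda>(2)) auto
      finally show ?thesis by (metis (mono_tags, lifting) of_nat_le_iff of_nat_sum of_nat_power sum.cong)
    qed
    have tm: "ennreal (\<delta> powr (q * ((real (length ls) - 1) / 2) + 1) * norm (divdiff (\<lambda>s. g (z' + s *s w)) ls) powr q)
        \<le> ennreal (\<delta> * ((32 / sqrt a) powr (q * real P) * 2 powr q * M))" if ls: "ls \<in> LL" for ls
    proof (rule ennreal_leI)
      have l: "ls \<noteq> []" "distinct ls" "set ls \<subseteq> \<Lambda>" "length ls \<le> P" using ls LLsub by (auto simp: LL_def)
      have "divdiff (\<lambda>s. g (z' + s *s w)) ls = divdiff (\<lambda>s. G (z' + s *s w)) ls"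
      proof (rule divdiff_cong)
        fix s assume "s \<in> set ls"
        then have s: "s \<in> \<Lambda>" using l by auto
        have "norm s < T t" using small[OF s] Tp by simp
        then have "z' + s *s w \<in> X \<inter> D" using Lam1(2)[OF s] T(3)[OF t] by (simp add: z'_def)
        then show "g (z' + s *s w) = G (z' + s *s w)" using G(2) by simp
      qed
      moreover have "norm (divdiff (\<lambda>s. G (z' + s *s w)) ls) \<le> 2 * S * (2 / (T t / 8)) ^ (length ls - 1)"
      proof (rule norm_divdiff_le)
        show "(\<lambda>s. G (z' + s *s w)) holomorphic_on cball 0 (T t / 8)"
        proof (rule holo_on_affine[OF G(1)])
          fix s :: complex assume "s \<in> cball 0 (T t / 8)"
          then have "norm s < T t" using Tp by simp
          then show "z' + s *s w \<in> D" unfolding z'_def by (rule T(3)[OF t])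
        qed
        show "norm (G (z' + s *s w)) \<le> S" if "norm s = T t / 8" for s
          unfolding z'_def by (rule Gbd[OF t]) (use that in simp)
      qed (use Tp l small in auto)
      ultimately have dd: "norm (divdiff (\<lambda>s. g (z' + s *s w)) ls) \<le> 2 * S * (16 / T t) ^ (length ls - 1)" by simp
      have k: "real (length ls) - 1 = real (length ls - 1)" using l(1) by (cases ls) auto
      show "\<delta> powr (q * ((real (length ls) - 1) / 2) + 1) * norm (divdiff (\<lambda>s. g (z' + s *s w)) ls) powr q
         \<le> \<delta> * ((32 / sqrt a) powr (q * real P) * 2 powr q * M)"
        unfolding k
        by (rule weighted_divdiff_term_le[OF dd norm_ge_zero S_def M0 q a \<delta>(1)])
           (use T(1)[OF t] l(4) in \<open>auto simp: c_def\<close>)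
    qed
    have "(\<Sum>\<^sub>\<infinity>ls\<in>LL. ennreal (\<delta> powr (q * ((real (length ls) - 1) / 2) + 1) * norm (divdiff (\<lambda>s. g (z' + s *s w)) ls) powr q))
       = (\<Sum>ls\<in>LL. ennreal (\<delta> powr (q * ((real (length ls) - 1) / 2) + 1) * norm (divdiff (\<lambda>s. g (z' + s *s w)) ls) powr q))"
      by (rule infsum_finite[OF LLfin])
    also have "\<dots> \<le> (\<Sum>ls\<in>LL. ennreal (\<delta> * ((32 / sqrt a) powr (q * real P) * 2 powr q * M)))"
      by (rule sum_mono) (rule tm)
    also have "\<dots> = ennreal (real (card LL)) * ennreal (\<delta> * ((32 / sqrt a) powr (q * real P) * 2 powr q * M))"
      by (simp add: ennreal_of_nat_eq_real_of_nat)
    also have "\<dots> \<le> ennreal (\<Sum>i\<le>P. real P ^ i) * ennreal (\<delta> * ((32 / sqrt a) powr (q * real P) * 2 powr q * M))"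
      by (intro mult_right_mono ennreal_leI LLcard) simp
    also have "\<dots> = ennreal B" unfolding B_def using \<delta> M0 by (intro ennreal_mult[symmetric] sum_nonneg) auto
    finally show ?thesis by (simp add: LL_def \<Lambda>_def z'_def)
  qed
  have ae: "AE t in Q. t \<in> PD \<longrightarrow> \<not> (\<forall>s. norm s < r0 \<longrightarrow> f (coord_point z W t + s *s w) = 0)"
  proof -
    obtain p U where U: "open U" "z \<in> U" "sheeted_covering {x \<in> N. f x = 0} U z w p"
      using W unfolding admissible_basis_def X w_def n_def by (elim conjE exE)
    have "AE t in Q. t \<in> PD \<longrightarrow> (\<exists>s. norm s < min c r0 \<and> f (coord_point z W t + s *s w) \<noteq> 0)"
      unfolding Q_def PD_def w_def n_def
    proof (rule AE_line_not_in_zero_set[OF Wb n f(1,2) U[unfolded w_def n_def]])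
      show "0 < 2 * \<kappa> * \<delta>" "0 < min c r0" using \<kappa> \<delta> c zeros(2) by auto
      show "coord_point z W t + s *s W CARD('n) \<in> N"
        if "t \<in> coord_polydisc CARD('n) (2 * \<kappa> * \<delta>)" "norm s < min c r0" for t s
        using z'w[of t s] that f(3) by (auto simp: PD_def w_def n_def)
    qed
    then show ?thesis
    proof (rule AE_mp, intro AE_I2 impI notI)
      fix t assume "t \<in> PD \<longrightarrow> (\<exists>s. norm s < min c r0 \<and> f (coord_point z W t + s *s w) \<noteq> 0)" "t \<in> PD"
        and 0: "\<forall>s. norm s < r0 \<longrightarrow> f (coord_point z W t + s *s w) = 0"
      then obtain s where "norm s < min c r0" "f (coord_point z W t + s *s w) \<noteq> 0" by blast
      then show False using 0 by simp
    qed
  qed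
  have "(\<integral>\<^sup>+ t. (\<Sum>\<^sub>\<infinity>ls\<in>{ls. ls \<noteq> [] \<and> distinct ls \<and> set ls \<subseteq> Lam \<rho> X \<kappa> (coord_point z W t) w}.
           ennreal (\<delta> powr (q * ((real (length ls) - 1) / 2) + 1)
                    * norm (divdiff (\<lambda>s. g (coord_point z W t + s *s w)) ls) powr q)) * indicator PD t \<partial>Q)
      \<le> (\<integral>\<^sup>+ t. ennreal B * indicator PD t \<partial>Q)"
  proof (rule nn_integral_mono_AE)
    show "AE t in Q. (\<Sum>\<^sub>\<infinity>ls\<in>{ls. ls \<noteq> [] \<and> distinct ls \<and> set ls \<subseteq> Lam \<rho> X \<kappa> (coord_point z W t) w}.
           ennreal (\<delta> powr (q * ((real (length ls) - 1) / 2) + 1)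
                    * norm (divdiff (\<lambda>s. g (coord_point z W t + s *s w)) ls) powr q)) * indicator PD t \<le> ennreal B * indicator PD t"
      using ae
    proof (rule AE_mp, intro AE_I2 impI)
      fix t assume t: "t \<in> PD \<longrightarrow> \<not> (\<forall>s. norm s < r0 \<longrightarrow> f (coord_point z W t + s *s w) = 0)"
      show "(\<Sum>\<^sub>\<infinity>ls\<in>{ls. ls \<noteq> [] \<and> distinct ls \<and> set ls \<subseteq> Lam \<rho> X \<kappa> (coord_point z W t) w}.
           ennreal (\<delta> powr (q * ((real (length ls) - 1) / 2) + 1)
                    * norm (divdiff (\<lambda>s. g (coord_point z W t + s *s w)) ls) powr q)) * indicator PD t \<le> ennreal B * indicator PD t"
      proof (cases "t \<in> PD")
        case True
        show ?thesis using t True by (intro mult_right_mono inner[OF True]) auto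
      qed simp
    qed
  qed
  also have "\<dots> = ennreal B * emeasure Q PD"
  proof (rule nn_integral_cmult_indicator)
    show "PD \<in> sets Q"
      unfolding PD_def Q_def coord_polydisc_eq_PiE[OF n[folded n_def]] by (rule sets_PiM_I_finite) auto
  qed
  also have "\<dots> \<le> ennreal B * ennreal (4 ^ n * \<delta> ^ n)"
  proof (rule mult_left_mono)
    have "emeasure Q PD \<le> ennreal (4 ^ n * (2 * \<kappa> * \<delta>) ^ n)"
      unfolding PD_def Q_def by (rule emeasure_coord_polydisc_le) (use n \<delta> \<kappa> in \<open>auto simp: n_def\<close>)
    also have "\<dots> \<le> ennreal (4 ^ n * \<delta> ^ n)"
    proof (intro ennreal_leI mult_left_mono power_mono)
      have "2 * \<kappa> * \<delta> \<le> 1 * \<delta>" using \<kappa> \<delta> by (intro mult_right_mono) auto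
      then show "2 * \<kappa> * \<delta> \<le> \<delta>" by simp
    qed (use \<kappa> \<delta> in auto)
    finally show "emeasure Q PD \<le> ennreal (4 ^ n * \<delta> ^ n)" .
  qed simp
  also have "\<dots> = ennreal (B * (4 ^ n * \<delta> ^ n))" using B0 \<delta> by (intro ennreal_mult[symmetric]) auto
  also have "B * (4 ^ n * \<delta> ^ n) = ((\<Sum>i\<le>P. real P ^ i) * (32 / sqrt a) powr (q * real P) * 2 powr q * 16 ^ n * 4 ^ n)
        * ((\<delta> ^ (n + 1) / v) * enn2real J)"
    by (simp add: B_def M_def mult_ac)
  also have "ennreal \<dots> = ennreal ((\<Sum>i\<le>P. real P ^ i) * (32 / sqrt a) powr (q * real P) * 2 powr q * 16 ^ n * 4 ^ n)
        * (ennreal (\<delta> ^ (n + 1) / v) * ennreal (enn2real J))"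
  proof -
    have "0 \<le> (\<Sum>i\<le>P. real P ^ i) * (32 / sqrt a) powr (q * real P) * 2 powr q * 16 ^ n * 4 ^ n"
      by (intro mult_nonneg_nonneg sum_nonneg) auto
    moreover have "0 \<le> \<delta> ^ (n + 1) / v" using v \<delta> by simp
    ultimately show ?thesis by (simp only: ennreal_mult enn2real_nonneg mult_nonneg_nonneg)
  qed
  also have "ennreal (enn2real J) = J" using J(2) by simp
  finally show ?thesis
    by (simp add: Let_def \<delta>_def w_def v_def Q_def PD_def n_def)
qed

section \<open>Levels of the covering and summation\<close>

text \<open>Convexity of \<open>\<rho>\<close> on the segments that join \<open>z\<close> and \<open>x\<close> to the two opposite points
  \<open>z + 4/3 * (x - z)\<close> and \<open>z - 4/3 * (x - z)\<close> of \<open>D\<close>.\<close>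
lemma disc_body_comparable:
  fixes \<rho> :: "complex^'n \<Rightarrow> real"
  assumes \<rho>: "strictly_convex \<rho>" and D: "D = sublevel \<rho> 0" and y: "x - z \<in> disc_body D z (3/4)"
  shows "\<bar>\<rho> z\<bar> \<le> 4 * \<bar>\<rho> x\<bar>" and "4 * \<bar>\<rho> x\<bar> \<le> 7 * \<bar>\<rho> z\<bar>"
proof -
  define y where "y = x - z"
  have neg: "\<rho> (z + s *s y) < 0" if "norm s \<le> 4/3" for s
    using disc_body_memD[OF y, of s] that by (simp add: D sublevel_def y_def)
  have zn: "\<rho> z < 0" and xn: "\<rho> x < 0" using neg[of 0] neg[of 1] by (simp_all add: y_def)
  define p where "p = z + complex_of_real (4/3) *s y"
  define m where "m = z + complex_of_real (- 4/3) *s y"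
  have pn: "\<rho> p < 0" and mn: "\<rho> m < 0" unfolding p_def m_def by (rule neg, simp)+
  have "(1 - 3/4) *\<^sub>R z + (3/4) *\<^sub>R p = x"
    by (simp add: p_def y_def scaleR_conv_smult vec_eq_iff field_simps)
  with strictly_convex_le[OF \<rho>, of "3/4" z p] have "\<rho> x \<le> (1/4) * \<rho> z + (3/4) * \<rho> p" by simp
  then show "\<bar>\<rho> z\<bar> \<le> 4 * \<bar>\<rho> x\<bar>" using pn zn xn by simp
  have "(1 - 3/7) *\<^sub>R x + (3/7) *\<^sub>R m = z"
    by (simp add: m_def y_def scaleR_conv_smult vec_eq_iff field_simps)
  with strictly_convex_le[OF \<rho>, of "3/7" x m] have "\<rho> z \<le> (4/7) * \<rho> x + (3/7) * \<rho> m" by simp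
  then show "4 * \<bar>\<rho> x\<bar> \<le> 7 * \<bar>\<rho> z\<bar>" using mn zn xn by simp
qed

lemma card_geometric_levels_le:
  fixes \<beta> \<epsilon> m :: real and lev :: "nat \<Rightarrow> nat"
  assumes \<beta>: "0 < \<beta>" "\<beta> < 1" "\<beta> ^ K < 1/7" and \<epsilon>: "0 < \<epsilon>" and fin: "finite F"
    and m: "\<And>j. j \<in> F \<Longrightarrow> m \<le> \<beta> ^ lev j * \<epsilon>" "\<And>j. j \<in> F \<Longrightarrow> \<beta> ^ lev j * \<epsilon> \<le> 7 * m"
  shows "card (lev ` F) \<le> K"
proof (cases "F = {}")
  case False
  define k0 where "k0 = Min (lev ` F)"
  have "k0 \<in> lev ` F" unfolding k0_def by (rule Min_in) (use fin False in auto)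
  then obtain i where i: "i \<in> F" "k0 = lev i" by auto
  have "lev ` F \<subseteq> {k0..<k0 + K}"
  proof
    fix k assume "k \<in> lev ` F"
    then obtain j where j: "j \<in> F" "k = lev j" by auto
    have ge: "k0 \<le> k" unfolding k0_def by (rule Min_le) (use fin \<open>k \<in> lev ` F\<close> in auto)
    have "k < k0 + K"
    proof (rule ccontr)
      assume "\<not> k < k0 + K"
      then have "\<beta> ^ k \<le> \<beta> ^ (k0 + K)" using \<beta> by (intro power_decreasing) auto
      also have "\<dots> < \<beta> ^ k0 * (1/7)" unfolding power_add using \<beta> by (intro mult_strict_left_mono) auto
      finally have "\<beta> ^ k * \<epsilon> < \<beta> ^ k0 * (1/7) * \<epsilon>" using \<epsilon> by (intro mult_strict_right_mono)
      then show False using m(1)[OF j(1)] m(2)[OF i(1)] by (simp add: i j)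
    qed
    then show "k \<in> {k0..<k0 + K}" using ge by simp
  qed
  from card_mono[OF _ this] show ?thesis by simp
qed simp

text \<open>A common point \<open>\<zeta> + u = \<xi> + v\<close> would place \<open>\<xi> - \<zeta> = u - v\<close> in a slab of size \<open>(5 + 2 * L) * r\<close> at \<open>\<zeta>\<close>:
  the normal component of \<open>v\<close> is small with respect to the normal at \<open>\<xi>\<close>, and replacing it by the normal
  at \<open>\<zeta>\<close> costs at most \<open>L * norm (\<xi> - \<zeta>) * norm v \<le> 2 * L * r\<close>.\<close>
lemma koranyi_separated_slabs_disjoint:
  fixes b :: "complex^'n \<Rightarrow> nat \<Rightarrow> complex^'n"
  assumes b: "orthonormal_basis (b \<zeta>)" and pos: "0 < r"
    and L: "norm (b \<xi> 1 - b \<zeta> 1) \<le> L * norm (\<xi> - \<zeta>)" "0 \<le> L"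
    and sep: "(5 + 2 * L) * r < koranyi_dist b \<zeta> \<xi>"
  shows "(+) \<zeta> ` {y. norm (hinner y (b \<zeta> 1)) < r \<and> (norm y)\<^sup>2 < r} \<inter>
         (+) \<xi> ` {y. norm (hinner y (b \<xi> 1)) < r \<and> (norm y)\<^sup>2 < r} = {}"
proof (rule ccontr)
  assume "\<not> ?thesis"
  then obtain u v where uv: "\<zeta> + u = \<xi> + v" "norm (hinner u (b \<zeta> 1)) < r" "(norm u)\<^sup>2 < r"
    "norm (hinner v (b \<xi> 1)) < r" "(norm v)\<^sup>2 < r" by blast
  have d: "\<xi> - \<zeta> = u - v" using uv(1) by (simp add: algebra_simps)
  have nu: "norm u \<le> sqrt r" "norm v \<le> sqrt r" using uv by (auto intro: real_le_rsqrt)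
  have nd: "norm (u - v) \<le> 2 * sqrt r" using norm_triangle_ineq4[of u v] nu by linarith
  have L5: "4 * r < (5 + 2 * L) * r" using L(2) pos by (simp add: mult_strict_right_mono)
  have sq: "(norm (u - v))\<^sup>2 \<le> 4 * r"
  proof -
    have "(norm (u - v))\<^sup>2 \<le> (2 * sqrt r)\<^sup>2" using nd by (intro power_mono) auto
    then show ?thesis using pos by (simp add: power_mult_distrib)
  qed
  have "norm (hinner v (b \<xi> 1 - b \<zeta> 1)) \<le> norm v * norm (b \<xi> 1 - b \<zeta> 1)" by (rule norm_hinner_le)
  also have "\<dots> \<le> sqrt r * (L * (2 * sqrt r))"
    using nu L nd by (intro mult_mono order_trans[OF L(1)] mult_left_mono) (auto simp: d pos less_imp_le)
  also have "\<dots> = 2 * L * r" using pos by (simp add: algebra_simps)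
  finally have v1: "norm (hinner v (b \<xi> 1 - b \<zeta> 1)) \<le> 2 * L * r" .
  have eq: "hinner (u - v) (b \<zeta> 1) = hinner u (b \<zeta> 1) - hinner v (b \<xi> 1) + hinner v (b \<xi> 1 - b \<zeta> 1)"
    by (simp add: hinner_diff_left hinner_diff_right)
  have "norm (hinner (u - v) (b \<zeta> 1)) < r + r + 2 * L * r"
    unfolding eq using uv(2,4) v1
      norm_triangle_ineq[of "hinner u (b \<zeta> 1) - hinner v (b \<xi> 1)" "hinner v (b \<xi> 1 - b \<zeta> 1)"]
      norm_triangle_ineq4[of "hinner u (b \<zeta> 1)" "hinner v (b \<xi> 1)"] by linarith
  also have "\<dots> \<le> (5 + 2 * L) * r" using pos by (simp add: algebra_simps)
  finally have "koranyi_dist b \<zeta> \<xi> \<le> (5 + 2 * L) * r"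
    using pos L(2) order_le_less_trans[OF sq L5] by (intro koranyi_dist_le[where b = b and z = \<zeta>, OF b]) (auto simp: d)
  then show False using sep by simp
qed

lemma kappa_covering_levels:
  assumes cov: "kappa_covering \<rho> b \<kappa> c \<epsilon>0 \<V> z" and \<rho>: "continuous_on UNIV \<rho>"
  obtains lev :: "nat \<Rightarrow> nat" where "\<And>j. \<rho> (z j) = - ((1 - c * \<kappa>) ^ lev j * \<epsilon>0)"
    "\<And>i j. i \<noteq> j \<Longrightarrow> lev i = lev j \<Longrightarrow> c * \<kappa> * ((1 - c * \<kappa>) ^ lev i * \<epsilon>0) \<le> koranyi_dist b (z i) (z j)"
proof -
  obtain m :: "nat \<Rightarrow> nat" and \<phi> where bij: "bij_betw \<phi> {(k, j). 1 \<le> j \<and> j \<le> m k} (UNIV :: nat set)"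
    and fr: "\<forall>k. \<forall>j\<in>{1..m k}. z (\<phi> (k, j)) \<in> frontier (sublevel \<rho> (- ((1 - c * \<kappa>) ^ k * \<epsilon>0)))"
    and sep: "\<forall>k. \<forall>i\<in>{1..m k}. \<forall>j\<in>{1..m k}. i \<noteq> j \<longrightarrow>
        koranyi_dist b (z (\<phi> (k, i))) (z (\<phi> (k, j))) \<ge> c * \<kappa> * ((1 - c * \<kappa>) ^ k * \<epsilon>0)"
    using cov unfolding kappa_covering_def Let_def by (elim exE conjE)
  define I where "I = {(k, j). 1 \<le> j \<and> j \<le> m k}"
  define \<psi> where "\<psi> = inv_into I \<phi>"
  have im: "j \<in> \<phi> ` I" for j using bij unfolding bij_betw_def I_def by blast
  have \<psi>: "\<phi> (\<psi> j) = j" "\<psi> j \<in> {(k, j). 1 \<le> j \<and> j \<le> m k}" for j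
    unfolding \<psi>_def I_def[symmetric] by (rule f_inv_into_f[OF im], rule inv_into_into[OF im])
  have mem: "snd (\<psi> j) \<in> {1..m (fst (\<psi> j))}" for j using \<psi>(2)[of j] by (auto simp: case_prod_beta)
  have zj: "z (\<phi> (fst (\<psi> j), snd (\<psi> j))) = z j" for j by (simp add: \<psi>(1))
  show ?thesis
  proof (rule that[of "\<lambda>j. fst (\<psi> j)"])
    fix j
    have "z j \<in> frontier (sublevel \<rho> (- ((1 - c * \<kappa>) ^ fst (\<psi> j) * \<epsilon>0)))"
      using fr[rule_format, OF mem[of j]] by (simp only: zj)
    then show "\<rho> (z j) = - ((1 - c * \<kappa>) ^ fst (\<psi> j) * \<epsilon>0)" by (rule frontier_sublevel[OF \<rho>])
  next
    fix i j :: nat assume ij: "i \<noteq> j" "fst (\<psi> i) = fst (\<psi> j)"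
    have ne: "snd (\<psi> i) \<noteq> snd (\<psi> j)"
    proof
      assume "snd (\<psi> i) = snd (\<psi> j)"
      then have "\<psi> i = \<psi> j" using ij(2) by (rule prod_eqI[rotated])
      then have "\<phi> (\<psi> i) = \<phi> (\<psi> j)" by (rule arg_cong)
      then show False using ij(1) by (simp add: \<psi>(1))
    qed
    have mi: "snd (\<psi> i) \<in> {1..m (fst (\<psi> j))}" using mem[of i] by (simp only: ij(2))
    have "c * \<kappa> * ((1 - c * \<kappa>) ^ fst (\<psi> j) * \<epsilon>0)
        \<le> koranyi_dist b (z (\<phi> (fst (\<psi> j), snd (\<psi> i)))) (z (\<phi> (fst (\<psi> j), snd (\<psi> j))))"
      by (rule sep[rule_format, OF mi mem[of j] ne])
    then show "c * \<kappa> * ((1 - c * \<kappa>) ^ fst (\<psi> i) * \<epsilon>0) \<le> koranyi_dist b (z i) (z j)"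
      by (simp only: zj ij(2)[symmetric]) (simp only: ij(2) zj)
  qed
qed

lemma nn_integral_Lq_norm:
  assumes G: "in_Lq q D G" and q: "0 < q"
  shows "(\<integral>\<^sup>+w. indicator D w * ennreal (norm (G w) powr q) \<partial>lborel) = ennreal (Lq_norm q D G powr q)"
proof -
  have int: "integrable lborel (\<lambda>x. indicator D x *\<^sub>R (norm (G x) powr q))"
    using G by (simp add: in_Lq_def set_integrable_def)
  have "(\<integral>\<^sup>+w. indicator D w * ennreal (norm (G w) powr q) \<partial>lborel)
      = (\<integral>\<^sup>+w. ennreal (indicator D w *\<^sub>R (norm (G w) powr q)) \<partial>lborel)"
    by (rule nn_integral_cong) (simp add: indicator_def)
  also have "\<dots> = ennreal (LINT w:D|lborel. norm (G w) powr q)"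
    unfolding set_lebesgue_integral_def by (rule nn_integral_eq_integral[OF int]) simp
  also have "(LINT w:D|lborel. norm (G w) powr q) = Lq_norm q D G powr q"
  proof -
    have "0 \<le> (LINT w:D|lborel. norm (G w) powr q)"
      unfolding set_lebesgue_integral_def by (rule integral_nonneg_AE) simp
    then show ?thesis using q by (simp add: Lq_norm_def powr_powr)
  qed
  finally show ?thesis .
qed

lemma borel_measurable_indicator_powr:
  fixes G :: "complex^'n \<Rightarrow> complex"
  assumes G: "in_Lq q D G" and q: "0 < q" and A: "A \<in> sets lborel" "A \<subseteq> D"
  shows "(\<lambda>w. indicator A w * ennreal (norm (G w) powr q)) \<in> borel_measurable lborel"
proof -
  have [measurable]: "(\<lambda>w. indicator D w *\<^sub>R G w) \<in> borel_measurable lborel" "A \<in> sets lborel"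
    using G A by (simp_all add: in_Lq_def set_borel_measurable_def)
  have "(\<lambda>w. indicator A w * ennreal (norm (indicator D w *\<^sub>R G w) powr q)) \<in> borel_measurable lborel"
    by measurable
  moreover have "(\<lambda>w. indicator A w * ennreal (norm (indicator D w *\<^sub>R G w) powr q))
      = (\<lambda>w. indicator A w * ennreal (norm (G w) powr q))"
    using A(2) by (auto simp: indicator_def fun_eq_iff)
  ultimately show ?thesis by simp
qed

text \<open>The sum and the integral are exchanged by monotone convergence. Since \<open>G\<close> is arbitrary outside
  \<open>D\<close>, measurability is obtained from the restriction of \<open>G\<close> to \<open>D\<close>.\<close>
lemma overlapping_integrals_le:
  fixes G :: "complex^'n \<Rightarrow> complex" and A :: "nat \<Rightarrow> (complex^'n) set"
  assumes G: "in_Lq q D G" and q: "0 < q" and A: "\<And>j. A j \<in> sets lborel" "\<And>j. A j \<subseteq> D"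
    and C: "0 \<le> C" "\<And>x. x \<in> D \<Longrightarrow> (\<Sum>j. indicator (A j) x * c j) \<le> ennreal C"
  shows "(\<Sum>j. c j * (\<integral>\<^sup>+w. indicator (A j) w * ennreal (norm (G w) powr q) \<partial>lborel))
     \<le> ennreal (C * Lq_norm q D G powr q)"
proof -
  note [measurable] = borel_measurable_indicator_powr[OF G q A]
  have "(\<Sum>j. c j * (\<integral>\<^sup>+w. indicator (A j) w * ennreal (norm (G w) powr q) \<partial>lborel))
      = (\<Sum>j. \<integral>\<^sup>+w. c j * (indicator (A j) w * ennreal (norm (G w) powr q)) \<partial>lborel)"
    by (intro suminf_cong nn_integral_cmult[symmetric]) measurable
  also have "\<dots> = (\<integral>\<^sup>+w. (\<Sum>j. c j * (indicator (A j) w * ennreal (norm (G w) powr q))) \<partial>lborel)"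
    by (rule nn_integral_suminf[symmetric]) measurable
  also have "\<dots> \<le> (\<integral>\<^sup>+w. ennreal C * (indicator D w * ennreal (norm (G w) powr q)) \<partial>lborel)"
  proof (rule nn_integral_mono)
    fix w
    have "(\<Sum>j. c j * (indicator (A j) w * ennreal (norm (G w) powr q)))
        = (\<Sum>j. indicator (A j) w * c j) * ennreal (norm (G w) powr q)"
      unfolding ennreal_suminf_multc[symmetric] by (intro suminf_cong) (simp only: mult_ac)
    also have "\<dots> \<le> ennreal C * (indicator D w * ennreal (norm (G w) powr q))"
    proof (cases "w \<in> D")
      case True
      then show ?thesis using mult_right_mono[OF C(2)[OF True]] by simp
    next
      case False
      then have "indicator (A j) w = (0 :: ennreal)" for j using A(2)[of j] by (auto simp: indicator_def)
      then show ?thesis by simp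
    qed
    finally show "(\<Sum>j. c j * (indicator (A j) w * ennreal (norm (G w) powr q)))
        \<le> ennreal C * (indicator D w * ennreal (norm (G w) powr q))" .
  qed
  also have "\<dots> = ennreal C * (\<integral>\<^sup>+w. indicator D w * ennreal (norm (G w) powr q) \<partial>lborel)"
  proof (rule nn_integral_cmult)
    have "(\<lambda>w. indicator D w *\<^sub>R (norm (G w) powr q)) \<in> borel_measurable lborel"
      using G unfolding in_Lq_def set_integrable_def by (intro borel_measurable_integrable) simp
    then have "(\<lambda>w. ennreal (indicator D w *\<^sub>R (norm (G w) powr q))) \<in> borel_measurable lborel" by measurable
    moreover have "(\<lambda>w. ennreal (indicator D w *\<^sub>R (norm (G w) powr q)))
       = (\<lambda>w. indicator D w * ennreal (norm (G w) powr q))" by (auto simp: indicator_def fun_eq_iff)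
    ultimately show "(\<lambda>w. indicator D w * ennreal (norm (G w) powr q)) \<in> borel_measurable lborel" by (simp only:)
  qed
  also have "\<dots> = ennreal (C * Lq_norm q D G powr q)"
    unfolding nn_integral_Lq_norm[OF G q] using C(1) by (simp add: ennreal_mult)
  finally show ?thesis .
qed

theorem theorem5p4:
  fixes \<rho> :: "complex^'n \<Rightarrow> real"
    and f :: "complex^'n \<Rightarrow> complex"
    and N X D :: "(complex^'n) set"
    and b :: "complex^'n \<Rightarrow> nat \<Rightarrow> complex^'n"
  assumes n: "CARD('n) \<ge> 2"
    and rho: "smooth \<rho>" "strictly_convex \<rho>"
    and D: "D = sublevel \<rho> 0" "bounded D"
    and grad: "\<exists>V. open V \<and> frontier D \<subseteq> V \<and> (\<forall>z\<in>V. grad \<rho> z \<noteq> 0)"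
    and f: "open N" "closure D \<subseteq> N" "holo_on f N" "minimal_defining f N"
    and X: "X = {z \<in> N. f z = 0}" "X \<inter> D \<noteq> {}"
    and transverse: "\<forall>p\<in>X \<inter> frontier D. transverse_at \<rho> X p"
    and frame: "adapted_frame \<rho> b"
  shows "\<exists>\<kappa>0>0. \<exists>c0>0. \<exists>e0>0. \<forall>\<kappa> c \<epsilon>0 q :: real.
           0 < \<kappa> \<and> \<kappa> < \<kappa>0 \<and> 0 < c \<and> c < c0 \<and> 0 < \<epsilon>0 \<and> \<epsilon>0 < e0 \<and> 1 \<le> q \<longrightarrow>
           (\<exists>C::real. C > 0 \<and>
             (\<forall>(z :: nat \<Rightarrow> complex^'n) (W :: nat \<Rightarrow> nat \<Rightarrow> complex^'n)
                (g :: complex^'n \<Rightarrow> complex) (G :: complex^'n \<Rightarrow> complex).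
                kappa_covering \<rho> b \<kappa> c \<epsilon>0 X z \<and>
                (\<forall>j. admissible_basis \<rho> X (z j) (W j)) \<and>
                holo_on_subset g (X \<inter> D) \<and>
                holo_on G D \<and> (\<forall>x\<in>X \<inter> D. G x = g x) \<and> in_Lq q D G \<longrightarrow>
                cq \<rho> X q \<kappa> z W g \<le> ennreal (C * Lq_norm q D G powr q)))"
proof -
  have \<rho>c: "continuous_on UNIV \<rho>" by (rule smooth_continuous[OF rho(1)])
  have oD: "open D" unfolding D(1) sublevel_def using open_Collect_less[OF \<rho>c continuous_on_const] by simp
  have cD: "convex D" unfolding D(1) by (rule convex_sublevel[OF rho(2)])
  obtain R where R: "\<And>x. x \<in> D \<Longrightarrow> norm x \<le> R" using D(2) by (auto simp: bounded_iff)
  have DN: "D \<subseteq> N" using f(2) closure_subset by blast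
  have cpt: "compact (closure D)" using D(2) by simp
  obtain r0 :: real and P :: nat where r0: "0 < r0" and zeros0: "\<And>x w. x \<in> closure D \<Longrightarrow> norm w = 1 \<Longrightarrow>
      (\<forall>s. norm s < r0 \<longrightarrow> f (x + s *s w) = 0) \<or>
      (finite {s. norm s < r0 \<and> f (x + s *s w) = 0} \<and> card {s. norm s < r0 \<and> f (x + s *s w) = 0} \<le> P)"
    by (fact uniform_line_zero_bound[OF f(1) cpt f(2,3)])
  have zeros: "(\<forall>s. norm s < r0 \<longrightarrow> f (x + s *s w) = 0) \<or>
      (finite {s. norm s < r0 \<and> f (x + s *s w) = 0} \<and> card {s. norm s < r0 \<and> f (x + s *s w) = 0} \<le> P)"
    if "x \<in> D" "norm w = 1" for x w
    by (rule zeros0[OF _ that(2)]) (use that(1) closure_subset in blast)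
  obtain a where a: "0 < a" "a \<le> 1" and slab: "\<And>\<zeta> y. \<zeta> \<in> D \<Longrightarrow> norm (hinner y (unit_normal \<rho> \<zeta>)) \<le> a * \<bar>\<rho> \<zeta>\<bar> \<Longrightarrow>
      (norm y)\<^sup>2 \<le> a * \<bar>\<rho> \<zeta>\<bar> \<Longrightarrow> y \<in> disc_body D \<zeta> 1"
    using slab_subset_disc_body[OF rho(1) D] by (elim exE conjE) blast
  obtain e L where e: "0 < e" and L: "0 \<le> L" and gr: "\<And>\<zeta>. \<zeta> \<in> D \<Longrightarrow> - e < \<rho> \<zeta> \<Longrightarrow> grad \<rho> \<zeta> \<noteq> 0"
    and lip: "\<And>\<zeta> \<xi>. \<zeta> \<in> D \<Longrightarrow> \<xi> \<in> D \<Longrightarrow> - e < \<rho> \<zeta> \<Longrightarrow> - e < \<rho> \<xi> \<Longrightarrow>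
        norm (unit_normal \<rho> \<zeta> - unit_normal \<rho> \<xi>) \<le> L * norm (\<zeta> - \<xi>)"
    using unit_normal_lipschitz_collar[OF rho(1) D grad] by (elim exE conjE) blast
  obtain cs where cs: "0 < cs" "\<And>\<eta> a. norm (\<eta> :: complex^'n) = 1 \<Longrightarrow> 0 < a \<Longrightarrow> a \<le> 1 \<Longrightarrow>
       ennreal (cs * a ^ (CARD('n) + 1)) \<le> emeasure lborel {y. norm (hinner y \<eta>) < a \<and> (norm y)\<^sup>2 < a}"
    using slab_volume_ge[where 'n = 'n] by (elim exE conjE) blast
  obtain d where "d \<in> D" using X(2) by blast
  have R0: "0 \<le> R" by (rule order_trans[OF norm_ge_zero R[OF \<open>d \<in> D\<close>]])
  \<comment> \<open>The three bounds serve, in this order: the points of \<open>Lam\<close> lie in a sixteenth of the disc of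
      radius \<open>tau\<close>, the polydisc is small compared with the slab, and the disc that contains \<open>Lam\<close> has
      radius at most \<open>r0\<close>.\<close>
  define \<kappa>0 where "\<kappa>0 = min (1/48) (min (a / (64 * (4 + 2 * real CARD('n)))) (r0 / (3 * (4 * R + 1))))"
  have pos64: "0 < 64 * (4 + 2 * real CARD('n))" and posR: "0 < 3 * (4 * R + 1)" using R0 by auto
  have \<kappa>0: "0 < \<kappa>0" using a pos64 r0 posR by (simp only: \<kappa>0_def min_less_iff_conj) simp
  have bound: "\<exists>C::real. C > 0 \<and> (\<forall>z W g G.
         kappa_covering \<rho> b \<kappa> c \<epsilon>0 X z \<and> (\<forall>j. admissible_basis \<rho> X (z j) (W j)) \<and>
         holo_on_subset g (X \<inter> D) \<and> holo_on G D \<and> (\<forall>x\<in>X \<inter> D. G x = g x) \<and> in_Lq q D G \<longrightarrow>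
         cq \<rho> X q \<kappa> z W g \<le> ennreal (C * Lq_norm q D G powr q))"
    if h: "0 < \<kappa>" "\<kappa> < \<kappa>0" "0 < c" "c < 1" "0 < \<epsilon>0" "\<epsilon>0 < min 1 e" "1 \<le> q" for \<kappa> c \<epsilon>0 q
  proof -
    have k1: "\<kappa> < 1/48" and k2: "\<kappa> < a / (64 * (4 + 2 * real CARD('n)))" and k3: "\<kappa> < r0 / (3 * (4 * R + 1))"
      using h(2) unfolding \<kappa>0_def min_less_iff_conj by blast+
    have k4: "64 * (4 + 2 * real CARD('n)) * \<kappa> \<le> a" using k2 pos64 by (simp add: pos_less_divide_eq mult.commute)
    have k5: "3 * \<kappa> * (4 * R + 1) \<le> r0" using k3 posR by (simp add: pos_less_divide_eq mult_ac)
    define \<beta> where "\<beta> = 1 - c * \<kappa>"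
    have ck: "0 < c * \<kappa>" using h by simp
    have "c * \<kappa> \<le> 1 * \<kappa>" using h by (intro mult_right_mono) auto
    then have \<beta>: "0 < \<beta>" "\<beta> < 1" using ck k1 by (auto simp: \<beta>_def)
    obtain K where K: "\<beta> ^ K < 1/7" using real_arch_pow_inv[of "1/7" \<beta>] \<beta> by auto
    \<comment> \<open>Slabs of relative size \<open>\<alpha>\<close> lie in the bodies, as \<open>\<alpha> \<le> a\<close>, and are disjoint within a level, as
        \<open>(5 + 2 * L) * \<alpha>\<close> is smaller than the separation constant \<open>c * \<kappa>\<close> of the covering.\<close>
    define \<alpha> where "\<alpha> = min a (c * \<kappa> / (2 * (5 + 2 * L)))"
    have L5: "0 < 2 * (5 + 2 * L)" using L by simp
    have \<alpha>: "0 < \<alpha>" "\<alpha> \<le> a" "\<alpha> \<le> 1" using a ck L5 by (auto simp: \<alpha>_def)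
    have \<alpha>L: "(5 + 2 * L) * \<alpha> < c * \<kappa>"
    proof -
      have "\<alpha> * (2 * (5 + 2 * L)) \<le> c * \<kappa>"
        using L5 by (simp only: \<alpha>_def pos_le_divide_eq[symmetric] min.cobounded2)
      then show ?thesis using ck by (simp add: algebra_simps)
    qed
    define C1 where "C1 = (\<Sum>i\<le>P. real P ^ i) * (32 / sqrt a) powr (q * real P) * 2 powr q * 16 ^ CARD('n) * 4 ^ CARD('n)"
    define C2 where "C2 = (7/4) ^ (2 * CARD('n)) * 7 ^ (2 * CARD('n)) * real K / (cs * \<alpha> ^ (CARD('n) + 1))"
    have C1: "0 \<le> C1" unfolding C1_def by (intro mult_nonneg_nonneg sum_nonneg) auto
    have C2: "0 \<le> C2" unfolding C2_def using cs \<alpha> by (intro divide_nonneg_nonneg mult_nonneg_nonneg) auto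
    \<comment> \<open>Adding \<open>1\<close> only makes the constant positive.\<close>
    have main: "cq \<rho> X q \<kappa> z W g \<le> ennreal ((C1 * C2 + 1) * Lq_norm q D G powr q)"
      if cov: "kappa_covering \<rho> b \<kappa> c \<epsilon>0 X z" and adm: "\<And>j. admissible_basis \<rho> X (z j) (W j)"
        and G: "holo_on G D" "\<And>x. x \<in> X \<inter> D \<Longrightarrow> G x = g x" "in_Lq q D G" for z W g G
    proof -
      obtain lev :: "nat \<Rightarrow> nat" where lev: "\<And>j. \<rho> (z j) = - (\<beta> ^ lev j * \<epsilon>0)"
        and sep: "\<And>i j. i \<noteq> j \<Longrightarrow> lev i = lev j \<Longrightarrow> c * \<kappa> * (\<beta> ^ lev i * \<epsilon>0) \<le> koranyi_dist b (z i) (z j)"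
        by (fact kappa_covering_levels[OF cov \<rho>c, folded \<beta>_def])
      define r where "r j = \<bar>\<rho> (z j)\<bar>" for j
      have rl: "r j = \<beta> ^ lev j * \<epsilon>0" for j using \<beta> h by (simp add: r_def lev)
      have rpos: "0 < r j" for j unfolding rl using \<beta> h by simp
      have re: "r j \<le> \<epsilon>0" for j unfolding rl using \<beta> h by (intro mult_left_le_one_le power_le_one) auto
      have r1: "r j \<le> 1" for j using re[of j] h by simp
      have \<rho>z: "\<rho> (z j) = - r j" for j by (simp add: rl lev)
      have zD: "z j \<in> D" for j using rpos[of j] by (simp add: D(1) sublevel_def \<rho>z)
      have ze: "- e < \<rho> (z j)" for j using re[of j] h by (simp add: \<rho>z)
      have fr: "orthonormal_basis (b (z j))" "b (z j) 1 = unit_normal \<rho> (z j)" for j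
        using frame gr[OF zD ze, of j] unfolding adapted_frame_def by blast+
      define \<eta> where "\<eta> j = unit_normal \<rho> (z j)" for j
      have \<eta>1: "norm (\<eta> j) = 1" for j
        unfolding \<eta>_def fr(2)[symmetric] by (rule norm_orthonormal_basis[OF fr(1)]) (use n in auto)
      define A where "A j = (+) (z j) ` disc_body D (z j) (3/4)" for j
      have Asub: "A j \<subseteq> D" for j
      proof
        fix x assume "x \<in> A j"
        then obtain y where "x = z j + y" "y \<in> disc_body D (z j) (3/4)" by (auto simp: A_def)
        then show "x \<in> D" using disc_body_memD[of y D "z j" "3/4" 1] by simp
      qed
      have oA: "open (A j)" for j unfolding A_def by (intro open_translation open_disc_body oD) simp
      define J where "J j = (\<integral>\<^sup>+w. indicator (A j) w * ennreal (norm (G w) powr q) \<partial>lborel)" for j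
      have q0: "0 < q" using h(7) by simp
      have Jfin: "J j < \<infinity>" for j
      proof -
        have "J j \<le> (\<integral>\<^sup>+w. indicator D w * ennreal (norm (G w) powr q) \<partial>lborel)"
          unfolding J_def using Asub[of j] by (intro nn_integral_mono mult_right_mono) (auto simp: indicator_def)
        then show ?thesis unfolding nn_integral_Lq_norm[OF G(3) q0] using le_less_trans by fastforce
      qed
      define v where "v j = measure lborel (disc_body D (z j) 1)" for j
      have overlap: "(\<Sum>j. indicator (A j) x * ennreal (r j ^ (CARD('n) + 1) / v j)) \<le> ennreal C2" if x: "x \<in> D" for x
      proof -
        have "(\<Sum>j. indicator (disc_body D (z j) (3/4)) (x - z j) * ennreal (r j ^ (CARD('n) + 1) / v j)) \<le> ennreal C2"
          unfolding C2_def v_def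
        proof (rule bounded_overlap[where \<eta> = \<eta> and lev = lev, OF oD D(2) cD cs zD rpos \<alpha>(1) _ \<eta>1 _ _ _ x])
          fix j
          have "\<alpha> * r j \<le> 1 * 1" using \<alpha> r1[of j] rpos[of j] by (intro mult_mono) auto
          then show "\<alpha> * r j \<le> 1" by simp
          have "\<alpha> * r j \<le> a * r j" using \<alpha> rpos[of j] by (intro mult_right_mono) auto
          then show "{y. norm (hinner y (\<eta> j)) < \<alpha> * r j \<and> (norm y)\<^sup>2 < \<alpha> * r j} \<subseteq> disc_body D (z j) 1"
            by (intro subsetI slab[OF zD]) (auto simp: \<eta>_def r_def)
        next
          fix i j :: nat assume ij: "i \<noteq> j" "lev i = lev j"
          have rij: "r i = r j" by (simp only: rl ij(2))
          have "(5 + 2 * L) * (\<alpha> * r j) < koranyi_dist b (z i) (z j)"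
          proof -
            have "((5 + 2 * L) * \<alpha>) * r j < c * \<kappa> * r j" using \<alpha>L rpos[of j] by (intro mult_strict_right_mono)
            also have "\<dots> \<le> koranyi_dist b (z i) (z j)" using sep[OF ij] by (simp only: rl ij(2))
            finally show ?thesis by (simp only: mult.assoc)
          qed
          moreover have "0 < \<alpha> * r j" using \<alpha> rpos[of j] by simp
          moreover have "norm (b (z j) 1 - b (z i) 1) \<le> L * norm (z j - z i)"
            unfolding fr(2) by (rule lip[OF zD zD ze ze])
          ultimately show "(+) (z i) ` {y. norm (hinner y (\<eta> i)) < \<alpha> * r i \<and> (norm y)\<^sup>2 < \<alpha> * r i} \<inter>
             (+) (z j) ` {y. norm (hinner y (\<eta> j)) < \<alpha> * r j \<and> (norm y)\<^sup>2 < \<alpha> * r j} = {}"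
            unfolding rij \<eta>_def fr(2)[symmetric]
            by (intro koranyi_separated_slabs_disjoint[where b = b, OF fr(1) _ _ L])
        next
          fix F :: "nat set" assume F: "finite F" "\<And>j. j \<in> F \<Longrightarrow> x - z j \<in> disc_body D (z j) (3/4)"
          show "card (lev ` F) \<le> K"
          proof (rule card_geometric_levels_le[OF \<beta> K h(5) F(1)])
            fix j assume j: "j \<in> F"
            show "4 / 7 * \<bar>\<rho> x\<bar> \<le> \<beta> ^ lev j * \<epsilon>0" "\<beta> ^ lev j * \<epsilon>0 \<le> 7 * (4 / 7 * \<bar>\<rho> x\<bar>)"
              using disc_body_comparable[OF rho(2) D(1) F(2)[OF j]] unfolding rl[symmetric] r_def[symmetric] by auto
          qed
        qed
        moreover have "indicator (A j) x = (indicator (disc_body D (z j) (3/4)) (x - z j) :: ennreal)" for j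
        proof -
          have "x \<in> A j \<longleftrightarrow> x - z j \<in> disc_body D (z j) (3/4)"
            unfolding A_def by (auto intro!: image_eqI[of _ _ "x - z j"])
          then show ?thesis by (simp only: indicator_def)
        qed
        ultimately show ?thesis by simp
      qed
      have "cq \<rho> X q \<kappa> z W g \<le> (\<Sum>j. ennreal C1 * (ennreal (r j ^ (CARD('n) + 1) / v j) * J j))"
        unfolding cq_def C1_def r_def v_def
        by (intro suminf_le summableI
            polydisc_integral_le[OF n D(1) oD cD D(2) R a slab[OF zD] f(3,1) DN X(1) zeros r0 h(1) _ k4 k5 zD _ adm G(1,2) h(7) J_def[unfolded A_def] Jfin])
           (use k1 r1 in \<open>auto simp: r_def\<close>)
      also have "\<dots> = ennreal C1 * (\<Sum>j. ennreal (r j ^ (CARD('n) + 1) / v j) * J j)"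
        by (rule ennreal_suminf_cmult)
      also have "\<dots> \<le> ennreal C1 * ennreal (C2 * Lq_norm q D G powr q)"
        unfolding J_def
        by (intro mult_left_mono overlapping_integrals_le[OF G(3) q0 _ Asub C2 overlap]) (use oA in auto)
      also have "\<dots> = ennreal (C1 * C2 * Lq_norm q D G powr q)"
        using C1 C2 by (simp add: ennreal_mult[symmetric] mult.assoc)
      also have "\<dots> \<le> ennreal ((C1 * C2 + 1) * Lq_norm q D G powr q)"
        by (intro ennreal_leI mult_right_mono) auto
      finally show ?thesis .
    qed
    show ?thesis
    proof (intro exI[of _ "C1 * C2 + 1"] conjI allI impI)
      show "0 < C1 * C2 + 1" using mult_nonneg_nonneg[OF C1 C2] by linarith
      fix z W g G
      assume "kappa_covering \<rho> b \<kappa> c \<epsilon>0 X z \<and> (\<forall>j. admissible_basis \<rho> X (z j) (W j)) \<and>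
         holo_on_subset g (X \<inter> D) \<and> holo_on G D \<and> (\<forall>x\<in>X \<inter> D. G x = g x) \<and> in_Lq q D G"
      then show "cq \<rho> X q \<kappa> z W g \<le> ennreal ((C1 * C2 + 1) * Lq_norm q D G powr q)"
        by (elim conjE) (rule main; blast)
    qed
  qed
  have e0: "0 < min 1 e" using e by simp
  show ?thesis
  proof (intro exI conjI)
    show "0 < \<kappa>0" "(0::real) < 1" "0 < min 1 e" by (fact \<kappa>0 zero_less_one e0)+
    show "\<forall>\<kappa> c \<epsilon>0 q. 0 < \<kappa> \<and> \<kappa> < \<kappa>0 \<and> 0 < c \<and> c < 1 \<and> 0 < \<epsilon>0 \<and> \<epsilon>0 < min 1 e \<and> 1 \<le> q \<longrightarrow>
       (\<exists>C::real. C > 0 \<and> (\<forall>z W g G.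
         kappa_covering \<rho> b \<kappa> c \<epsilon>0 X z \<and> (\<forall>j. admissible_basis \<rho> X (z j) (W j)) \<and>
         holo_on_subset g (X \<inter> D) \<and> holo_on G D \<and> (\<forall>x\<in>X \<inter> D. G x = g x) \<and> in_Lq q D G \<longrightarrow>
         cq \<rho> X q \<kappa> z W g \<le> ennreal (C * Lq_norm q D G powr q)))"
      by (intro allI impI, elim conjE, rule bound)
  qed
qed

end
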